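(* Let $Z$ be a real valued symmetric Lévy process with characteristic exponent $\psi$, i.e. $E(e^{i\lambda Z_t})=e^{-t\psi(\lambda)}$ for all $t\ge 0$, where $\psi$ is an even function with $\frac{1}{1+\psi(\lambda)}\in L^1(\mathbb R^1)$. Let $\beta>0$ and set $$u^\beta(x)=\frac{1}{2\pi}\int_{-\infty}^\infty\frac{\cos\lambda x}{\beta+\psi(\lambda)}\,d\lambda,\qquad (\sigma^\beta)^2(x)=2\left(u^\beta(0)-u^\beta(x)\right)=\frac1\pi\int_{-\infty}^{\infty}\frac{1-\cos\lambda x}{\beta+\psi(\lambda)}\,d\lambda,\qquad x\in\mathbb R^1,$$ $$v^\beta(x,y)=u^\beta(x-y)-\frac{u^\beta(x)u^\beta(y)}{u^\beta(0)},\qquad x,y\in\mathbb R^1 .$$ Let $\mu$ be a finite positive measure on $\mathbb R^1$ with $\mu(\{0\})=0$, and set $$f_{u^\beta,\mu}(y)=\int_{-\infty}^\infty u^\beta(x-y)\,d\mu(x),\qquad f_{v^\beta,\mu}(y)=\int_{-\infty}^\infty v^\beta(x,y)\,d\mu(x),\qquad v(x,y)=v^\beta(x,y)+f_{v^\beta,\mu}(y).$$ Let $\alpha>0$ and let $\{X_\alpha(x),\ x\in[0,1]\}$ be an $\alpha$-permanental process with kernel $\{v(x,y),\ x,y\in[0,1]\}$. Assume that $(\sigma^\beta)^2\in C^1(\mathbb R^1-\{0\})$, that $\left|\left((\sigma^\beta)^2\right)'\right|$ is bounded on $(-\infty,-\Delta)\cup(\Delta,\infty)$ for all $\Delta>0$,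 and that $(\sigma^\beta)^2$ is regularly varying at zero with positive index. Then $X_\alpha(t)$ is continuous on $[0,\delta]$ for some $\delta>0$. Furthermore: (i) when $\displaystyle\lim_{t\downarrow 0}\frac{t}{(\sigma^\beta)^2(t)}=0$, $$\limsup_{t\downarrow 0}\frac{X_\alpha(t)}{(\sigma^\beta)^2(t)\log\log 1/t}\le 1+\frac{f_{u^\beta,\mu}(0)}{2u^\beta(0)}\qquad\text{a.s.};$$ (ii) when $\displaystyle\lim_{t\downarrow 0}\frac{t}{(\sigma^\beta)^2(t)}=\frac1C$ for some $C>0$, $$\limsup_{t\downarrow 0}\frac{X_\alpha(t)}{C\,t\log\log 1/t}\le 1+\frac{f_{u^\beta,\mu}(0)}{2u^\beta(0)}+\frac{1}{2C}\int_{-\infty}^{\infty}\left((\sigma^\beta)^2\right)'(v)\,d\mu(v)\qquad\text{a.s.}$$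
   Context: For $\alpha>0$, an $\alpha$-permanental process with kernel $K=\{K(s,t),\ s,t\in[0,1]\}$ is a stochastic process $\{X_\alpha(t),\ t\in[0,1]\}$ with nonnegative values such that for all $n$, all $t_1,\dots,t_n\in[0,1]$ and all $s_1,\dots,s_n>0$, $$E\left(e^{-\sum_{i=1}^n s_iX_\alpha(t_i)}\right)=\frac{1}{\det\left(I+\mathcal K\,\Sigma\right)^{\alpha}},$$ where $\mathcal K=\{K(t_i,t_j)\}_{i,j=1}^n$ and $\Sigma$ is the diagonal matrix with entries $s_1,\dots,s_n$. Sample path statements are, as usual, understood for a suitable (separable, respectively continuous) version of the process. $u^\beta(x-y)$ is the potential density, with respect to Lebesgue measure, of $Z$ killed at an independent exponential time with mean $1/\beta$; $v^\beta$, restricted to $(\mathbb R^1-\{0\})^2$, is the potential density of that killed process when it is further killed the first time it hits $0$. It is known that an $\alpha$-permanental process with kernel $v$ on $[0,1]$ exists for every $\alpha>0$. *)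

theory Defs
  imports "HOL-Probability.Probability" "Jordan_Normal_Form.Determinant"
begin

section \<open>Symmetric Levy processes\<close>

text \<open>The time set is \<open>[0,\<infinity>)\<close>; the values of \<open>Z\<close> at negative times are irrelevant.
  In the independence clause \<open>t 0\<close> may be \<open>0\<close>, so that, as \<open>Z 0 = 0\<close> almost surely, the
  increments from time \<open>0\<close> on are covered.\<close>

definition levy_process :: "'a measure \<Rightarrow> (real \<Rightarrow> 'a \<Rightarrow> real) \<Rightarrow> bool" where
  "levy_process N Z \<longleftrightarrow>
     prob_space N \<and>
     (\<forall>t\<ge>0. Z t \<in> borel_measurable N) \<and>
     (AE \<omega> in N. Z 0 \<omega> = 0) \<and>
     (\<forall>(n::nat) (t::nat \<Rightarrow> real). 0 \<le> t 0 \<and> (\<forall>i<n. t i \<le> t (Suc i)) \<longrightarrow>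
        prob_space.indep_vars N (\<lambda>_. borel) (\<lambda>i \<omega>. Z (t (Suc i)) \<omega> - Z (t i) \<omega>) {..<n}) \<and>
     (\<forall>s\<ge>0. \<forall>t\<ge>0. distr N borel (\<lambda>\<omega>. Z (s + t) \<omega> - Z s \<omega>) = distr N borel (Z t)) \<and>
     (AE \<omega> in N. (\<forall>t\<ge>0. continuous (at_right t) (\<lambda>s. Z s \<omega>)) \<and>
                 (\<forall>t>0. \<exists>l. ((\<lambda>s. Z s \<omega>) \<longlongrightarrow> l) (at_left t)))"

definition symmetric_process :: "'a measure \<Rightarrow> (real \<Rightarrow> 'a \<Rightarrow> real) \<Rightarrow> bool" where
  "symmetric_process N Z \<longleftrightarrow>
     (\<forall>t\<ge>0. distr N borel (\<lambda>\<omega>. - Z t \<omega>) = distr N borel (Z t))"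

text \<open>The exponent of a symmetric process is real valued.\<close>

definition characteristic_exponent ::
    "'a measure \<Rightarrow> (real \<Rightarrow> 'a \<Rightarrow> real) \<Rightarrow> (real \<Rightarrow> real) \<Rightarrow> bool" where
  "characteristic_exponent N Z \<psi> \<longleftrightarrow>
     (\<forall>t\<ge>0. \<forall>l. (LINT \<omega>|N. exp (\<i> * complex_of_real (l * Z t \<omega>)))
                  = complex_of_real (exp (- (t * \<psi> l))))"


section \<open>Potential densities and kernels\<close>

definition u_pot :: "(real \<Rightarrow> real) \<Rightarrow> real \<Rightarrow> real \<Rightarrow> real" where
  "u_pot \<psi> \<beta> x = 1 / (2 * pi) * (LINT l|lborel. cos (l * x) / (\<beta> + \<psi> l))"

definition sigma_sq :: "(real \<Rightarrow> real) \<Rightarrow> real \<Rightarrow> real \<Rightarrow> real" where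
  "sigma_sq \<psi> \<beta> x = 2 * (u_pot \<psi> \<beta> 0 - u_pot \<psi> \<beta> x)"

definition v_pot :: "(real \<Rightarrow> real) \<Rightarrow> real \<Rightarrow> real \<Rightarrow> real \<Rightarrow> real" where
  "v_pot \<psi> \<beta> x y =
     u_pot \<psi> \<beta> (x - y) - u_pot \<psi> \<beta> x * u_pot \<psi> \<beta> y / u_pot \<psi> \<beta> 0"

definition f_u :: "(real \<Rightarrow> real) \<Rightarrow> real \<Rightarrow> real measure \<Rightarrow> real \<Rightarrow> real" where
  "f_u \<psi> \<beta> \<mu> y = (LINT x|\<mu>. u_pot \<psi> \<beta> (x - y))"

definition f_v :: "(real \<Rightarrow> real) \<Rightarrow> real \<Rightarrow> real measure \<Rightarrow> real \<Rightarrow> real" where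
  "f_v \<psi> \<beta> \<mu> y = (LINT x|\<mu>. v_pot \<psi> \<beta> x y)"

definition v_kernel :: "(real \<Rightarrow> real) \<Rightarrow> real \<Rightarrow> real measure \<Rightarrow> real \<Rightarrow> real \<Rightarrow> real" where
  "v_kernel \<psi> \<beta> \<mu> x y = v_pot \<psi> \<beta> x y + f_v \<psi> \<beta> \<mu> y"


section \<open>Permanental processes\<close>

text \<open>The determinant is automatically positive: the left-hand side is positive, so the
  determinant never vanishes, and it tends to \<open>1\<close> as the \<open>s i\<close> tend to \<open>0\<close>. Hence the
  values of \<open>powr\<close> at nonpositive bases play no role.\<close>

definition permanental_process ::
    "'b measure \<Rightarrow> real \<Rightarrow> (real \<Rightarrow> real \<Rightarrow> real) \<Rightarrow> real set \<Rightarrow> (real \<Rightarrow> 'b \<Rightarrow> real) \<Rightarrow> bool" where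
  "permanental_process M \<alpha> K T X \<longleftrightarrow>
     prob_space M \<and>
     (\<forall>t\<in>T. X t \<in> borel_measurable M) \<and>
     (\<forall>t\<in>T. \<forall>\<omega>\<in>space M. 0 \<le> X t \<omega>) \<and>
     (\<forall>(n::nat) (t::nat \<Rightarrow> real) (s::nat \<Rightarrow> real).
        (\<forall>i<n. t i \<in> T \<and> 0 < s i) \<longrightarrow>
        (LINT \<omega>|M. exp (- (\<Sum>i<n. s i * X (t i) \<omega>))) =
          1 / (Determinant.det (1\<^sub>m n + Matrix.mat n n (\<lambda>(i, j). K (t i) (t j)) * mat_diag n s))
                powr \<alpha>)"

definition version_on ::
    "'b measure \<Rightarrow> real set \<Rightarrow> (real \<Rightarrow> 'b \<Rightarrow> real) \<Rightarrow> (real \<Rightarrow> 'b \<Rightarrow> real) \<Rightarrow> bool" where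
  "version_on M T X Y \<longleftrightarrow>
     (\<forall>t\<in>T. Y t \<in> borel_measurable M \<and> (AE \<omega> in M. Y t \<omega> = X t \<omega>))"

text \<open>\<open>Y\<close> is a version of the process \<open>X\<close> on \<open>[0,1]\<close> whose paths are almost surely
  continuous on \<open>[0,\<delta>]\<close>, for the deterministic number \<open>\<delta>\<close>.\<close>

definition continuous_version ::
    "'b measure \<Rightarrow> (real \<Rightarrow> 'b \<Rightarrow> real) \<Rightarrow> real \<Rightarrow> (real \<Rightarrow> 'b \<Rightarrow> real) \<Rightarrow> bool" where
  "continuous_version M X \<delta> Y \<longleftrightarrow>
     version_on M {0..1} X Y \<and> (AE \<omega> in M. continuous_on {0..\<delta>} (\<lambda>t. Y t \<omega>))"


section \<open>Regular variation at zero\<close>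

definition regularly_varying_at_zero :: "(real \<Rightarrow> real) \<Rightarrow> real \<Rightarrow> bool" where
  "regularly_varying_at_zero f \<rho> \<longleftrightarrow>
     (\<forall>\<^sub>F t in at_right 0. 0 < f t) \<and>
     (\<forall>c>0. ((\<lambda>t. f (c * t) / f t) \<longlongrightarrow> c powr \<rho>) (at_right 0))"

end

theory Submission
  imports Defs "HOL-Complex_Analysis.Cauchy_Integral_Formula" "HOL-Real_Asymp.Real_Asymp"
begin

text \<open>Write \<open>\<sigma>\<^sup>2 = (\<sigma>\<^sup>\<beta>)\<^sup>2\<close>. By the maximum principle for the \<open>\<beta>\<close>-potential operator,
  \<open>\<bar>u (x + t) - u x\<bar> \<le> \<sigma>\<^sup>2 t / 2\<close>. Hence \<open>\<sigma>\<^sup>2\<close> is subadditive, and dominated convergence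
  gives \<open>v (t, t) / \<sigma>\<^sup>2 t \<longlongrightarrow> 1 + f\<^sub>u 0 / (2 u 0) + (c / 2) \<integral> (\<sigma>\<^sup>2)' d\<mu>\<close> as \<open>t \<down> 0\<close>, where \<open>c\<close> is the limit
  of \<open>t / \<sigma>\<^sup>2 t\<close>; this is the constant in both bounds. The one-point laws are gamma laws with scale
  \<open>v (t, t)\<close>, which yields the bound along a geometric sequence. The two-point Laplace transform
  extends to mixed signs, so increments \<open>X s - X t\<close> have exponential tails, whose scale is
  of order \<open>\<sigma> (s - t) \<sigma> T\<close> on \<open>[0, T]\<close>. Dyadic chaining then gives a continuous version and shows that the
  oscillation between consecutive terms of the sequence is negligible as its ratio tends to \<open>1\<close>.\<close>

section \<open>Laplace transforms of permanental processes\<close>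

text \<open>The kernel is in general not symmetric, because \<open>f_v\<close> enters through the
  second argument only; so instead of squared Gaussian processes the proof uses one- and two-point
  Laplace transforms, that is, determinants of size at most two. The scale of an increment is read
  off from the two-point determinant, which has a factor \<open>sigma_sq (s - t)\<close> and a
  factor of order \<open>sigma_sq T\<close>. Exponential tails are weaker than Gaussian ones, but
  chaining survives: a positive index of regular variation gives some q < 1 with
  \<open>sigma_sq (t / 2) <= q * sigma_sq t\<close>, so the scale at dyadic level k is of order
  \<open>sqrt q ^ k\<close> and only a factor k + 1 is lost. Starting at level m instead of 0 makes
  the oscillation on a block of ratio 1 - 2^-m proportional to \<open>sqrt q ^ m\<close>. The
  maximum principle is used for two purposes: subadditivity replaces monotonicity of
  \<open>sigma_sq\<close>, and the constant 1/2 is a majorant for the integral against \<mu> even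
  where the derivative is large near 0. Cases (i) and (ii) are the values c = 0 and c = 1/C of one
  computation.\<close>

lemma sums_of_suminf_ennreal:
  fixes f :: "nat \<Rightarrow> real"
  assumes "\<And>n. 0 \<le> f n" "(\<Sum>n. ennreal (f n)) = ennreal r" "0 \<le> r"
  shows "f sums r"
proof -
  have s: "summable f"
    using assms by (intro summable_suminf_not_top) auto
  then have "(\<Sum>n. ennreal (f n)) = ennreal (suminf f)"
    using assms by (intro suminf_ennreal2) auto
  with assms(2) have "ennreal (suminf f) = ennreal r" by simp
  then have "suminf f = r"
    by (rule ennreal_inj[THEN iffD1, rotated 2]) (use assms s in \<open>auto intro: suminf_nonneg\<close>)
  then show ?thesis using s by (simp add: sums_iff)
qed

text \<open>A nonzero power series has an isolated zero at 0, while here zeros accumulate at 0 from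
  the right. One-sided data are what the expansions of Laplace transforms provide.\<close>

lemma power_series_eqI_right:
  fixes a :: "nat \<Rightarrow> real"
  assumes "0 < r" and "\<And>y. 0 \<le> y \<Longrightarrow> y < r \<Longrightarrow> (\<lambda>n. a n * y ^ n) sums 0"
  shows "a n = 0"
proof (rule ccontr)
  assume n: "a n \<noteq> 0"
  define f where "f x = (\<Sum>n. a n * x ^ n)" for x
  \<comment> \<open>Convergence at \<open>r / 2\<close> gives convergence on a two-sided disc,
    negative arguments included.\<close>
  have sm: "summable (\<lambda>n. a n * x ^ n)" if "\<bar>x\<bar> < r / 2" for x
  proof (rule powser_inside)
    show "summable (\<lambda>n. a n * (r / 2) ^ n)"
      using assms(2)[of "r / 2"] assms(1) by (auto simp: sums_iff)
    show "norm x < norm (r / 2)" using that by simp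
  qed
  have f0: "f y = 0" if "0 \<le> y" "y < r" for y
    using assms(2)[OF that] by (simp add: f_def sums_iff)
  have "a 0 = 0"
    using assms(2)[of 0] assms(1) by (intro sums_unique2[OF powser_sums_zero[of a]]) auto
  with n have "n > 0" by (cases n) auto
  have "(\<lambda>n. a n * (x - 0) ^ n) sums (f x)" if "norm (x - 0) < r / 2" for x
    using sm[of x] that by (simp add: f_def summable_sums)
  moreover have "0 < r / 2" "f 0 = 0" using f0[of 0] assms(1) by auto
  ultimately obtain s where s: "0 < s" "\<And>z. z \<in> cball 0 s - {0} \<Longrightarrow> f z \<noteq> 0"
    using powser_0_nonzero[of "r / 2" 0 a f n] n \<open>n > 0\<close> by blast
  define z where "z = min s (r / 2)"
  have "f z = 0" using f0[of z] s(1) assms(1) by (auto simp: z_def)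
  moreover have "f z \<noteq> 0" using s assms(1) by (intro s(2)) (auto simp: z_def)
  ultimately show False by simp
qed

text \<open>Both sides expand as power series in \<open>y = 1 - s\<close>; the series agree on \<open>[0,1)\<close>, hence
  everywhere, and the left one has nonnegative terms.\<close>

lemma laplace_transform_extend:
  fixes X w :: "'a \<Rightarrow> real"
  assumes [measurable]: "X \<in> borel_measurable M" "w \<in> borel_measurable M"
    and X0: "\<And>x. x \<in> space M \<Longrightarrow> 0 \<le> X x" and w0: "\<And>x. x \<in> space M \<Longrightarrow> 0 \<le> w x"
    and L: "\<And>s. 0 < s \<Longrightarrow>
      (\<integral>\<^sup>+x. ennreal (w x * exp (- (s * X x))) \<partial>M) = ennreal (c * (1 + s * \<kappa>) powr (- \<alpha>))"
    and "0 \<le> \<kappa>" "0 \<le> c" "0 \<le> \<theta>" "\<theta> * \<kappa> < 1"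
  shows "(\<integral>\<^sup>+x. ennreal (w x * exp (\<theta> * X x)) \<partial>M) = ennreal (c * (1 - \<theta> * \<kappa>) powr (- \<alpha>))"
proof -
  \<comment> \<open>With \<open>ennreal\<close> coefficients the exchange of sum and integral is
    monotone convergence, before any moment is known to be finite.\<close>
  define a where "a n = (\<integral>\<^sup>+x. ennreal (w x * exp (- X x) * (X x ^ n / fact n)) \<partial>M)" for n
  have series: "(\<integral>\<^sup>+x. ennreal (w x * exp (- ((1 - y) * X x))) \<partial>M) = (\<Sum>n. a n * ennreal (y ^ n))"
    if y: "0 \<le> y" for y
  proof -
    have "(\<integral>\<^sup>+x. ennreal (w x * exp (- ((1 - y) * X x))) \<partial>M)
        = (\<integral>\<^sup>+x. (\<Sum>n. ennreal (w x * exp (- X x) * (X x ^ n / fact n)) * ennreal (y ^ n)) \<partial>M)"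
    proof (rule nn_integral_cong)
      fix x assume x: "x \<in> space M"
      have "(\<lambda>n. (y * X x) ^ n /\<^sub>R fact n) sums exp (y * X x)" by (rule exp_converges)
      then have "(\<lambda>n. w x * exp (- X x) * ((y * X x) ^ n /\<^sub>R fact n)) sums (w x * exp (- X x) * exp (y * X x))"
        by (rule sums_mult)
      moreover have "w x * exp (- X x) * exp (y * X x) = w x * exp (- ((1 - y) * X x))"
        by (simp add: exp_add[symmetric] algebra_simps)
      moreover have "w x * exp (- X x) * ((y * X x) ^ n /\<^sub>R fact n)
          = w x * exp (- X x) * (X x ^ n / fact n) * y ^ n" for n
        by (simp add: power_mult_distrib field_simps)
      ultimately have "(\<lambda>n. w x * exp (- X x) * (X x ^ n / fact n) * y ^ n) sums (w x * exp (- ((1 - y) * X x)))"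
        by simp
      moreover have "0 \<le> w x * exp (- X x) * (X x ^ n / fact n) * y ^ n" for n
        using x X0[OF x] w0[OF x] y by simp
      ultimately have "(\<Sum>n. ennreal (w x * exp (- X x) * (X x ^ n / fact n) * y ^ n))
          = ennreal (w x * exp (- ((1 - y) * X x)))"
        by (subst suminf_ennreal2) (auto simp: sums_iff)
      moreover have "ennreal (w x * exp (- X x) * (X x ^ n / fact n) * y ^ n)
          = ennreal (w x * exp (- X x) * (X x ^ n / fact n)) * ennreal (y ^ n)" for n
        using x X0[OF x] w0[OF x] y by (intro ennreal_mult) auto
      ultimately show "ennreal (w x * exp (- ((1 - y) * X x)))
          = (\<Sum>n. ennreal (w x * exp (- X x) * (X x ^ n / fact n)) * ennreal (y ^ n))"
        by simp
    qed
    also have "\<dots> = (\<Sum>n. a n * ennreal (y ^ n))"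
      by (subst nn_integral_suminf) (auto simp: nn_integral_multc a_def)
    finally show ?thesis .
  qed
  \<comment> \<open>Finiteness of the single value at \<open>y = 1/2\<close> bounds every
    coefficient.\<close>
  have fin: "a n \<noteq> top_class.top" for n
  proof
    assume "a n = top_class.top"
    then have "a n * ennreal ((1/2) ^ n) = top_class.top" by (simp add: ennreal_top_mult)
    moreover have "a n * ennreal ((1/2) ^ n) \<le> (\<Sum>n. a n * ennreal ((1/2) ^ n))"
      using sum_le_suminf[of "\<lambda>n. a n * ennreal ((1/2) ^ n)" "{n}"] by simp
    moreover have "\<dots> = ennreal (c * (1 + (1/2) * \<kappa>) powr (- \<alpha>))"
      using L[of "1/2"] series[of "1/2"] by simp
    ultimately show False by (simp add: top_unique)
  qed
  define A where "A n = enn2real (a n)" for n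
  have aA: "a n = ennreal (A n)" for n using fin[of n] by (simp add: A_def less_top)
  have A0: "0 \<le> A n" for n by (simp add: A_def)
  have As: "(\<lambda>n. A n * y ^ n) sums (c * (1 + (1 - y) * \<kappa>) powr (- \<alpha>))" if "0 \<le> y" "y < 1" for y
  proof (rule sums_of_suminf_ennreal)
    show "0 \<le> A n * y ^ n" for n using A0 that by simp
    have "(\<Sum>n. a n * ennreal (y ^ n)) = ennreal (c * (1 + (1 - y) * \<kappa>) powr (- \<alpha>))"
      using series[of y] L[of "1 - y"] that by simp
    then show "(\<Sum>n. ennreal (A n * y ^ n)) = ennreal (c * (1 + (1 - y) * \<kappa>) powr (- \<alpha>))"
      using A0 that by (simp add: aA ennreal_mult)
  qed (use assms in auto)
  \<comment> \<open>\<open>1 + (1 - y) * \<kappa> = (1 + \<kappa>) * (1 - y * p)\<close>, so the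
    right side is a binomial series in \<open>y * p\<close>, which converges beyond
    \<open>y = 1\<close>.\<close>
  define p where "p = \<kappa> / (1 + \<kappa>)"
  have p: "0 \<le> p" "p < 1" "(1 + \<kappa>) * p = \<kappa>" using assms by (auto simp: p_def)
  define B where "B n = c * (1 + \<kappa>) powr (- \<alpha>) * (((- \<alpha>) gchoose n) * (- p) ^ n)" for n
  have Bs: "(\<lambda>n. B n * y ^ n) sums (c * (1 + (1 - y) * \<kappa>) powr (- \<alpha>))" if "0 \<le> y" "y * p < 1" for y
  proof -
    have yp: "\<bar>- (y * p)\<bar> < 1" using that p by simp
    have "(\<lambda>n. c * (1 + \<kappa>) powr (- \<alpha>) * (((- \<alpha>) gchoose n) * (- (y * p)) ^ n)) sums
        (c * (1 + \<kappa>) powr (- \<alpha>) * (1 + - (y * p)) powr (- \<alpha>))"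
      by (rule sums_mult[OF gen_binomial_real[OF yp]])
    moreover have "(1 + \<kappa>) powr (- \<alpha>) * (1 + - (y * p)) powr (- \<alpha>) = ((1 + \<kappa>) * (1 + - (y * p))) powr (- \<alpha>)"
      using that assms by (subst powr_mult) auto
    moreover have "(1 + \<kappa>) * (1 + - (y * p)) = 1 + (1 - y) * \<kappa>"
    proof -
      have "(1 + \<kappa>) * (1 + - (y * p)) = (1 + \<kappa>) - y * ((1 + \<kappa>) * p)" by (simp add: algebra_simps)
      also have "\<dots> = 1 + (1 - y) * \<kappa>" by (simp only: p(3)) (simp add: algebra_simps)
      finally show ?thesis .
    qed
    moreover have "(- (y * p)) ^ n = (- p) ^ n * y ^ n" for n
      by (metis mult.commute mult_minus_right power_mult_distrib)
    ultimately show ?thesis by (simp add: B_def mult.assoc)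
  qed
  have AB: "A n = B n" for n
  proof -
    have "(\<lambda>n. (A n - B n) * y ^ n) sums 0" if "0 \<le> y" "y < 1" for y
    proof -
      have "y * p < 1"
        using p that by (metis less_eq_real_def mult.right_neutral mult_strict_mono' zero_less_one)
      from sums_diff[OF As[OF that] Bs[OF that(1) this]] show ?thesis by (simp add: algebra_simps)
    qed
    then have "A n - B n = 0" by (intro power_series_eqI_right[of 1 "\<lambda>n. A n - B n"]) auto
    then show ?thesis by simp
  qed
  \<comment> \<open>The target is the value at \<open>y = 1 + \<theta>\<close>, and
    \<open>\<theta> * \<kappa> < 1\<close> is exactly the condition for convergence there.\<close>
  have tp: "(1 + \<theta>) * p < 1"
  proof -
    have "(1 + \<theta>) * \<kappa> < 1 + \<kappa>" using assms by (simp add: algebra_simps)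
    then show ?thesis using assms by (simp add: p_def field_simps)
  qed
  have "(\<lambda>n. A n * (1 + \<theta>) ^ n) sums (c * (1 - \<theta> * \<kappa>) powr (- \<alpha>))"
    using Bs[OF _ tp] assms by (simp add: AB)
  then have "(\<Sum>n. ennreal (A n * (1 + \<theta>) ^ n)) = ennreal (c * (1 - \<theta> * \<kappa>) powr (- \<alpha>))"
    using A0 assms by (subst suminf_ennreal2) (auto simp: sums_iff)
  then show ?thesis
    using series[of "1 + \<theta>"] A0 assms by (simp add: aA ennreal_mult)
qed

lemma (in prob_space) expectation_pos:
  fixes f :: "'a \<Rightarrow> real"
  assumes [measurable]: "f \<in> borel_measurable M" and f: "\<And>x. x \<in> space M \<Longrightarrow> 0 < f x" "\<And>x. x \<in> space M \<Longrightarrow> f x \<le> 1"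
  shows "integrable M f" "0 < expectation f"
proof -
  show i: "integrable M f"
    using f by (intro integrable_const_bound[where B = 1]) (auto simp: less_imp_le intro!: AE_I2 abs_leI intro: order_trans[of _ 0])
  have "expectation f \<noteq> 0"
  proof
    assume "expectation f = 0"
    then have "AE x in M. f x = 0"
      using i f by (subst integral_nonneg_eq_0_iff_AE[symmetric]) (auto simp: less_imp_le)
    then have "AE x in M. False" by (rule AE_mp) (use f(1) in \<open>force intro: AE_I2\<close>)
    then show False by simp
  qed
  moreover have "0 \<le> expectation f" using f by (intro integral_nonneg_AE AE_I2) (auto simp: less_imp_le)
  ultimately show "0 < expectation f" by simp
qed

section \<open>One- and two-point Laplace transforms in closed form\<close>

lemma det_mat_2:
  assumes "A \<in> carrier_mat 2 2"
  shows "Determinant.det A = A $$ (0,0) * A $$ (1,1) - A $$ (0,1) * A $$ (1,0)"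
proof -
  have "mat_delete A 0 0 \<in> carrier_mat 1 1" "mat_delete A 0 1 \<in> carrier_mat 1 1"
    using assms by (auto simp: mat_delete_def)
  then show ?thesis
    using assms
    by (subst laplace_expansion_row[OF assms, of 0])
      (auto simp: numeral_2_eq_2 cofactor_def det_single mat_delete_def)
qed

lemma permanental_laplace1:
  assumes P: "permanental_process M \<alpha> K T X" and t: "t \<in> T" and s: "0 < s"
  shows "(LINT \<omega>|M. exp (- (s * X t \<omega>))) = 1 / (1 + s * K t t) powr \<alpha>"
proof -
  have "(LINT \<omega>|M. exp (- (\<Sum>i<1::nat. s * X t \<omega>))) =
    1 / (Determinant.det (1\<^sub>m 1 + Matrix.mat 1 1 (\<lambda>(i, j). K t t) * mat_diag 1 (\<lambda>_. s))) powr \<alpha>"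
    using P[unfolded permanental_process_def, THEN conjunct2, THEN conjunct2, THEN conjunct2,
        THEN spec[of _ 1], THEN spec[of _ "\<lambda>_. t"], THEN spec[of _ "\<lambda>_. s"]] t s by simp
  moreover have "Determinant.det (1\<^sub>m 1 + Matrix.mat 1 1 (\<lambda>(i, j). K t t) * mat_diag 1 (\<lambda>_. s)) = 1 + s * K t t"
    by (subst det_single) (auto simp: mat_diag_mult_right[of _ 1 1] mat_diag_def scalar_prod_def)
  ultimately show ?thesis by simp
qed

lemma permanental_laplace2:
  assumes P: "permanental_process M \<alpha> K T X" and t: "r \<in> T" "t \<in> T" and s: "0 < a" "0 < b"
  shows "(LINT \<omega>|M. exp (- (a * X r \<omega> + b * X t \<omega>))) =
    1 / ((1 + a * K r r) * (1 + b * K t t) - a * b * (K r t * K t r)) powr \<alpha>"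
proof -
  define tt where "tt = (\<lambda>i::nat. if i = 0 then r else t)"
  define ss where "ss = (\<lambda>i::nat. if i = 0 then a else b)"
  have "(LINT \<omega>|M. exp (- (\<Sum>i<2. ss i * X (tt i) \<omega>))) =
    1 / (Determinant.det (1\<^sub>m 2 + Matrix.mat 2 2 (\<lambda>(i, j). K (tt i) (tt j)) * mat_diag 2 ss)) powr \<alpha>"
    using P[unfolded permanental_process_def, THEN conjunct2, THEN conjunct2, THEN conjunct2,
        THEN spec[of _ 2], THEN spec[of _ tt], THEN spec[of _ ss]] t s by (simp add: tt_def ss_def)
  moreover have "1\<^sub>m 2 + Matrix.mat 2 2 (\<lambda>(i, j). K (tt i) (tt j)) * mat_diag 2 ss
      = Matrix.mat 2 2 (\<lambda>(i, j). (if i = j then 1 else 0) + K (tt i) (tt j) * ss j)"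
    by (subst mat_diag_mult_right) auto
  moreover have "Determinant.det (Matrix.mat 2 2 (\<lambda>(i, j). (if i = j then 1 else 0) + K (tt i) (tt j) * ss j))
      = (1 + a * K r r) * (1 + b * K t t) - a * b * (K r t * K t r)"
    by (subst det_mat_2) (auto simp: tt_def ss_def algebra_simps)
  ultimately show ?thesis by (simp add: numeral_2_eq_2 tt_def ss_def)
qed

text \<open>A negative diagonal entry would make the determinant vanish at some positive
  \<open>s\<close>. By the conventions \<open>0 powr \<alpha> = 0\<close> and
  \<open>1 / 0 = 0\<close> the formula would then give 0, whereas a Laplace transform is
  positive.\<close>

lemma permanental_diag_nonneg:
  assumes P: "permanental_process M \<alpha> K T X" and t: "t \<in> T"
  shows "0 \<le> K t t"
proof (rule ccontr)
  assume neg: "\<not> 0 \<le> K t t"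
  interpret prob_space M using P by (simp add: permanental_process_def)
  define s where "s = - 1 / K t t"
  have s: "0 < s" "1 + s * K t t = 0" using neg by (auto simp: s_def field_simps)
  have [measurable]: "X t \<in> borel_measurable M" and X0: "\<And>x. x \<in> space M \<Longrightarrow> 0 \<le> X t x"
    using P t by (auto simp: permanental_process_def)
  have "0 < (LINT \<omega>|M. exp (- (s * X t \<omega>)))"
    using X0 s by (intro expectation_pos) auto
  then show False using permanental_laplace1[OF P t s(1)] s(2) by simp
qed

lemma permanental_exp_moment:
  assumes P: "permanental_process M \<alpha> K T X" and t: "t \<in> T" and \<theta>: "0 \<le> \<theta>" "\<theta> * K t t < 1"
  shows "(\<integral>\<^sup>+\<omega>. ennreal (exp (\<theta> * X t \<omega>)) \<partial>M) = ennreal ((1 - \<theta> * K t t) powr (- \<alpha>))"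
proof -
  interpret prob_space M using P by (simp add: permanental_process_def)
  have [measurable]: "X t \<in> borel_measurable M" and X0: "\<And>x. x \<in> space M \<Longrightarrow> 0 \<le> X t x"
    using P t by (auto simp: permanental_process_def)
  have "(\<integral>\<^sup>+x. ennreal (1 * exp (\<theta> * X t x)) \<partial>M) = ennreal (1 * (1 - \<theta> * K t t) powr (- \<alpha>))"
  proof (rule laplace_transform_extend)
    fix s :: real assume s: "0 < s"
    have "integrable M (\<lambda>\<omega>. exp (- (s * X t \<omega>)))"
      using X0 s by (intro expectation_pos) auto
    then show "(\<integral>\<^sup>+x. ennreal (1 * exp (- (s * X t x))) \<partial>M) = ennreal (1 * (1 + s * K t t) powr (- \<alpha>))"
      using permanental_laplace1[OF P t s] by (simp add: nn_integral_eq_integral powr_minus_divide)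
  qed (use X0 \<theta> permanental_diag_nonneg[OF P t] in auto)
  then show ?thesis by simp
qed

text \<open>Weighting by \<open>exp (- \<theta> * X t)\<close> turns the law of \<open>X r\<close> into a multiple of a gamma law.\<close>

lemma permanental_exp_moment_diff:
  assumes P: "permanental_process M \<alpha> K T X" and t: "r \<in> T" "t \<in> T" and \<theta>: "0 < \<theta>"
    and pos: "0 < 1 - \<theta> * (K r r - K t t) - \<theta>\<^sup>2 * (K r r * K t t - K r t * K t r)"
  shows "(\<integral>\<^sup>+\<omega>. ennreal (exp (\<theta> * (X r \<omega> - X t \<omega>))) \<partial>M) =
    ennreal ((1 - \<theta> * (K r r - K t t) - \<theta>\<^sup>2 * (K r r * K t t - K r t * K t r)) powr (- \<alpha>))"
proof -
  interpret prob_space M using P by (simp add: permanental_process_def)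
  have [measurable]: "X t \<in> borel_measurable M" "X r \<in> borel_measurable M"
    and X0: "\<And>x. x \<in> space M \<Longrightarrow> 0 \<le> X t x" "\<And>x. x \<in> space M \<Longrightarrow> 0 \<le> X r x"
    using P t by (auto simp: permanental_process_def)
  define D where "D = K r r * K t t - K r t * K t r"
  define c where "c = 1 + \<theta> * K t t"
  have c: "c \<ge> 1" using permanental_diag_nonneg[OF P t(2)] \<theta> by (simp add: c_def)
  \<comment> \<open>With the second parameter fixed at \<open>\<theta>\<close>, the determinant is
    affine in the first one, namely \<open>c * (1 + a * \<kappa>)\<close>; so
    \<open>\<kappa>\<close> is the gamma scale of \<open>X r\<close> under the weighted
    measure.\<close>
  define \<kappa> where "\<kappa> = (K r r + \<theta> * D) / c"
  have c\<kappa>: "c * \<kappa> = K r r + \<theta> * D" using c by (simp add: \<kappa>_def)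
  have det: "(1 + a * K r r) * (1 + \<theta> * K t t) - a * \<theta> * (K r t * K t r) = c * (1 + a * \<kappa>)" for a
  proof -
    have "c * (1 + a * \<kappa>) = c + a * (c * \<kappa>)" by (simp add: algebra_simps)
    then show ?thesis by (simp only: c\<kappa>) (simp add: D_def c_def algebra_simps)
  qed
  have int: "integrable M (\<lambda>\<omega>. exp (- (a * X r \<omega> + \<theta> * X t \<omega>)))"
    "0 < (LINT \<omega>|M. exp (- (a * X r \<omega> + \<theta> * X t \<omega>)))" if "0 < a" for a
    using X0 \<theta> that by (auto intro!: expectation_pos add_nonneg_nonneg simp del: minus_add_distrib)
  \<comment> \<open>As for the diagonal entries, a negative \<open>\<kappa>\<close> would put a zero
    of the determinant at a positive \<open>a\<close>.\<close>
  have \<kappa>0: "0 \<le> \<kappa>"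
  proof (rule ccontr)
    assume "\<not> 0 \<le> \<kappa>"
    then have "0 < - 1 / \<kappa>" "1 + (- 1 / \<kappa>) * \<kappa> = 0" by (auto simp: field_simps)
    then show False
      using int(2)[of "- 1 / \<kappa>"] permanental_laplace2[OF P t, of "- 1 / \<kappa>" \<theta>] \<theta> det[of "- 1 / \<kappa>"] by simp
  qed
  have "(\<integral>\<^sup>+x. ennreal (exp (- (\<theta> * X t x)) * exp (\<theta> * X r x)) \<partial>M)
      = ennreal (c powr (- \<alpha>) * (1 - \<theta> * \<kappa>) powr (- \<alpha>))"
  proof (rule laplace_transform_extend)
    fix a :: real assume a: "0 < a"
    have "(LINT \<omega>|M. exp (- (a * X r \<omega> + \<theta> * X t \<omega>))) = (c * (1 + a * \<kappa>)) powr (- \<alpha>)"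
      using permanental_laplace2[OF P t a \<theta>] det by (simp add: powr_minus_divide)
    also have "\<dots> = c powr (- \<alpha>) * (1 + a * \<kappa>) powr (- \<alpha>)"
      using c a \<kappa>0 by (subst powr_mult) auto
    finally show "(\<integral>\<^sup>+x. ennreal (exp (- (\<theta> * X t x)) * exp (- (a * X r x))) \<partial>M)
        = ennreal (c powr (- \<alpha>) * (1 + a * \<kappa>) powr (- \<alpha>))"
      using int(1)[OF a] by (simp add: nn_integral_eq_integral exp_add[symmetric] add.commute)
  next
    \<comment> \<open>\<open>c * (1 - \<theta> * \<kappa>)\<close> is precisely the quadratic
      expression assumed positive.\<close>
    have "c * (\<theta> * \<kappa>) < c * 1"
    proof -
      have "c * (\<theta> * \<kappa>) = \<theta> * (c * \<kappa>)" by simp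
      also have "\<dots> = \<theta> * (K r r + \<theta> * D)" by (simp only: c\<kappa>)
      finally show ?thesis using pos by (simp add: c_def D_def algebra_simps power2_eq_square)
    qed
    then show "\<theta> * \<kappa> < 1" using c by simp
  qed (use X0 \<theta> \<kappa>0 in auto)
  moreover have "exp (- (\<theta> * X t x)) * exp (\<theta> * X r x) = exp (\<theta> * (X r x - X t x))" for x
    by (simp add: exp_add[symmetric] algebra_simps)
  moreover have "c powr (- \<alpha>) * (1 - \<theta> * \<kappa>) powr (- \<alpha>) = (c - \<theta> * (c * \<kappa>)) powr (- \<alpha>)"
  proof -
    have "c - \<theta> * (c * \<kappa>) = c * (1 - \<theta> * \<kappa>)" by (simp add: algebra_simps)
    moreover have "0 < c - \<theta> * (c * \<kappa>)"
      using pos by (simp only: c\<kappa>) (simp add: c_def D_def algebra_simps power2_eq_square)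
    ultimately show ?thesis using c by (metis (no_types, lifting) powr_mult)
  qed
  moreover have "c - \<theta> * (c * \<kappa>) = 1 - \<theta> * (K r r - K t t) - \<theta>\<^sup>2 * D"
    by (simp only: c\<kappa>) (simp add: c_def D_def algebra_simps power2_eq_square)
  ultimately show ?thesis by (simp add: D_def)
qed

section \<open>Tail bounds for values and increments\<close>

lemma (in prob_space) prob_ge_le_exp_moment:
  assumes [measurable]: "f \<in> borel_measurable M" and "0 \<le> C"
    and "(\<integral>\<^sup>+\<omega>. ennreal (exp (\<theta> * f \<omega>)) \<partial>M) \<le> ennreal C" "0 < \<theta>"
  shows "prob {\<omega> \<in> space M. l \<le> f \<omega>} \<le> C * exp (- (\<theta> * l))"
proof -
  have "emeasure M {\<omega> \<in> space M. l \<le> f \<omega>}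
      = emeasure M {\<omega> \<in> space M. 1 \<le> ennreal (exp (- (\<theta> * l))) * ennreal (exp (\<theta> * f \<omega>))}"
    using \<open>0 < \<theta>\<close> by (intro arg_cong[where f = "emeasure M"])
      (auto simp: ennreal_mult[symmetric] exp_add[symmetric] ennreal_1[symmetric] simp del: ennreal_1)
  also have "\<dots> \<le> ennreal (exp (- (\<theta> * l))) * (\<integral>\<^sup>+\<omega>. ennreal (exp (\<theta> * f \<omega>)) * indicator (space M) \<omega> \<partial>M)"
    by (intro nn_integral_Markov_inequality) auto
  also have "(\<integral>\<^sup>+\<omega>. ennreal (exp (\<theta> * f \<omega>)) * indicator (space M) \<omega> \<partial>M) = (\<integral>\<^sup>+\<omega>. ennreal (exp (\<theta> * f \<omega>)) \<partial>M)"
    by (intro nn_integral_cong) auto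
  also have "ennreal (exp (- (\<theta> * l))) * (\<integral>\<^sup>+\<omega>. ennreal (exp (\<theta> * f \<omega>)) \<partial>M) \<le> ennreal (exp (- (\<theta> * l))) * ennreal C"
    using assms by (intro mult_left_mono) auto
  also have "\<dots> = ennreal (C * exp (- (\<theta> * l)))"
    using assms by (simp add: ennreal_mult[symmetric] mult.commute)
  finally show ?thesis
    using assms by (simp add: emeasure_eq_measure)
qed

text \<open>The exponential moment blows up at \<open>\<theta> * K t t = 1\<close>. Staying
  \<open>\<eta>\<close> below this point costs only a constant factor, so for positive
  \<open>K t t\<close> the decay rate can be taken as close to \<open>1 / K t t\<close> as
  desired.\<close>

lemma permanental_tail:
  assumes P: "permanental_process M \<alpha> K T X" and t: "t \<in> T" and \<theta>: "0 < \<theta>" "\<theta> * K t t \<le> 1 - \<eta>" "0 < \<eta>"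
    and \<alpha>: "0 < \<alpha>"
  shows "measure M {\<omega> \<in> space M. l \<le> X t \<omega>} \<le> \<eta> powr (- \<alpha>) * exp (- (\<theta> * l))"
proof -
  interpret prob_space M using P by (simp add: permanental_process_def)
  show ?thesis
  proof (rule prob_ge_le_exp_moment)
    show "X t \<in> borel_measurable M" using P t by (auto simp: permanental_process_def)
    show "(\<integral>\<^sup>+\<omega>. ennreal (exp (\<theta> * X t \<omega>)) \<partial>M) \<le> ennreal (\<eta> powr (- \<alpha>))"
      using permanental_exp_moment[OF P t, of \<theta>] \<theta> \<alpha>
      by (auto intro!: ennreal_leI powr_mono2')
  qed (use \<theta> in auto)
qed

text \<open>At \<open>\<theta> = 1 / d\<close> each hypothesis on \<open>K\<close> removes at most
  1/4 from the base of the mixed moment. At least 1/2 remains, whence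
  \<open>2 powr \<alpha>\<close>; the other factor 2 accounts for the two signs of the
  increment.\<close>

lemma permanental_increment_tail:
  assumes P: "permanental_process M \<alpha> K T X" and t: "r \<in> T" "t \<in> T" and d: "0 < d" and \<alpha>: "0 < \<alpha>"
    and K: "\<bar>K r r - K t t\<bar> \<le> d / 4" "K r r * K t t - K r t * K t r \<le> d\<^sup>2 / 4"
  shows "measure M {\<omega> \<in> space M. l \<le> \<bar>X r \<omega> - X t \<omega>\<bar>} \<le> 2 * 2 powr \<alpha> * exp (- (l / d))"
proof -
  interpret prob_space M using P by (simp add: permanental_process_def)
  have [measurable]: "X t \<in> borel_measurable M" "X r \<in> borel_measurable M"
    using P t by (auto simp: permanental_process_def)
  have *: "prob {\<omega> \<in> space M. l \<le> X r \<omega> - X t \<omega>} \<le> 2 powr \<alpha> * exp (- (1 / d * l))"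
    if t: "r \<in> T" "t \<in> T" and K: "\<bar>K r r - K t t\<bar> \<le> d / 4" "K r r * K t t - K r t * K t r \<le> d\<^sup>2 / 4" for r t
  proof (rule prob_ge_le_exp_moment)
    have [measurable]: "X t \<in> borel_measurable M" "X r \<in> borel_measurable M"
      using P t by (auto simp: permanental_process_def)
    show "(\<lambda>\<omega>. X r \<omega> - X t \<omega>) \<in> borel_measurable M" by measurable
    have "(1 / d) * (K r r - K t t) \<le> 1 / 4" using K d by (simp add: field_simps abs_if split: if_splits)
    moreover have "(1 / d)\<^sup>2 * (K r r * K t t - K r t * K t r) \<le> 1 / 4"
      using K d by (simp add: field_simps power2_eq_square)
    ultimately have "1 / 2 \<le> 1 - (1 / d) * (K r r - K t t) - (1 / d)\<^sup>2 * (K r r * K t t - K r t * K t r)"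
      by linarith
    moreover have "(1 / 2) powr (- \<alpha>) = 2 powr \<alpha>" by (simp add: powr_minus_divide powr_divide)
    ultimately have "(1 - (1 / d) * (K r r - K t t) - (1 / d)\<^sup>2 * (K r r * K t t - K r t * K t r)) powr (- \<alpha>) \<le> 2 powr \<alpha>"
      and "0 < 1 - (1 / d) * (K r r - K t t) - (1 / d)\<^sup>2 * (K r r * K t t - K r t * K t r)"
      using powr_mono2'[of "- \<alpha>" "1 / 2" "1 - (1 / d) * (K r r - K t t) - (1 / d)\<^sup>2 * (K r r * K t t - K r t * K t r)"] \<alpha>
      by linarith+
    then show "(\<integral>\<^sup>+\<omega>. ennreal (exp (1 / d * (X r \<omega> - X t \<omega>))) \<partial>M) \<le> ennreal (2 powr \<alpha>)"
      using d by (subst permanental_exp_moment_diff[OF P t]) (auto intro!: ennreal_leI)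
  qed (use d in auto)
  have "{\<omega> \<in> space M. l \<le> \<bar>X r \<omega> - X t \<omega>\<bar>} = {\<omega> \<in> space M. l \<le> X r \<omega> - X t \<omega>} \<union> {\<omega> \<in> space M. l \<le> X t \<omega> - X r \<omega>}"
    by auto
  then have "prob {\<omega> \<in> space M. l \<le> \<bar>X r \<omega> - X t \<omega>\<bar>}
      \<le> prob {\<omega> \<in> space M. l \<le> X r \<omega> - X t \<omega>} + prob {\<omega> \<in> space M. l \<le> X t \<omega> - X r \<omega>}"
    by (simp add: measure_Un_le)
  also have "\<dots> \<le> 2 powr \<alpha> * exp (- (1 / d * l)) + 2 powr \<alpha> * exp (- (1 / d * l))"
    using t K by (intro add_mono *) (auto simp: abs_minus_commute mult.commute)
  also have "\<dots> = 2 * 2 powr \<alpha> * exp (- (l / d))" by simp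
  finally show ?thesis .
qed

section \<open>The maximum principle for the potential density\<close>

text \<open>For even \<open>\<phi>\<close> this is the Fourier transform; the real form keeps the
  potential estimates free of complex integrals.\<close>

definition cos_transform :: "(real \<Rightarrow> real) \<Rightarrow> real \<Rightarrow> real" where
  "cos_transform \<phi> x = (LINT l|lborel. cos (l * x) * \<phi> l)"

lemma integrable_cos_mult:
  fixes \<phi> :: "real \<Rightarrow> real"
  assumes "integrable lborel \<phi>"
  shows "integrable lborel (\<lambda>l. cos (l * x) * \<phi> l)"
proof (rule Bochner_Integration.integrable_bound[OF assms])
  show "(\<lambda>l. cos (l * x) * \<phi> l) \<in> borel_measurable lborel"
    using borel_measurable_integrable[OF assms] by measurable
qed (auto simp: abs_mult intro!: AE_I2 mult_left_le_one_le)

lemma integral_abs_cos_mult_le: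
  fixes \<phi> :: "real \<Rightarrow> real"
  assumes "integrable lborel \<phi>"
  shows "(LINT l|lborel. \<bar>cos (l * x) * \<phi> l\<bar>) \<le> (LINT l|lborel. \<bar>\<phi> l\<bar>)"
proof (rule integral_mono)
  show "integrable lborel (\<lambda>l. \<bar>cos (l * x) * \<phi> l\<bar>)" "integrable lborel (\<lambda>l. \<bar>\<phi> l\<bar>)"
    using assms by (auto intro: integrable_abs integrable_cos_mult simp del: abs_mult)
qed (auto simp: abs_mult intro!: mult_left_le_one_le)

lemma abs_cos_transform_le:
  assumes "integrable lborel \<phi>"
  shows "\<bar>cos_transform \<phi> x\<bar> \<le> (LINT l|lborel. \<bar>\<phi> l\<bar>)"
proof -
  have "\<bar>cos_transform \<phi> x\<bar> \<le> (LINT l|lborel. \<bar>cos (l * x) * \<phi> l\<bar>)"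
    unfolding cos_transform_def by (rule integral_abs_bound)
  also have "\<dots> \<le> (LINT l|lborel. \<bar>\<phi> l\<bar>)"
    by (rule integral_abs_cos_mult_le[OF assms])
  finally show ?thesis .
qed

lemma cos_transform_diff:
  assumes "integrable lborel \<phi>" "integrable lborel \<xi>"
  shows "cos_transform (\<lambda>l. \<phi> l - \<xi> l) x = cos_transform \<phi> x - cos_transform \<xi> x"
  unfolding cos_transform_def right_diff_distrib
  by (rule Bochner_Integration.integral_diff[OF integrable_cos_mult[OF assms(1)] integrable_cos_mult[OF assms(2)]])

lemma isCont_cos_transform:
  assumes "integrable lborel \<phi>"
  shows "isCont (cos_transform \<phi>) x"
  unfolding continuous_at_sequentially
proof (intro allI impI)
  fix X :: "nat \<Rightarrow> real" assume X: "X \<longlonglongrightarrow> x"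
  have [measurable]: "\<phi> \<in> borel_measurable lborel" using assms by auto
  show "(cos_transform \<phi> \<circ> X) \<longlonglongrightarrow> cos_transform \<phi> x"
    unfolding cos_transform_def comp_def
  proof (rule integral_dominated_convergence[where w = "\<lambda>l. \<bar>\<phi> l\<bar>"])
    show "AE l in lborel. (\<lambda>n. cos (l * X n) * \<phi> l) \<longlonglongrightarrow> cos (l * x) * \<phi> l"
      by (intro AE_I2 tendsto_intros X)
    show "AE l in lborel. norm (cos (l * X n) * \<phi> l) \<le> \<bar>\<phi> l\<bar>" for n
      by (auto simp: abs_mult intro!: AE_I2 mult_left_le_one_le)
  qed (use assms in auto)
qed

lemma cos_transform_minus: "cos_transform \<phi> (- x) = cos_transform \<phi> x"
  by (simp add: cos_transform_def)

text \<open>A rescaled characteristic function of the normal law. For small \<open>r\<close> the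
  multiplier is close to 1 and its transform is a positive bump of width \<open>r\<close>, a smooth
  stand-in for a point charge.\<close>

lemma cos_transform_gaussian:
  assumes r: "0 < r"
  shows "cos_transform (\<lambda>l. exp (- (r * l)\<^sup>2 / 2)) x = sqrt (2 * pi) / r * exp (- (x / r)\<^sup>2 / 2)"
    and "integrable lborel (\<lambda>l. exp (- (r * l)\<^sup>2 / 2))"
proof -
  have std: "integrable lborel (\<lambda>l. cos (l * y) * std_normal_density l)"
    "(LINT l|lborel. cos (l * y) * std_normal_density l) = exp (- y\<^sup>2 / 2)" for y
  proof -
    show "integrable lborel (\<lambda>l. cos (l * y) * std_normal_density l)"
      by (rule integrable_cos_mult) simp
    have i: "complex_integrable std_normal_distribution (\<lambda>l. iexp (y * l))"
    proof -
      interpret real_distribution std_normal_distribution by (rule real_dist_normal_dist)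
      show ?thesis by (rule integrable_iexp) auto
    qed
    have "exp (- y\<^sup>2 / 2) = Re (char std_normal_distribution y)"
      by (simp add: char_std_normal_distribution)
    also have "\<dots> = (LINT l|std_normal_distribution. cos (y * l))"
      unfolding char_def using i by (subst integral_Re[symmetric]) (auto simp: Re_exp)
    also have "\<dots> = (LINT l|lborel. std_normal_density l *\<^sub>R cos (y * l))"
      by (subst integral_density) (auto simp: normal_density_nonneg)
    finally show "(LINT l|lborel. cos (l * y) * std_normal_density l) = exp (- y\<^sup>2 / 2)"
      by (simp add: mult.commute)
  qed
  have eq: "cos (l * x) * exp (- (r * l)\<^sup>2 / 2) = sqrt (2 * pi) * (cos ((0 + r * l) * (x / r)) * std_normal_density (0 + r * l))" for l
    using r by (simp add: std_normal_density_def)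
  have "exp (- (x / r)\<^sup>2 / 2) = \<bar>r\<bar> *\<^sub>R (LINT l|lborel. cos ((0 + r * l) * (x / r)) * std_normal_density (0 + r * l))"
    unfolding std(2)[symmetric] using r by (subst lborel_integral_real_affine[where c = r and t = 0]) auto
  moreover have "cos_transform (\<lambda>l. exp (- (r * l)\<^sup>2 / 2)) x
      = sqrt (2 * pi) * (LINT l|lborel. cos ((0 + r * l) * (x / r)) * std_normal_density (0 + r * l))"
    unfolding cos_transform_def eq by simp
  ultimately show "cos_transform (\<lambda>l. exp (- (r * l)\<^sup>2 / 2)) x = sqrt (2 * pi) / r * exp (- (x / r)\<^sup>2 / 2)"
    using r by (simp add: field_simps)
  have "integrable lborel (\<lambda>l. std_normal_density (0 + r * l))"
    using r by (intro lborel_integrable_real_affine) auto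
  then have "integrable lborel (\<lambda>l. sqrt (2 * pi) * std_normal_density (0 + r * l))" by (rule integrable_mult_right)
  then show "integrable lborel (\<lambda>l. exp (- (r * l)\<^sup>2 / 2))"
    by (simp add: std_normal_density_def)
qed

text \<open>For \<open>x = (\<beta> + \<psi> l) * h\<close> this quotient is the Fourier multiplier
  of the average of the killed semigroup over the times in [0, h].\<close>

lemma one_minus_exp_quotient_bounds:
  fixes x :: real
  assumes "0 < x"
  shows "0 \<le> (1 - exp (- x)) / x" "(1 - exp (- x)) / x \<le> 1"
  using assms exp_ge_add_one_self[of "- x"] by (auto simp: field_simps)

lemma one_minus_exp_quotient_tendsto:
  fixes w :: real
  assumes "0 < w"
  shows "(\<lambda>n. (1 - exp (- (w * (1 / real (Suc n))))) / (w * (1 / real (Suc n)))) \<longlonglongrightarrow> 1"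
  using assms by real_asymp

section \<open>Semigroup and resolvent as Fourier multipliers\<close>

locale symmetric_exponent = prob_space N for N :: "'a measure" +
  fixes Z :: "real \<Rightarrow> 'a \<Rightarrow> real" and \<psi> :: "real \<Rightarrow> real" and \<beta> :: real
  assumes Z_measurable: "\<And>t. 0 \<le> t \<Longrightarrow> Z t \<in> borel_measurable N"
    and char_exponent: "characteristic_exponent N Z \<psi>"
    and \<psi>_integrable: "integrable lborel (\<lambda>l. 1 / (1 + \<psi> l))"
    and \<beta>_pos: "0 < \<beta>"
begin

lemma \<psi>_measurable [measurable]: "\<psi> \<in> borel_measurable borel"
proof -
  have [measurable]: "(\<lambda>l. 1 / (1 + \<psi> l)) \<in> borel_measurable borel"
    using \<psi>_integrable by auto
  \<comment> \<open>Inverting twice returns \<open>1 + \<psi> l\<close> even where it vanishes,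
    because \<open>1 / 0 = 0\<close>; nonnegativity of \<open>\<psi>\<close> comes only
    later.\<close>
  have "(\<lambda>l. 1 / (1 / (1 + \<psi> l)) - 1) \<in> borel_measurable borel" by measurable
  then show ?thesis by simp
qed

lemma expectation_cos_sin:
  assumes t: "0 \<le> t"
  shows "expectation (\<lambda>\<omega>. cos (l * Z t \<omega>)) = exp (- (t * \<psi> l))" "expectation (\<lambda>\<omega>. sin (l * Z t \<omega>)) = 0"
proof -
  have [measurable]: "Z t \<in> borel_measurable N" by (rule Z_measurable[OF t])
  have i: "complex_integrable N (\<lambda>\<omega>. exp (\<i> * complex_of_real (l * Z t \<omega>)))"
    by (intro integrable_const_bound[where B = 1]) auto
  have c: "(LINT \<omega>|N. exp (\<i> * complex_of_real (l * Z t \<omega>))) = complex_of_real (exp (- (t * \<psi> l)))"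
    using char_exponent t unfolding characteristic_exponent_def by blast
  show "expectation (\<lambda>\<omega>. cos (l * Z t \<omega>)) = exp (- (t * \<psi> l))"
    using integral_Re[OF i] unfolding c by (simp add: Re_exp)
  show "expectation (\<lambda>\<omega>. sin (l * Z t \<omega>)) = 0"
    using integral_Im[OF i] unfolding c by (simp add: Im_exp)
qed

lemma \<psi>_nonneg: "0 \<le> \<psi> l"
proof -
  have [measurable]: "Z 1 \<in> borel_measurable N" by (rule Z_measurable) simp
  have "expectation (\<lambda>\<omega>. cos (l * Z 1 \<omega>)) \<le> expectation (\<lambda>\<omega>. 1)"
    by (intro integral_mono integrable_const_bound[where B = 1]) auto
  then show ?thesis using expectation_cos_sin(1)[of 1 l] by (simp add: prob_space)
qed

lemma expectation_cos_shift:
  assumes t: "0 \<le> t"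
  shows "expectation (\<lambda>\<omega>. cos (l * (x + Z t \<omega>))) = cos (l * x) * exp (- (t * \<psi> l))"
proof -
  have [measurable]: "Z t \<in> borel_measurable N" by (rule Z_measurable[OF t])
  have "expectation (\<lambda>\<omega>. cos (l * (x + Z t \<omega>)))
      = expectation (\<lambda>\<omega>. cos (l * x) * cos (l * Z t \<omega>) - sin (l * x) * sin (l * Z t \<omega>))"
    by (simp add: distrib_left cos_add)
  also have "\<dots> = cos (l * x) * expectation (\<lambda>\<omega>. cos (l * Z t \<omega>)) - sin (l * x) * expectation (\<lambda>\<omega>. sin (l * Z t \<omega>))"
    by (subst Bochner_Integration.integral_diff)
      (auto intro!: integrable_mult_right integrable_const_bound[where B = 1])
  finally show ?thesis by (simp add: expectation_cos_sin[OF t])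
qed

text \<open>By Fubini, the semigroup of \<open>Z\<close> acts on the frequency side as
  multiplication by \<open>exp (- (t * \<psi> l))\<close>.\<close>

lemma expectation_cos_transform:
  assumes \<phi>: "integrable lborel \<phi>" and t: "0 \<le> t"
  shows "expectation (\<lambda>\<omega>. cos_transform \<phi> (x + Z t \<omega>)) = cos_transform (\<lambda>l. exp (- (t * \<psi> l)) * \<phi> l) x"
proof -
  have [measurable]: "Z t \<in> borel_measurable N" by (rule Z_measurable[OF t])
  have [measurable]: "\<phi> \<in> borel_measurable borel" using \<phi> by auto
  interpret P: pair_sigma_finite N lborel
    by (intro pair_sigma_finite.intro sigma_finite_lborel sigma_finite_measure_axioms)
  have int: "integrable (N \<Otimes>\<^sub>M lborel) (\<lambda>(\<omega>, l). cos (l * (x + Z t \<omega>)) * \<phi> l)"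
  proof (rule P.Fubini_integrable)
    show "integrable N (\<lambda>\<omega>. LINT l|lborel. norm (case (\<omega>, l) of (\<omega>, l) \<Rightarrow> cos (l * (x + Z t \<omega>)) * \<phi> l))"
    proof (rule integrable_const_bound[where B = "LINT l|lborel. \<bar>\<phi> l\<bar>"])
      show "AE \<omega> in N. norm (LINT l|lborel. norm (case (\<omega>, l) of (\<omega>, l) \<Rightarrow> cos (l * (x + Z t \<omega>)) * \<phi> l))
          \<le> (LINT l|lborel. \<bar>\<phi> l\<bar>)"
      proof (rule AE_I2)
        fix \<omega>
        show "norm (LINT l|lborel. norm (case (\<omega>, l) of (\<omega>, l) \<Rightarrow> cos (l * (x + Z t \<omega>)) * \<phi> l))
          \<le> (LINT l|lborel. \<bar>\<phi> l\<bar>)"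
          using integral_abs_cos_mult_le[OF \<phi>, of "x + Z t \<omega>"] by simp
      qed
    qed measurable
  qed (auto intro!: AE_I2 integrable_cos_mult \<phi>)
  have "expectation (\<lambda>\<omega>. cos_transform \<phi> (x + Z t \<omega>))
      = (LINT l|lborel. (LINT \<omega>|N. cos (l * (x + Z t \<omega>)) * \<phi> l))"
    unfolding cos_transform_def using P.Fubini_integral[OF int] by simp
  also have "\<dots> = (LINT l|lborel. cos (l * x) * exp (- (t * \<psi> l)) * \<phi> l)"
    by (simp add: expectation_cos_shift[OF t])
  finally show ?thesis by (simp add: cos_transform_def mult.assoc)
qed

abbreviation resolvent :: "real \<Rightarrow> real" where "resolvent l \<equiv> 1 / (\<beta> + \<psi> l)"

lemma integrable_resolvent: "integrable lborel resolvent"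
proof (rule Bochner_Integration.integrable_bound)
  show "integrable lborel (\<lambda>l. max 1 (1 / \<beta>) * (1 / (1 + \<psi> l)))"
    by (intro integrable_mult_right \<psi>_integrable)
  show "AE l in lborel. norm (1 / (\<beta> + \<psi> l)) \<le> norm (max 1 (1 / \<beta>) * (1 / (1 + \<psi> l)))"
  proof (rule AE_I2)
    fix l
    have "1 + \<psi> l \<le> max 1 (1 / \<beta>) * (\<beta> + \<psi> l)"
    proof -
      have "1 \<le> max 1 (1 / \<beta>) * \<beta>" using \<beta>_pos by (simp add: max_def field_simps)
      moreover have "1 * \<psi> l \<le> max 1 (1 / \<beta>) * \<psi> l" by (intro mult_right_mono \<psi>_nonneg) simp
      ultimately show ?thesis by (simp add: distrib_left)
    qed
    then show "norm (1 / (\<beta> + \<psi> l)) \<le> norm (max 1 (1 / \<beta>) * (1 / (1 + \<psi> l)))"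
      using \<beta>_pos \<psi>_nonneg[of l] by (simp add: field_simps)
  qed
qed measurable

lemma integrable_mult_resolvent:
  assumes \<phi>: "integrable lborel \<phi>"
  shows "integrable lborel (\<lambda>l. \<phi> l * resolvent l)"
proof (rule Bochner_Integration.integrable_bound)
  have [measurable]: "\<phi> \<in> borel_measurable borel" using \<phi> by auto
  show "(\<lambda>l. \<phi> l * resolvent l) \<in> borel_measurable lborel" by measurable
  show "integrable lborel (\<lambda>l. (1 / \<beta>) * \<phi> l)" by (intro integrable_mult_right \<phi>)
  show "AE l in lborel. norm (\<phi> l * resolvent l) \<le> norm ((1 / \<beta>) * \<phi> l)"
  proof (rule AE_I2)
    fix l
    have "1 / (\<beta> + \<psi> l) \<le> 1 / \<beta>" using \<beta>_pos \<psi>_nonneg[of l] by (intro divide_left_mono) auto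
    then have "\<bar>\<phi> l\<bar> * (1 / (\<beta> + \<psi> l)) \<le> \<bar>\<phi> l\<bar> * (1 / \<beta>)" by (rule mult_left_mono) simp
    then show "norm (\<phi> l * resolvent l) \<le> norm ((1 / \<beta>) * \<phi> l)"
      using \<beta>_pos \<psi>_nonneg[of l] by (simp add: abs_mult)
  qed
qed

text \<open>At an exact maximum \<open>y\<close> of \<open>g\<close> the generator would give \<open>\<beta> * g y \<le> f y\<close>. Working with
  near-maxima avoids the question whether the maximum is attained.\<close>

lemma resolvent_maximum_principle:
  fixes \<phi> :: "real \<Rightarrow> real" and t :: real
  defines "g \<equiv> \<lambda>x. cos_transform (\<lambda>l. \<phi> l * resolvent l) (x + t) - cos_transform (\<lambda>l. \<phi> l * resolvent l) x"
    and "f \<equiv> \<lambda>x. cos_transform \<phi> (x + t) - cos_transform \<phi> x"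
  assumes \<phi>: "integrable lborel \<phi>" and e: "0 < e"
  obtains y where "\<And>x. g x \<le> g y + e" "\<beta> * g y - e \<le> f y"
proof -
  have [measurable]: "\<phi> \<in> borel_measurable borel" using \<phi> by auto
  have \<phi>G: "integrable lborel (\<lambda>l. \<phi> l * resolvent l)" by (rule integrable_mult_resolvent[OF \<phi>])
  define B where "B = 2 * (LINT l|lborel. \<bar>\<phi> l * resolvent l\<bar>)"
  have gB: "\<bar>g x\<bar> \<le> B" for x
    using abs_cos_transform_le[OF \<phi>G, of "x + t"] abs_cos_transform_le[OF \<phi>G, of x]
    unfolding g_def B_def by linarith
  define \<epsilon> where "\<epsilon> n = 1 / real (Suc n)" for n
  \<comment> \<open>Error of the short-time average as a multiplier; it is bounded by 1 and tends to
    0 pointwise, so its effect on \<open>\<phi>\<close> is small in L1.\<close>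
  define R where "R n l = (1 - exp (- ((\<beta> + \<psi> l) * \<epsilon> n))) / ((\<beta> + \<psi> l) * \<epsilon> n) - 1" for n l
  have \<epsilon>0: "0 < \<epsilon> n" for n by (simp add: \<epsilon>_def)
  have w0: "0 < \<beta> + \<psi> l" for l using \<beta>_pos \<psi>_nonneg[of l] by simp
  have R1: "\<bar>R n l\<bar> \<le> 1" for n l
  proof -
    have "0 < (\<beta> + \<psi> l) * \<epsilon> n" using w0 \<epsilon>0 by simp
    from one_minus_exp_quotient_bounds[OF this] show ?thesis by (simp add: R_def)
  qed
  have [measurable]: "R n \<in> borel_measurable borel" for n unfolding R_def by measurable
  have Rint: "integrable lborel (\<lambda>l. \<phi> l * R n l)" for n
    using \<phi> by (rule Bochner_Integration.integrable_bound)
      (auto intro!: AE_I2 mult_left_le simp: abs_mult R1)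
  have "(\<lambda>n. LINT l|lborel. \<bar>\<phi> l * R n l\<bar>) \<longlonglongrightarrow> (LINT (l::real)|lborel. (0::real))"
  proof (rule integral_dominated_convergence[where w = "\<lambda>l. \<bar>\<phi> l\<bar>"])
    show "AE l in lborel. (\<lambda>n. \<bar>\<phi> l * R n l\<bar>) \<longlonglongrightarrow> 0"
    proof (rule AE_I2)
      fix l
      have "(\<lambda>n. R n l) \<longlonglongrightarrow> 1 - 1"
        unfolding R_def \<epsilon>_def by (intro tendsto_diff one_minus_exp_quotient_tendsto[OF w0] tendsto_const)
      then have "(\<lambda>n. \<bar>\<phi> l * R n l\<bar>) \<longlonglongrightarrow> \<bar>\<phi> l * (1 - 1)\<bar>" by (intro tendsto_intros)
      then show "(\<lambda>n. \<bar>\<phi> l * R n l\<bar>) \<longlonglongrightarrow> 0" by simp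
    qed
    show "AE l in lborel. norm \<bar>\<phi> l * R n l\<bar> \<le> \<bar>\<phi> l\<bar>" for n
      by (auto intro!: AE_I2 mult_left_le simp: abs_mult R1)
  qed (use \<phi> in auto)
  then have "\<forall>\<^sub>F n in sequentially. (LINT l|lborel. \<bar>\<phi> l * R n l\<bar>) < e / 4"
    using e by (intro order_tendstoD) auto
  moreover have "(\<lambda>n. \<bar>(1 - exp (- (\<beta> * \<epsilon> n))) / \<epsilon> n - \<beta>\<bar> * B) \<longlonglongrightarrow> 0"
  proof -
    have "(\<lambda>n. \<bar>\<beta> * ((1 - exp (- (\<beta> * \<epsilon> n))) / (\<beta> * \<epsilon> n)) - \<beta>\<bar> * B) \<longlonglongrightarrow> \<bar>\<beta> * 1 - \<beta>\<bar> * B"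
      unfolding \<epsilon>_def by (intro tendsto_intros one_minus_exp_quotient_tendsto \<beta>_pos)
    then show ?thesis using \<beta>_pos by simp
  qed
  then have "\<forall>\<^sub>F n in sequentially. \<bar>(1 - exp (- (\<beta> * \<epsilon> n))) / \<epsilon> n - \<beta>\<bar> * B < e / 4"
    using e by (intro order_tendstoD) auto
  ultimately have "\<forall>\<^sub>F n in sequentially. (LINT l|lborel. \<bar>\<phi> l * R n l\<bar>) < e / 4 \<and>
      \<bar>(1 - exp (- (\<beta> * \<epsilon> n))) / \<epsilon> n - \<beta>\<bar> * B < e / 4" by (rule eventually_conj)
  then obtain n where n: "(LINT l|lborel. \<bar>\<phi> l * R n l\<bar>) < e / 4"
      "\<bar>(1 - exp (- (\<beta> * \<epsilon> n))) / \<epsilon> n - \<beta>\<bar> * B < e / 4"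
    using eventually_happens'[OF sequentially_bot] by blast
  define h where "h = \<epsilon> n"
  have h: "0 < h" by (simp add: h_def \<epsilon>0)
  \<comment> \<open>The slack at the near-maximum is later divided by the time step
    \<open>h\<close>, hence the factor \<open>h\<close>; the step is fixed before the point
    \<open>y\<close> is chosen.\<close>
  define \<eta> where "\<eta> = min e (e * h / 4)"
  have \<eta>: "0 < \<eta>" "\<eta> \<le> e" "\<eta> / h \<le> e / 4" using e h by (auto simp: \<eta>_def field_simps min_def)
  define S where "S = (SUP x. g x)"
  have bdd: "bdd_above (range g)" using gB by (intro bdd_aboveI[of _ B]) (auto simp: abs_le_iff)
  have gS: "g x \<le> S" for x unfolding S_def by (rule cSUP_upper[OF _ bdd]) simp
  obtain y where y: "S - \<eta> < g y"
    using less_cSUP_iff[OF _ bdd, of "S - \<eta>"] \<eta> by (auto simp: S_def)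
  have Zh [measurable]: "Z h \<in> borel_measurable N" using Z_measurable h by simp
  define P where "P l = exp (- (h * \<psi> l)) * (\<phi> l * resolvent l)" for l
  have Pint: "integrable lborel P"
    unfolding P_def using \<phi>G
    by (rule Bochner_Integration.integrable_bound)
      (use h \<psi>_nonneg in \<open>auto simp: abs_mult intro!: AE_I2 mult_left_le_one_le divide_right_mono\<close>)
  have ctm [measurable]: "cos_transform (\<lambda>l. \<phi> l * resolvent l) \<in> borel_measurable borel"
    using isCont_cos_transform[OF \<phi>G]
    by (intro borel_measurable_continuous_onI continuous_at_imp_continuous_on) auto
  have ei: "integrable N (\<lambda>\<omega>. cos_transform (\<lambda>l. \<phi> l * resolvent l) (x + Z h \<omega>))" for x
  proof (rule integrable_const_bound[where B = "LINT l|lborel. \<bar>\<phi> l * resolvent l\<bar>"])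
    show "(\<lambda>\<omega>. cos_transform (\<lambda>l. \<phi> l * resolvent l) (x + Z h \<omega>)) \<in> borel_measurable N"
      by (rule measurable_compose[OF _ ctm]) measurable
  qed (unfold real_norm_def, intro AE_I2 abs_cos_transform_le[OF \<phi>G])
  have Eg: "expectation (\<lambda>\<omega>. g (y + Z h \<omega>)) = cos_transform P (y + t) - cos_transform P y"
  proof -
    have "expectation (\<lambda>\<omega>. g (y + Z h \<omega>)) = expectation (\<lambda>\<omega>. cos_transform (\<lambda>l. \<phi> l * resolvent l) ((y + t) + Z h \<omega>)
        - cos_transform (\<lambda>l. \<phi> l * resolvent l) (y + Z h \<omega>))"
      unfolding g_def by (simp add: ac_simps)
    also have "\<dots> = expectation (\<lambda>\<omega>. cos_transform (\<lambda>l. \<phi> l * resolvent l) ((y + t) + Z h \<omega>))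
        - expectation (\<lambda>\<omega>. cos_transform (\<lambda>l. \<phi> l * resolvent l) (y + Z h \<omega>))"
      by (rule Bochner_Integration.integral_diff[OF ei ei])
    finally show ?thesis
      using h by (simp only: expectation_cos_transform[OF \<phi>G less_imp_le] P_def[abs_def])
  qed
  have Egle: "expectation (\<lambda>\<omega>. g (y + Z h \<omega>)) \<le> g y + \<eta>"
  proof -
    have "integrable N (\<lambda>\<omega>. g (y + Z h \<omega>))"
      unfolding g_def using Bochner_Integration.integrable_diff[OF ei[of "y + t"] ei[of y]] by (simp add: ac_simps)
    then have "expectation (\<lambda>\<omega>. g (y + Z h \<omega>)) \<le> expectation (\<lambda>\<omega>. S)"
      using gS by (intro integral_mono) auto
    then show ?thesis using y by (simp add: prob_space)
  qed
  \<comment> \<open>Discrete resolvent equation: a potential minus its discounted evolution over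
    time \<open>h\<close> is the charge collected during that time, hence \<open>h\<close> times the
    charge up to the error \<open>R n\<close>.\<close>
  have key: "cos_transform (\<lambda>l. \<phi> l * resolvent l) x - exp (- (\<beta> * h)) * cos_transform P x
      = h * (cos_transform \<phi> x + cos_transform (\<lambda>l. \<phi> l * R n l) x)" for x
  proof -
    have "cos_transform (\<lambda>l. \<phi> l * resolvent l) x - exp (- (\<beta> * h)) * cos_transform P x
        = (LINT l|lborel. cos (l * x) * (\<phi> l * resolvent l) - exp (- (\<beta> * h)) * (cos (l * x) * P l))"
      unfolding cos_transform_def
      using integrable_cos_mult[OF \<phi>G] integrable_cos_mult[OF Pint] by simp
    also have "\<dots> = (LINT l|lborel. h * (cos (l * x) * \<phi> l + cos (l * x) * (\<phi> l * R n l)))"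
    proof (rule Bochner_Integration.integral_cong[OF refl])
      fix l
      have "exp (- (\<beta> * h)) * exp (- (h * \<psi> l)) = exp (- ((\<beta> + \<psi> l) * h))"
        by (simp add: exp_add[symmetric] algebra_simps)
      moreover have "a * b - e0 * (a * (e1 * b)) = a * b * (1 - e0 * e1)" for a b e0 e1 :: real
        by (simp add: algebra_simps)
      ultimately have "cos (l * x) * (\<phi> l * resolvent l) - exp (- (\<beta> * h)) * (cos (l * x) * P l)
          = cos (l * x) * (\<phi> l * resolvent l) * (1 - exp (- ((\<beta> + \<psi> l) * h)))"
        by (simp only: P_def)
      also have "\<dots> = h * (cos (l * x) * \<phi> l * ((1 - exp (- ((\<beta> + \<psi> l) * h))) / ((\<beta> + \<psi> l) * h)))"
        using h by simp
      also have "(1 - exp (- ((\<beta> + \<psi> l) * h))) / ((\<beta> + \<psi> l) * h) = 1 + R n l"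
        by (simp add: R_def h_def)
      finally show "cos (l * x) * (\<phi> l * resolvent l) - exp (- (\<beta> * h)) * (cos (l * x) * P l)
          = h * (cos (l * x) * \<phi> l + cos (l * x) * (\<phi> l * R n l))"
        by (simp add: algebra_simps)
    qed
    also have "\<dots> = h * (cos_transform \<phi> x + cos_transform (\<lambda>l. \<phi> l * R n l) x)"
      unfolding cos_transform_def
      using integrable_cos_mult[OF \<phi>] integrable_cos_mult[OF Rint[of n]] by simp
    finally show ?thesis .
  qed
  define err where "err = cos_transform (\<lambda>l. \<phi> l * R n l) (y + t) - cos_transform (\<lambda>l. \<phi> l * R n l) y"
  have err: "\<bar>err\<bar> \<le> e / 2"
    using abs_cos_transform_le[OF Rint[of n], of "y + t"] abs_cos_transform_le[OF Rint[of n], of y] n(1)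
    unfolding err_def by linarith
  have "h * (f y + err) = g y - exp (- (\<beta> * h)) * (cos_transform P (y + t) - cos_transform P y)"
    unfolding g_def f_def err_def using key[of "y + t"] key[of y] by (simp add: algebra_simps)
  also have "\<dots> = g y - exp (- (\<beta> * h)) * expectation (\<lambda>\<omega>. g (y + Z h \<omega>))" by (simp only: Eg)
  also have "\<dots> \<ge> g y - exp (- (\<beta> * h)) * (g y + \<eta>)"
    using Egle by (intro diff_left_mono mult_left_mono) auto
  finally have 1: "(1 - exp (- (\<beta> * h))) * g y - exp (- (\<beta> * h)) * \<eta> \<le> h * (f y + err)"
    by (simp add: algebra_simps)
  have "exp (- (\<beta> * h)) * \<eta> \<le> \<eta>" using \<eta> h \<beta>_pos by (intro mult_left_le_one_le) auto
  with 1 have "((1 - exp (- (\<beta> * h))) * g y - \<eta>) / h \<le> f y + err"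
    using h by (simp add: pos_divide_le_eq mult.commute)
  then have 2: "((1 - exp (- (\<beta> * h))) / h) * g y - \<eta> / h \<le> f y + err"
    by (simp add: diff_divide_distrib[of _ \<eta> h])
  \<comment> \<open>The discrete discount rate is replaced by \<open>\<beta>\<close>. The bound
    \<open>B\<close> on \<open>g\<close> makes the error uniform, as \<open>y\<close> depends on
    \<open>h\<close>.\<close>
  have "\<bar>((1 - exp (- (\<beta> * h))) / h - \<beta>) * g y\<bar> \<le> \<bar>(1 - exp (- (\<beta> * h))) / h - \<beta>\<bar> * B"
    unfolding abs_mult by (intro mult_left_mono gB) simp
  then have "\<bar>((1 - exp (- (\<beta> * h))) / h - \<beta>) * g y\<bar> \<le> e / 4" using n(2) by (simp add: h_def)
  then have "\<beta> * g y - e / 4 \<le> ((1 - exp (- (\<beta> * h))) / h) * g y"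
    unfolding left_diff_distrib[of _ \<beta> "g y"] by linarith
  with 2 err \<eta> have "\<beta> * g y - e \<le> f y" by linarith
  moreover have "g x \<le> g y + e" for x using gS[of x] y \<eta> by linarith
  ultimately show ?thesis using that by blast
qed

text \<open>The potential of the signed charge \<open>\<delta>\<^sub>-\<^sub>t - \<delta>\<^sub>0\<close> is largest at its positive part.\<close>

lemma cos_transform_resolvent_increment_le:
  "cos_transform resolvent (x + t) - cos_transform resolvent x \<le> cos_transform resolvent 0 - cos_transform resolvent t"
proof (rule ccontr)
  define U where "U = cos_transform resolvent"
  assume "\<not> ?thesis"
  then have gt: "U 0 - U t < U (x + t) - U x" by (simp add: U_def)
  \<comment> \<open>The excess \<open>4 * c\<close> is spent in equal parts: smoothing
    \<open>U\<close> to \<open>V\<close> around \<open>x\<close>, the tolerance \<open>e\<close>,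
    smoothing around \<open>y\<close>, and continuity of \<open>U\<close> at
    \<open>- t\<close>.\<close>
  define c where "c = ((U (x + t) - U x) - (U 0 - U t)) / 4"
  have c: "0 < c" using gt by (simp add: c_def)
  have Uint: "integrable lborel resolvent" by (rule integrable_resolvent)
  have w0: "0 < \<beta> + \<psi> l" for l using \<beta>_pos \<psi>_nonneg[of l] by simp
  have U0: "U y \<le> U 0" for y
    unfolding U_def cos_transform_def
  proof (rule integral_mono[OF integrable_cos_mult[OF Uint] integrable_cos_mult[OF Uint]])
    fix l
    show "cos (l * y) * resolvent l \<le> cos (l * 0) * resolvent l"
      by (rule mult_right_mono) (use w0[of l] in auto)
  qed
  obtain \<delta> where \<delta>: "0 < \<delta>" "\<And>z. \<bar>z + t\<bar> < \<delta> \<Longrightarrow> \<bar>U z - U t\<bar> < c"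
  proof -
    have "isCont U (- t)" unfolding U_def by (rule isCont_cos_transform[OF Uint])
    then obtain d where "0 < d" "\<And>z. \<bar>z - (- t)\<bar> < d \<Longrightarrow> \<bar>U z - U (- t)\<bar> < c"
      using c unfolding continuous_at_eps_delta dist_real_def by blast
    then show ?thesis using that[of d] by (simp add: U_def cos_transform_minus)
  qed
  \<comment> \<open>The multiplier 1, which belongs to a point charge, is not integrable; Gaussian
    damping replaces the point charge by a bump of width \<open>1 / (n + 1)\<close>.\<close>
  define gauss where "gauss n l = exp (- ((1 / real (Suc n)) * l)\<^sup>2 / 2)" for n l
  have gint: "integrable lborel (gauss n)" for n
    unfolding gauss_def by (rule cos_transform_gaussian(2)) simp
  have [measurable]: "gauss n \<in> borel_measurable borel" for n unfolding gauss_def by measurable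
  have g01: "0 \<le> gauss n l" "gauss n l \<le> 1" for n l by (auto simp: gauss_def)
  have diffint: "integrable lborel (\<lambda>l. resolvent l - gauss n l * resolvent l)" for n
    by (intro Bochner_Integration.integrable_diff Uint integrable_mult_resolvent gint)
  have "(\<lambda>n. LINT l|lborel. \<bar>resolvent l - gauss n l * resolvent l\<bar>) \<longlonglongrightarrow> (LINT (l::real)|lborel. (0::real))"
  proof (rule integral_dominated_convergence[where w = resolvent])
    show "AE l in lborel. (\<lambda>n. \<bar>resolvent l - gauss n l * resolvent l\<bar>) \<longlonglongrightarrow> 0"
    proof (rule AE_I2)
      fix l
      have "(\<lambda>n. gauss n l) \<longlonglongrightarrow> 1"
      proof -
        have "(\<lambda>n. exp (- ((1 / real (Suc n)) * l)\<^sup>2 / 2)) \<longlonglongrightarrow> exp (- (0 * l)\<^sup>2 / 2)"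
          by (intro tendsto_intros LIMSEQ_Suc[OF lim_1_over_n]) auto
        then show ?thesis by (simp add: gauss_def)
      qed
      then have "(\<lambda>n. \<bar>resolvent l - gauss n l * resolvent l\<bar>) \<longlonglongrightarrow> \<bar>resolvent l - 1 * resolvent l\<bar>"
        by (intro tendsto_intros)
      then show "(\<lambda>n. \<bar>resolvent l - gauss n l * resolvent l\<bar>) \<longlonglongrightarrow> 0" by simp
    qed
    show "AE l in lborel. norm \<bar>resolvent l - gauss n l * resolvent l\<bar> \<le> resolvent l" for n
    proof (rule AE_I2)
      fix l
      have "resolvent l - gauss n l * resolvent l = (1 - gauss n l) * resolvent l" by (simp add: algebra_simps diff_divide_distrib)
      moreover have "0 \<le> (1 - gauss n l) * resolvent l" "(1 - gauss n l) * resolvent l \<le> resolvent l"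
        using g01[of n l] w0[of l] by (auto intro!: divide_right_mono)
      ultimately show "norm \<bar>resolvent l - gauss n l * resolvent l\<bar> \<le> resolvent l"
        unfolding real_norm_def by linarith
    qed
  qed (use Uint in auto)
  then have "\<forall>\<^sub>F n in sequentially. (LINT l|lborel. \<bar>resolvent l - gauss n l * resolvent l\<bar>) < c / 2"
    using c by (intro order_tendstoD) auto
  \<comment> \<open>Outside distance \<open>\<delta>\<close> of 0 the bump has to stay below
    \<open>\<beta> * c\<close>; the left side arises from \<open>exp (- a) <= 1 / a\<close> with
    \<open>a = (z / r)^2 / 2\<close>.\<close>
  moreover have "\<forall>\<^sub>F n in sequentially. 2 * sqrt (2 * pi) / \<delta>\<^sup>2 * (1 / real (Suc n)) < \<beta> * c"
  proof -
    have "(\<lambda>n. 2 * sqrt (2 * pi) / \<delta>\<^sup>2 * (1 / real (Suc n))) \<longlonglongrightarrow> 2 * sqrt (2 * pi) / \<delta>\<^sup>2 * 0"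
      by (intro tendsto_intros LIMSEQ_Suc[OF lim_1_over_n])
    then show ?thesis using c \<beta>_pos by (intro order_tendstoD) auto
  qed
  ultimately have "\<forall>\<^sub>F n in sequentially. (LINT l|lborel. \<bar>resolvent l - gauss n l * resolvent l\<bar>) < c / 2 \<and>
      2 * sqrt (2 * pi) / \<delta>\<^sup>2 * (1 / real (Suc n)) < \<beta> * c" by (rule eventually_conj)
  then obtain n where n: "(LINT l|lborel. \<bar>resolvent l - gauss n l * resolvent l\<bar>) < c / 2"
      "2 * sqrt (2 * pi) / \<delta>\<^sup>2 * (1 / real (Suc n)) < \<beta> * c"
    using eventually_happens'[OF sequentially_bot] by blast
  define r where "r = 1 / real (Suc n)"
  have r: "0 < r" by (simp add: r_def)
  define V where "V = cos_transform (\<lambda>l. gauss n l * resolvent l)"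
  have UV: "\<bar>U z - V z\<bar> < c / 2" for z
    using abs_cos_transform_le[OF diffint[of n], of z] n(1)
      cos_transform_diff[OF Uint integrable_mult_resolvent[OF gint[of n]], of z]
    by (simp add: U_def V_def)
  define e where "e = min c (\<beta> * c)"
  have e: "0 < e" "e \<le> c" "e \<le> \<beta> * c" using c \<beta>_pos by (auto simp: e_def)
  obtain y where y: "\<And>x. V (x + t) - V x \<le> V (y + t) - V y + e"
      "\<beta> * (V (y + t) - V y) - e \<le> cos_transform (gauss n) (y + t) - cos_transform (gauss n) y"
    using resolvent_maximum_principle[OF gint[of n] e(1), of t] unfolding V_def by blast
  have Vy: "U 0 - U t + 2 * c \<le> V (y + t) - V y"
  proof -
    have "4 * c = (U (x + t) - U x) - (U 0 - U t)" by (simp add: c_def)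
    then show ?thesis using y(1)[of x] UV[of "x + t"] UV[of x] e(2) unfolding abs_less_iff by linarith
  qed
  have H: "cos_transform (gauss n) z = sqrt (2 * pi) / r * exp (- (z / r)\<^sup>2 / 2)" for z
    unfolding gauss_def r_def by (rule cos_transform_gaussian) simp
  \<comment> \<open>At a near-maximum the positive charge is at least \<open>\<beta> * c\<close>.
    Hence \<open>y + t\<close> lies under the bump at 0, which locates \<open>y\<close> near
    \<open>- t\<close>.\<close>
  have "\<beta> * (2 * c) \<le> \<beta> * (V (y + t) - V y)"
    using Vy U0[of t] \<beta>_pos by (intro mult_left_mono) auto
  then have "\<beta> * c \<le> cos_transform (gauss n) (y + t) - cos_transform (gauss n) y"
    using y(2) e(3) by linarith
  moreover have "0 \<le> cos_transform (gauss n) y" unfolding H using r by simp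
  ultimately have Hy: "\<beta> * c \<le> cos_transform (gauss n) (y + t)" by linarith
  have "\<bar>y + t\<bar> < \<delta>"
  proof (rule ccontr)
    assume "\<not> \<bar>y + t\<bar> < \<delta>"
    then have sq: "\<delta>\<^sup>2 \<le> (y + t)\<^sup>2" using \<delta>(1) by (metis abs_le_square_iff abs_of_pos not_le)
    have "(y + t)\<^sup>2 > 0" using sq \<delta>(1) by (metis less_le_trans zero_less_power)
    define a where "a = ((y + t) / r)\<^sup>2 / 2"
    have a: "0 < a" using \<open>(y + t)\<^sup>2 > 0\<close> r by (simp add: a_def)
    have "a \<le> exp a" using exp_ge_add_one_self[of a] by linarith
    then have "exp (- a) \<le> 1 / a" using a by (simp add: exp_minus field_simps)
    then have "cos_transform (gauss n) (y + t) \<le> sqrt (2 * pi) / r * (1 / a)"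
      unfolding H a_def using r by (intro mult_left_mono) auto
    also have "\<dots> = 2 * sqrt (2 * pi) * r / (y + t)\<^sup>2"
      using r by (simp add: a_def power_divide field_simps power2_eq_square)
    also have "\<dots> \<le> 2 * sqrt (2 * pi) * r / \<delta>\<^sup>2"
      using sq \<delta>(1) r \<open>(y + t)\<^sup>2 > 0\<close> by (intro divide_left_mono) auto
    also have "\<dots> < \<beta> * c" using n(2) by (simp add: r_def mult.commute)
    finally show False using Hy by simp
  qed
  from \<delta>(2)[OF this] have "U (y + t) - U y < U 0 - U t + c"
    using U0[of "y + t"] unfolding abs_less_iff by linarith
  then show False using Vy UV[of "y + t"] UV[of y] unfolding abs_less_iff by linarith
qed

section \<open>Increments of the potential density\<close>

lemma u_pot_eq: "u_pot \<psi> \<beta> x = 1 / (2 * pi) * cos_transform resolvent x"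
  by (simp add: u_pot_def cos_transform_def)

text \<open>The maximum principle at \<open>x\<close> with \<open>t\<close>, and at
  \<open>x + t\<close> with \<open>- t\<close>, gives both signs by evenness.\<close>

lemma u_pot_increment_le: "\<bar>u_pot \<psi> \<beta> (x + t) - u_pot \<psi> \<beta> x\<bar> \<le> sigma_sq \<psi> \<beta> t / 2"
proof -
  have *: "u_pot \<psi> \<beta> (x + t) - u_pot \<psi> \<beta> x \<le> u_pot \<psi> \<beta> 0 - u_pot \<psi> \<beta> t" for x t
    unfolding u_pot_eq right_diff_distrib[symmetric]
    by (intro mult_left_mono cos_transform_resolvent_increment_le) simp
  have "u_pot \<psi> \<beta> (- t) = u_pot \<psi> \<beta> t" by (simp add: u_pot_eq cos_transform_minus)
  then have "\<bar>u_pot \<psi> \<beta> (x + t) - u_pot \<psi> \<beta> x\<bar> \<le> u_pot \<psi> \<beta> 0 - u_pot \<psi> \<beta> t"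
    using *[of x t] *[of "x + t" "- t"] by (simp add: abs_le_iff)
  then show ?thesis by (simp add: sigma_sq_def)
qed

lemma isCont_u_pot: "isCont (u_pot \<psi> \<beta>) x"
  unfolding u_pot_eq[abs_def] by (intro continuous_intros isCont_cos_transform integrable_resolvent)

lemma u_pot_minus: "u_pot \<psi> \<beta> (- x) = u_pot \<psi> \<beta> x"
  by (simp add: u_pot_eq cos_transform_minus)

lemma abs_u_pot_le: "\<bar>u_pot \<psi> \<beta> x\<bar> \<le> u_pot \<psi> \<beta> 0"
proof -
  have "\<bar>cos_transform resolvent x\<bar> \<le> (LINT l|lborel. \<bar>resolvent l\<bar>)"
    by (rule abs_cos_transform_le[OF integrable_resolvent])
  also have "(LINT l|lborel. \<bar>resolvent l\<bar>) = cos_transform resolvent 0"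
    using \<beta>_pos \<psi>_nonneg by (auto simp: cos_transform_def abs_of_nonneg intro!: Bochner_Integration.integral_cong)
  finally show ?thesis by (simp add: u_pot_eq abs_mult divide_right_mono)
qed

end

section \<open>Dyadic chaining with exponential tails\<close>

definition dyadic_floor :: "nat \<Rightarrow> real \<Rightarrow> real" where
  "dyadic_floor k x = real (nat \<lfloor>2 ^ k * x\<rfloor>) / 2 ^ k"

lemma dyadic_floor_bounds:
  assumes "0 \<le> x"
  shows "0 \<le> dyadic_floor k x" "dyadic_floor k x \<le> x" "x - dyadic_floor k x \<le> 1 / 2 ^ k"
proof -
  have "0 \<le> \<lfloor>2 ^ k * x\<rfloor>" using assms by simp
  then have eq: "dyadic_floor k x = of_int \<lfloor>2 ^ k * x\<rfloor> / 2 ^ k" by (simp add: dyadic_floor_def)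
  show "0 \<le> dyadic_floor k x" by (simp add: dyadic_floor_def)
  show "dyadic_floor k x \<le> x" unfolding eq by (simp add: field_simps)
  have "2 ^ k * x \<le> of_int \<lfloor>2 ^ k * x\<rfloor> + 1" by linarith
  then have "x \<le> (of_int \<lfloor>2 ^ k * x\<rfloor> + 1) / 2 ^ k" by (simp add: pos_le_divide_eq mult.commute)
  then show "x - dyadic_floor k x \<le> 1 / 2 ^ k" unfolding eq by (simp add: add_divide_distrib)
qed

lemma dyadic_floor_tendsto:
  assumes "0 \<le> x"
  shows "(\<lambda>k. dyadic_floor k x) \<longlonglongrightarrow> x"
proof -
  have "norm (x - dyadic_floor k x) \<le> (1 / 2) ^ k" for k
    using dyadic_floor_bounds(2,3)[OF assms, of k] by (simp add: power_one_over)
  then have "(\<lambda>k. x - dyadic_floor k x) \<longlonglongrightarrow> 0"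
    by (intro Lim_null_comparison[OF always_eventually[OF allI] LIMSEQ_realpow_zero]) auto
  then have "(\<lambda>k. x - (x - dyadic_floor k x)) \<longlonglongrightarrow> x - 0" by (intro tendsto_diff tendsto_const)
  then show ?thesis by simp
qed

text \<open>Doubling the scale doubles the floor up to one binary digit, so one refinement moves the
  point by at most one cell of the finer grid.\<close>

lemma dyadic_floor_step:
  fixes F :: "real \<Rightarrow> real"
  assumes inc: "\<And>j. j < 2 ^ Suc k \<Longrightarrow> \<bar>F (real (Suc j) / 2 ^ Suc k) - F (real j / 2 ^ Suc k)\<bar> \<le> l"
    and x: "0 \<le> x" "x \<le> 1" and l: "0 \<le> l"
  shows "\<bar>F (dyadic_floor (Suc k) x) - F (dyadic_floor k x)\<bar> \<le> l"
proof -
  define i where "i = \<lfloor>2 ^ k * x\<rfloor>"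
  define j where "j = nat i"
  have i: "0 \<le> i" "of_int i \<le> 2 ^ k * x" "2 ^ k * x < of_int i + 1" using x by (auto simp: i_def)
  have J: "dyadic_floor k x = real (2 * j) / 2 ^ Suc k" by (simp add: dyadic_floor_def j_def i_def)
  have "\<lfloor>2 ^ Suc k * x\<rfloor> = 2 * i \<or> \<lfloor>2 ^ Suc k * x\<rfloor> = 2 * i + 1"
  proof -
    have "of_int (2 * i) \<le> 2 ^ Suc k * x" "2 ^ Suc k * x < of_int (2 * i) + 2" using i by auto
    then show ?thesis by linarith
  qed
  then show ?thesis
  proof
    assume "\<lfloor>2 ^ Suc k * x\<rfloor> = 2 * i"
    then have "dyadic_floor (Suc k) x = real (2 * j) / 2 ^ Suc k"
      using i(1) by (simp add: dyadic_floor_def j_def nat_mult_distrib)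
    then show ?thesis using J l by simp
  next
    assume f: "\<lfloor>2 ^ Suc k * x\<rfloor> = 2 * i + 1"
    then have eq: "dyadic_floor (Suc k) x = real (Suc (2 * j)) / 2 ^ Suc k"
      using i(1) by (simp add: dyadic_floor_def j_def nat_add_distrib nat_mult_distrib)
    \<comment> \<open>\<open>x <= 1\<close> keeps the cell to the right of index
      \<open>2 * j\<close> inside [0, 1]; at \<open>x = 1\<close> the floor is even and this case
      does not arise.\<close>
    have "of_int (2 * i + 1) \<le> 2 ^ Suc k * x" by (metis f of_int_floor_le)
    also have "\<dots> \<le> 2 ^ Suc k * 1" using x by (intro mult_left_mono) auto
    finally have "real_of_int (2 * i + 1) \<le> of_int (2 ^ Suc k)" by simp
    then have "2 * i + 1 \<le> 2 ^ Suc k" by (simp only: of_int_le_iff)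
    then have "int (2 * j) < int (2 ^ Suc k)" using i(1) by (simp add: j_def)
    then have "2 * j < 2 ^ Suc k" by (simp only: of_nat_less_iff)
    from inc[OF this] show ?thesis by (simp only: eq J)
  qed
qed

text \<open>Points at most one cell length apart have equal or adjacent dyadic floors.\<close>

lemma dyadic_floor_close:
  fixes F :: "real \<Rightarrow> real"
  assumes inc: "\<And>j. j < 2 ^ k \<Longrightarrow> \<bar>F (real (Suc j) / 2 ^ k) - F (real j / 2 ^ k)\<bar> \<le> l"
    and x: "0 \<le> x" "x \<le> y" "y \<le> 1" "y - x \<le> 1 / 2 ^ k" and l: "0 \<le> l"
  shows "\<bar>F (dyadic_floor k y) - F (dyadic_floor k x)\<bar> \<le> l"
proof -
  define i where "i = \<lfloor>2 ^ k * x\<rfloor>"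
  define j where "j = nat i"
  have i: "0 \<le> i" "of_int i \<le> 2 ^ k * x" "2 ^ k * x < of_int i + 1" using x by (auto simp: i_def)
  have J: "dyadic_floor k x = real j / 2 ^ k" by (simp add: dyadic_floor_def j_def i_def)
  have xy: "2 ^ k * x \<le> 2 ^ k * y" using x by simp
  have "2 ^ k * y \<le> 2 ^ k * x + 1" using x(4) by (simp add: field_simps)
  with i xy have "\<lfloor>2 ^ k * y\<rfloor> = i \<or> \<lfloor>2 ^ k * y\<rfloor> = i + 1" by linarith
  then show ?thesis
  proof
    assume "\<lfloor>2 ^ k * y\<rfloor> = i"
    then show ?thesis using J l by (simp add: dyadic_floor_def j_def)
  next
    assume f: "\<lfloor>2 ^ k * y\<rfloor> = i + 1"
    then have eq: "dyadic_floor k y = real (Suc j) / 2 ^ k"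
      using i(1) by (simp add: dyadic_floor_def j_def nat_add_distrib)
    have "of_int (i + 1) \<le> 2 ^ k * y" by (metis f of_int_floor_le)
    also have "\<dots> \<le> 2 ^ k * 1" using x by (intro mult_left_mono) auto
    finally have "real_of_int (i + 1) \<le> of_int (2 ^ k)" by simp
    then have "i + 1 \<le> 2 ^ k" by (simp only: of_int_le_iff)
    then have "int j < int (2 ^ k)" using i(1) by (simp add: j_def)
    then have "j < 2 ^ k" by (simp only: of_nat_less_iff)
    from inc[OF this] show ?thesis by (simp only: eq J)
  qed
qed

text \<open>Telescoping from the coarsest level, where the floor is an endpoint of [0, 1]. The right
  endpoint serves as anchor, because in the application it is the time at which the marginal bound
  is known.\<close>

lemma dyadic_chain_bound:
  fixes F :: "real \<Rightarrow> real"
  assumes cont: "continuous_on {0..1} F"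
    and inc: "\<And>k j. j < 2 ^ k \<Longrightarrow> \<bar>F (real (Suc j) / 2 ^ k) - F (real j / 2 ^ k)\<bar> \<le> l k"
    and l: "summable l" "\<And>k. 0 \<le> l k" and x: "0 \<le> x" "x \<le> 1"
  shows "\<bar>F x - F 1\<bar> \<le> suminf l"
proof -
  have part: "\<bar>F (dyadic_floor n x) - F 1\<bar> \<le> sum l {..n}" for n
  proof (induction n)
    case 0
    have "dyadic_floor 0 x = 0 \<or> dyadic_floor 0 x = 1"
    proof -
      define i where "i = \<lfloor>x\<rfloor>"
      have "i = 0 \<or> i = 1" unfolding i_def using x by linarith
      moreover have "dyadic_floor 0 x = real (nat i)" by (simp add: dyadic_floor_def i_def)
      ultimately show ?thesis by auto
    qed
    then show ?case using inc[of 0 0] l(2)[of 0] by (auto simp: abs_minus_commute)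
  next
    case (Suc n)
    have "\<bar>F (dyadic_floor (Suc n) x) - F (dyadic_floor n x)\<bar> \<le> l (Suc n)"
      by (rule dyadic_floor_step[OF inc x l(2)])
    with Suc show ?case by simp
  qed
  have "(\<lambda>n. F (dyadic_floor n x)) \<longlonglongrightarrow> F x"
  proof (rule continuous_on_tendsto_compose[OF cont dyadic_floor_tendsto[OF x(1)]])
    show "\<forall>\<^sub>F n in sequentially. dyadic_floor n x \<in> {0..1}"
      using dyadic_floor_bounds[OF x(1)] x(2) by (auto intro!: always_eventually intro: order.trans)
  qed (use x in auto)
  then have "(\<lambda>n. \<bar>F (dyadic_floor n x) - F 1\<bar>) \<longlonglongrightarrow> \<bar>F x - F 1\<bar>" by (intro tendsto_intros)
  then show ?thesis
  proof (rule LIMSEQ_le_const2)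
    have "sum l {..n} \<le> suminf l" for n by (rule sum_le_suminf) (use l in auto)
    then show "\<exists>N. \<forall>n\<ge>N. \<bar>F (dyadic_floor n x) - F 1\<bar> \<le> suminf l" using part order.trans by blast
  qed
qed

text \<open>Grid values alone determine a continuous path: the values at dyadic floors are uniformly
  Cauchy with tails \<open>R\<close>, and two close points are compared through adjacent floors of
  one level.\<close>

lemma dyadic_chain_limit:
  fixes F :: "real \<Rightarrow> real"
  assumes inc: "\<forall>\<^sub>F k in sequentially. \<forall>j<2 ^ k. \<bar>F (real (Suc j) / 2 ^ k) - F (real j / 2 ^ k)\<bar> \<le> l k"
    and l: "summable l" "\<And>k. 0 \<le> l k"
  shows "continuous_on {0..1} (\<lambda>x. lim (\<lambda>k. F (dyadic_floor k x)))"
proof -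
  obtain k0 where k0: "\<And>k j. k0 \<le> k \<Longrightarrow> j < 2 ^ k \<Longrightarrow> \<bar>F (real (Suc j) / 2 ^ k) - F (real j / 2 ^ k)\<bar> \<le> l k"
    using inc unfolding eventually_sequentially by blast
  define G where "G x = lim (\<lambda>k. F (dyadic_floor k x))" for x
  \<comment> \<open>The sum starts at \<open>Suc k\<close>, since leaving level \<open>k\<close>
    uses increments of the next finer grid.\<close>
  define R where "R k = (\<Sum>i. l (i + Suc k))" for k
  have step: "\<bar>F (dyadic_floor (Suc k) x) - F (dyadic_floor k x)\<bar> \<le> l (Suc k)"
    if "k0 \<le> k" "0 \<le> x" "x \<le> 1" for k x
    by (rule dyadic_floor_step) (use k0[of "Suc k"] that l in auto)
  have dist_sum: "\<bar>F (dyadic_floor (n + k) x) - F (dyadic_floor k x)\<bar> \<le> (\<Sum>i<n. l (i + Suc k))"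
    if "k0 \<le> k" "0 \<le> x" "x \<le> 1" for n k x
  proof (induction n)
    case (Suc n)
    have "\<bar>F (dyadic_floor (Suc (n + k)) x) - F (dyadic_floor (n + k) x)\<bar> \<le> l (Suc (n + k))"
      by (rule step) (use that in auto)
    with Suc show ?case by simp
  qed simp
  have ls: "summable (\<lambda>i. l (i + Suc k))" for k using l(1) by (simp add: summable_iff_shift del: add_Suc_right)
  have dist_R: "\<bar>F (dyadic_floor (n + k) x) - F (dyadic_floor k x)\<bar> \<le> R k"
    if "k0 \<le> k" "0 \<le> x" "x \<le> 1" for n k x
    using dist_sum[OF that, of n] sum_le_suminf[OF ls[of k], of "{..<n}"] l(2) by (simp add: R_def)
  have R0: "R \<longlonglongrightarrow> 0"
    unfolding R_def using LIMSEQ_Suc[OF suminf_exist_split2[OF l(1)]] by simp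
  have conv: "(\<lambda>k. F (dyadic_floor k x)) \<longlonglongrightarrow> G x" if x: "0 \<le> x" "x \<le> 1" for x
  proof -
    have "Cauchy (\<lambda>k. F (dyadic_floor k x))"
    proof (rule metric_CauchyI)
      fix e :: real assume "0 < e"
      then have "\<forall>\<^sub>F k in sequentially. R k < e / 2" using R0 by (intro order_tendstoD) auto
      then obtain k where k: "k0 \<le> k" "R k < e / 2"
        by (metis (no_types, lifting) eventually_sequentially nle_le)
      have "dist (F (dyadic_floor p x)) (F (dyadic_floor k x)) < e / 2" if "k \<le> p" for p
        using dist_R[OF k(1) x, of "p - k"] k(2) that by (simp add: dist_real_def)
      then show "\<exists>M. \<forall>p\<ge>M. \<forall>q\<ge>M. dist (F (dyadic_floor p x)) (F (dyadic_floor q x)) < e"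
        by (meson dist_triangle_half_l)
    qed
    then show ?thesis unfolding G_def by (simp add: Cauchy_convergent_iff convergent_LIMSEQ_iff)
  qed
  have GR: "\<bar>G x - F (dyadic_floor k x)\<bar> \<le> R k" if "k0 \<le> k" "0 \<le> x" "x \<le> 1" for k x
  proof (rule LIMSEQ_le_const2)
    show "(\<lambda>n. \<bar>F (dyadic_floor (n + k) x) - F (dyadic_floor k x)\<bar>) \<longlonglongrightarrow> \<bar>G x - F (dyadic_floor k x)\<bar>"
      using LIMSEQ_ignore_initial_segment[OF conv[OF that(2,3)], of k] by (intro tendsto_intros)
    show "\<exists>N. \<forall>n\<ge>N. \<bar>F (dyadic_floor (n + k) x) - F (dyadic_floor k x)\<bar> \<le> R k"
      using dist_R[OF that] by blast
  qed
  have "\<exists>d>0. \<forall>x y. 0 \<le> x \<longrightarrow> x \<le> y \<longrightarrow> y \<le> 1 \<longrightarrow> y - x < d \<longrightarrow> \<bar>G y - G x\<bar> < e" if e: "0 < e" for e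
  proof -
    have "\<forall>\<^sub>F k in sequentially. R k < e / 3" using R0 e by (intro order_tendstoD) auto
    moreover have "\<forall>\<^sub>F k in sequentially. l k < e / 3"
      using summable_LIMSEQ_zero[OF l(1)] e by (intro order_tendstoD) auto
    ultimately have "\<forall>\<^sub>F k in sequentially. R k < e / 3 \<and> l k < e / 3 \<and> k0 \<le> k"
      by (intro eventually_conj eventually_ge_at_top)
    then obtain k where k: "R k < e / 3" "l k < e / 3" "k0 \<le> k"
      using eventually_happens'[OF sequentially_bot] by blast
    have "\<bar>G y - G x\<bar> < e" if x: "0 \<le> x" "x \<le> y" "y \<le> 1" "y - x < 1 / 2 ^ k" for x y
    proof -
      have "\<bar>F (dyadic_floor k y) - F (dyadic_floor k x)\<bar> \<le> l k"
        by (rule dyadic_floor_close[OF k0[OF k(3)]]) (use x l in auto)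
      moreover have "\<bar>G y - F (dyadic_floor k y)\<bar> \<le> R k" "\<bar>G x - F (dyadic_floor k x)\<bar> \<le> R k"
        using GR[OF k(3)] x by auto
      ultimately show ?thesis
        using k unfolding abs_le_iff abs_less_iff by (intro conjI) linarith+
    qed
    then show ?thesis by (intro exI[of _ "1 / 2 ^ k"]) auto
  qed
  then have "continuous_on {0..1} G"
    unfolding continuous_on_iff dist_real_def
    by (metis abs_minus_commute abs_of_nonneg atLeastAtMost_iff diff_ge_0_iff_ge linorder_le_cases)
  then show ?thesis by (simp add: G_def[abs_def])
qed

section \<open>Union bounds over grids and continuous modifications\<close>

lemma (in prob_space) prob_dyadic_grid_le:
  fixes F :: "real \<Rightarrow> 'a \<Rightarrow> real"
  assumes meas: "\<And>x. 0 \<le> x \<Longrightarrow> x \<le> 1 \<Longrightarrow> F x \<in> borel_measurable M"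
    and tail: "\<And>j. j < 2 ^ k \<Longrightarrow>
      prob {\<omega> \<in> space M. l \<le> \<bar>F (real (Suc j) / 2 ^ k) \<omega> - F (real j / 2 ^ k) \<omega>\<bar>} \<le> p"
  shows "{\<omega> \<in> space M. \<exists>j<2 ^ k. l \<le> \<bar>F (real (Suc j) / 2 ^ k) \<omega> - F (real j / 2 ^ k) \<omega>\<bar>} \<in> events"
    and "prob {\<omega> \<in> space M. \<exists>j<2 ^ k. l \<le> \<bar>F (real (Suc j) / 2 ^ k) \<omega> - F (real j / 2 ^ k) \<omega>\<bar>} \<le> 2 ^ k * p"
proof -
  define E where "E j = {\<omega> \<in> space M. l \<le> \<bar>F (real (Suc j) / 2 ^ k) \<omega> - F (real j / 2 ^ k) \<omega>\<bar>}" for j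
  have eq: "{\<omega> \<in> space M. \<exists>j<2 ^ k. l \<le> \<bar>F (real (Suc j) / 2 ^ k) \<omega> - F (real j / 2 ^ k) \<omega>\<bar>} = (\<Union>j\<in>{..<2 ^ k}. E j)"
    by (auto simp: E_def)
  have E: "E j \<in> events" if "j < 2 ^ k" for j
  proof -
    have "real (Suc j) \<le> real (2 ^ k)" using that by (subst of_nat_le_iff) auto
    then have 1: "real (Suc j) / 2 ^ k \<le> 1" by simp
    moreover have "real j / 2 ^ k \<le> real (Suc j) / 2 ^ k" by (rule divide_right_mono) auto
    ultimately have "real j / 2 ^ k \<le> 1" by linarith
    then have [measurable]: "F (real j / 2 ^ k) \<in> borel_measurable M" by (rule meas[rotated]) simp
    have [measurable]: "F (real (Suc j) / 2 ^ k) \<in> borel_measurable M" using 1 by (rule meas[rotated]) simp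
    show ?thesis unfolding E_def by measurable
  qed
  show "{\<omega> \<in> space M. \<exists>j<2 ^ k. l \<le> \<bar>F (real (Suc j) / 2 ^ k) \<omega> - F (real j / 2 ^ k) \<omega>\<bar>} \<in> events"
    unfolding eq using E by auto
  have "prob (\<Union>j\<in>{..<2 ^ k}. E j) \<le> (\<Sum>j<2 ^ k. prob (E j))"
    using E by (intro finite_measure_subadditive_finite) auto
  also have "\<dots> \<le> (\<Sum>j<(2::nat) ^ k. p)"
    using tail by (intro sum_mono) (auto simp: E_def)
  finally show "prob {\<omega> \<in> space M. \<exists>j<2 ^ k. l \<le> \<bar>F (real (Suc j) / 2 ^ k) \<omega> - F (real j / 2 ^ k) \<omega>\<bar>} \<le> 2 ^ k * p"
    unfolding eq by simp
qed

text \<open>The origin of the factor 2 in the thresholds: as \<open>exp 2 >= 4\<close>, a tail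
  \<open>exp (- 2 k)\<close> per cell still sums geometrically after a union over 2^k cells.\<close>

lemma two_pow_mult_exp_le: "2 ^ k * exp (- (2 * real k)) \<le> (1 / 2) ^ k"
proof -
  have "(4::real) \<le> exp 2"
  proof -
    have "(2::real) * 2 \<le> exp 1 * exp 1" using exp_ge_add_one_self[of 1] by (intro mult_mono) auto
    then show ?thesis by (simp add: exp_add[symmetric])
  qed
  then have "2 * exp (- 2) \<le> (1 / 2 :: real)" by (simp add: exp_minus field_simps)
  then have "(2 * exp (- 2)) ^ k \<le> (1 / 2 :: real) ^ k" by (rule power_mono) simp
  moreover have "(2 * exp (- 2)) ^ k = 2 ^ k * exp (- (2 * real k))"
    by (simp add: power_mult_distrib exp_of_nat_mult[symmetric] mult.commute)
  ultimately show ?thesis by simp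
qed

text \<open>The differentiated geometric series. Thresholds grow linearly in \<open>k\<close>
  because an exponential tail needs that many scale units to pay for 2^k cells.\<close>

lemma summable_linear_geometric:
  fixes Q :: real
  assumes "0 \<le> Q" "Q < 1"
  shows "summable (\<lambda>k. 2 * real (k + 1) * Q ^ k)"
proof -
  have "summable (\<lambda>n. diffs (\<lambda>_. 1) n * Q ^ n)"
    by (rule termdiff_converges[where K = 1]) (use assms in \<open>auto simp: summable_geometric\<close>)
  then have "summable (\<lambda>n. 2 * (diffs (\<lambda>_. 1) n * Q ^ n))" by (rule summable_mult)
  moreover have "(\<lambda>n. 2 * (diffs (\<lambda>_. 1) n * Q ^ n)) = (\<lambda>k. 2 * real (k + 1) * Q ^ k)"
    by (auto simp: diffs_def)
  ultimately show ?thesis by simp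
qed

text \<open>Borel-Cantelli controls all late grid increments, and the limit along dyadic floors is
  the modification. The same tail bound, for \<open>t\<close> and its dyadic floor, identifies this
  limit with \<open>X t\<close> almost surely.\<close>

lemma (in prob_space) continuous_modification:
  fixes X :: "real \<Rightarrow> 'a \<Rightarrow> real"
  assumes meas: "\<And>t. 0 \<le> t \<Longrightarrow> t \<le> T \<Longrightarrow> X t \<in> borel_measurable M"
    and T: "0 < T" and b: "0 < b" and Q: "0 < Q" "Q < 1" and C: "0 \<le> C"
    and inc: "\<And>k s t l. 0 \<le> s \<Longrightarrow> s \<le> T \<Longrightarrow> 0 \<le> t \<Longrightarrow> t \<le> T \<Longrightarrow> \<bar>s - t\<bar> \<le> T / 2 ^ k \<Longrightarrow>
      prob {\<omega> \<in> space M. l \<le> \<bar>X s \<omega> - X t \<omega>\<bar>} \<le> C * exp (- (l / (b * Q ^ k)))"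
  obtains Y where "\<And>t. 0 \<le> t \<Longrightarrow> t \<le> T \<Longrightarrow> Y t \<in> borel_measurable M"
    "\<And>t. 0 \<le> t \<Longrightarrow> t \<le> T \<Longrightarrow> AE \<omega> in M. Y t \<omega> = X t \<omega>"
    "AE \<omega> in M. continuous_on {0..T} (\<lambda>t. Y t \<omega>)"
proof -
  define F where "F x = X (T * x)" for x
  define l where "l k = b * (2 * real k * Q ^ k)" for k
  have l0: "0 \<le> l k" for k using b Q by (simp add: l_def)
  have ls: "summable l"
  proof -
    have "summable (\<lambda>k. b * (2 * real (k + 1) * Q ^ k))"
      using Q by (intro summable_mult summable_linear_geometric) auto
    then show ?thesis
    proof (rule summable_comparison_test_ev[rotated])
      show "\<forall>\<^sub>F k in sequentially. norm (l k) \<le> b * (2 * real (k + 1) * Q ^ k)"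
        using b Q by (auto simp: l_def intro!: always_eventually mult_left_mono mult_right_mono)
    qed
  qed
  have lexp: "exp (- (l k / (b * Q ^ k))) = exp (- (2 * real k))" for k
    using b Q by (simp add: l_def)
  have Tx: "0 \<le> T * x" "T * x \<le> T" if "0 \<le> x" "x \<le> 1" for x
    using that T by (auto intro: mult_left_le)
  have Fmeas: "F x \<in> borel_measurable M" if "0 \<le> x" "x \<le> 1" for x
    unfolding F_def using Tx[OF that] by (intro meas)
  define E where "E k = {\<omega> \<in> space M. \<exists>j<2 ^ k. l k \<le> \<bar>F (real (Suc j) / 2 ^ k) \<omega> - F (real j / 2 ^ k) \<omega>\<bar>}" for k
  have tail: "prob {\<omega> \<in> space M. l k \<le> \<bar>F (real (Suc j) / 2 ^ k) \<omega> - F (real j / 2 ^ k) \<omega>\<bar>} \<le> C * exp (- (2 * real k))"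
    if "j < 2 ^ k" for k j
  proof -
    have "real (Suc j) \<le> real (2 ^ k)" using that by (subst of_nat_le_iff) auto
    then have 1: "real (Suc j) / 2 ^ k \<le> 1" by simp
    define p where "p = real (Suc j) / 2 ^ k"
    define q where "q = real j / 2 ^ k"
    have pq: "p - q = 1 / 2 ^ k" by (simp add: p_def q_def field_simps)
    have "0 < 1 / (2::real) ^ k" by simp
    moreover have "0 \<le> p" "0 \<le> q" "p \<le> 1" using 1 by (simp_all add: p_def q_def)
    moreover from calculation have "q \<le> 1" using pq by linarith
    moreover have "\<bar>T * p - T * q\<bar> = T / 2 ^ k" using T pq by (simp add: right_diff_distrib[symmetric])
    ultimately show ?thesis
      unfolding F_def lexp[symmetric] p_def[symmetric] q_def[symmetric] using T
      by (intro inc) (auto intro: Tx)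
  qed
  have E: "E k \<in> events" "prob (E k) \<le> C * (1 / 2) ^ k" for k
  proof -
    show "E k \<in> events" unfolding E_def by (rule prob_dyadic_grid_le(1)[OF Fmeas tail])
    have "prob (E k) \<le> 2 ^ k * (C * exp (- (2 * real k)))"
      unfolding E_def by (rule prob_dyadic_grid_le(2)[OF Fmeas tail])
    also have "\<dots> = C * (2 ^ k * exp (- (2 * real k)))" by simp
    also have "\<dots> \<le> C * (1 / 2) ^ k" by (intro mult_left_mono two_pow_mult_exp_le C)
    finally show "prob (E k) \<le> C * (1 / 2) ^ k" .
  qed
  have geo: "summable (\<lambda>k. C * (1 / 2 :: real) ^ k)" by (intro summable_mult summable_geometric) simp
  have AE1: "AE \<omega> in M. \<forall>\<^sub>F k in sequentially. \<omega> \<in> space M - E k"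
    by (rule borel_cantelli_AE1[OF E(1)])
      (auto simp: emeasure_eq_measure intro!: summable_comparison_test_ev[OF _ geo] always_eventually E(2))
  \<comment> \<open>On paths without convergence \<open>lim\<close> has an unspecified value; this
    concerns a null set only.\<close>
  define Y where "Y t \<omega> = lim (\<lambda>k. F (dyadic_floor k (t / T)) \<omega>)" for t \<omega>
  show ?thesis
  proof (rule that[of Y])
    fix t assume t: "0 \<le> t" "t \<le> T"
    define x where "x = t / T"
    have x: "0 \<le> x" "x \<le> 1" "T * x = t" using t T by (auto simp: x_def)
    have d: "0 \<le> dyadic_floor k x" "dyadic_floor k x \<le> 1" for k
      using dyadic_floor_bounds[OF x(1), of k] x(2) by auto
    show "Y t \<in> borel_measurable M"
      unfolding Y_def[abs_def] x_def[symmetric] using Fmeas[OF d] by measurable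
    define A where "A k = {\<omega> \<in> space M. l k \<le> \<bar>F (dyadic_floor k x) \<omega> - X t \<omega>\<bar>}" for k
    have A: "A k \<in> events" for k
      unfolding A_def using Fmeas[OF d, of k] meas[OF t] by measurable
    have pA: "prob (A k) \<le> C * (1 / 2) ^ k" for k
    proof -
      have "\<bar>T * dyadic_floor k x - t\<bar> = T * (x - dyadic_floor k x)"
        using dyadic_floor_bounds(2)[OF x(1), of k] T x(3)
        by (metis abs_minus_commute abs_of_nonneg diff_ge_0_iff_ge mult_left_mono less_imp_le right_diff_distrib)
      also have "\<dots> \<le> T * (1 / 2 ^ k)"
        by (intro mult_left_mono dyadic_floor_bounds(3) x) (use T in auto)
      finally have "prob (A k) \<le> C * exp (- (l k / (b * Q ^ k)))"
        unfolding A_def F_def using Tx[OF d, of k] t by (intro inc) auto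
      also have "\<dots> = C * exp (- (2 * real k))" by (simp only: lexp)
      \<comment> \<open>Only one pair of times is involved; the factor \<open>2 ^ k\<close> is
        inserted so that the grid estimate applies.\<close>
      also have "\<dots> \<le> C * (2 ^ k * exp (- (2 * real k)))"
        using C by (intro mult_left_mono) (auto simp: mult_le_cancel_right1)
      also have "\<dots> \<le> C * (1 / 2) ^ k" by (intro mult_left_mono two_pow_mult_exp_le C)
      finally show ?thesis .
    qed
    have "AE \<omega> in M. \<forall>\<^sub>F k in sequentially. \<omega> \<in> space M - A k"
      by (rule borel_cantelli_AE1[OF A])
        (auto simp: emeasure_eq_measure intro!: summable_comparison_test_ev[OF _ geo] always_eventually pA)
    then show "AE \<omega> in M. Y t \<omega> = X t \<omega>"
    proof eventually_elim
      case (elim \<omega>)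
      then have ev: "\<forall>\<^sub>F k in sequentially. \<bar>F (dyadic_floor k x) \<omega> - X t \<omega>\<bar> \<le> l k"
        by eventually_elim (auto simp: A_def)
      have "(\<lambda>k. F (dyadic_floor k x) \<omega> - X t \<omega>) \<longlonglongrightarrow> 0"
        by (rule Lim_null_comparison[OF _ summable_LIMSEQ_zero[OF ls]]) (use ev in simp)
      then have "(\<lambda>k. F (dyadic_floor k x) \<omega>) \<longlonglongrightarrow> X t \<omega>" by (simp add: LIM_zero_iff)
      then show ?case unfolding Y_def x_def[symmetric] by (rule limI)
    qed
  next
    show "AE \<omega> in M. continuous_on {0..T} (\<lambda>t. Y t \<omega>)"
      using AE1
    proof eventually_elim
      case (elim \<omega>)
      then have "\<forall>\<^sub>F k in sequentially. \<forall>j<2 ^ k. \<bar>F (real (Suc j) / 2 ^ k) \<omega> - F (real j / 2 ^ k) \<omega>\<bar> \<le> l k"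
        by eventually_elim (force simp: E_def)
      from dyadic_chain_limit[OF this ls l0]
      have "continuous_on {0..1} (\<lambda>x. lim (\<lambda>k. F (dyadic_floor k x) \<omega>))" .
      then have "continuous_on {0..T} ((\<lambda>x. lim (\<lambda>k. F (dyadic_floor k x) \<omega>)) \<circ> (\<lambda>t. t / T))"
      proof (intro continuous_on_compose)
        show "continuous_on {0..T} (\<lambda>t. t / T)" by (intro continuous_intros) (use T in auto)
        assume c: "continuous_on {0..1} (\<lambda>x. lim (\<lambda>k. F (dyadic_floor k x) \<omega>))"
        have "(\<lambda>t. t / T) ` {0..T} \<subseteq> {0..1}" using T by auto
        with c show "continuous_on ((\<lambda>t. t / T) ` {0..T}) (\<lambda>x. lim (\<lambda>k. F (dyadic_floor k x) \<omega>))"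
          by (rule continuous_on_subset)
      qed
      then show ?case by (simp add: Y_def comp_def)
    qed
  qed
qed

section \<open>The iterated logarithm bound along a geometric sequence\<close>

lemma geometric_bracket:
  fixes \<theta> s :: real
  assumes \<theta>: "0 < \<theta>" "\<theta> < 1" and s: "0 < s" "s \<le> \<theta> ^ n0"
  obtains n where "n0 \<le> n" "\<theta> ^ Suc n \<le> s" "s \<le> \<theta> ^ n"
proof -
  obtain N where N: "\<theta> ^ N < s" using real_arch_pow_inv[OF s(1) \<theta>(2)] by blast
  define m where "m = (LEAST N. \<theta> ^ N < s)"
  have m: "\<theta> ^ m < s" unfolding m_def by (rule LeastI[of _ N]) (rule N)
  have "n0 < m"
  proof (rule ccontr)
    assume "\<not> n0 < m"
    then have "\<theta> ^ n0 \<le> \<theta> ^ m" using \<theta> by (intro power_decreasing) auto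
    then show False using m s by simp
  qed
  then obtain n where n: "m = Suc n" by (cases m) auto
  have "\<not> \<theta> ^ n < s" using not_less_Least[of n "\<lambda>N. \<theta> ^ N < s"] n by (simp add: m_def)
  then show ?thesis using that[of n] m n \<open>n0 < m\<close> by auto
qed

text \<open>Reading of the constant: \<open>(1 + \<eta>) * L\<close> bounds \<open>Y\<close> at the
  times \<open>\<theta> ^ n\<close>, the term with \<open>B * Q ^ m\<close> bounds the oscillation
  on the block below such a time, \<open>1 - A * Q ^ m\<close> is lost in replacing
  \<open>\<phi> (\<theta> ^ n)\<close> by \<open>\<phi> t\<close>, and \<open>1 - \<eta>\<close> in
  replacing \<open>ln n\<close> by \<open>ln (ln (1 / t))\<close>.\<close>

lemma (in prob_space) iterated_log_upper_bound:
  fixes Y :: "real \<Rightarrow> 'a \<Rightarrow> real" and \<phi> :: "real \<Rightarrow> real"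
  assumes meas: "\<And>t. 0 \<le> t \<Longrightarrow> t \<le> \<delta> \<Longrightarrow> Y t \<in> borel_measurable M"
    and cont: "AE \<omega> in M. continuous_on {0..\<delta>} (\<lambda>t. Y t \<omega>)"
    and \<delta>: "0 < \<delta>" and B: "0 < B" and Q: "0 < Q" "Q < 1" and C: "0 \<le> C" and C': "0 \<le> C'" and L: "0 < L"
    and \<phi>: "\<And>t. 0 < t \<Longrightarrow> t \<le> \<delta> \<Longrightarrow> 0 < \<phi> t"
    and inc: "\<And>T k s t l. 0 < T \<Longrightarrow> T \<le> \<delta> \<Longrightarrow> 0 \<le> s \<Longrightarrow> s \<le> T \<Longrightarrow> 0 \<le> t \<Longrightarrow> t \<le> T \<Longrightarrow>
      \<bar>s - t\<bar> \<le> T / 2 ^ k \<Longrightarrow>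
      prob {\<omega> \<in> space M. l \<le> \<bar>Y s \<omega> - Y t \<omega>\<bar>} \<le> C * exp (- (l / (B * \<phi> T * Q ^ k)))"
    and osc: "\<And>T k s. 0 < T \<Longrightarrow> T \<le> \<delta> \<Longrightarrow> T - T / 2 ^ k \<le> s \<Longrightarrow> s \<le> T \<Longrightarrow> \<phi> T * (1 - A * Q ^ k) \<le> \<phi> s"
    and marg: "\<And>t l. 0 < t \<Longrightarrow> t \<le> \<delta> \<Longrightarrow> prob {\<omega> \<in> space M. l \<le> Y t \<omega>} \<le> C' * exp (- (l / (L * \<phi> t)))"
    and m: "1 \<le> m" "A * Q ^ m < 1" and \<eta>: "0 < \<eta>" "\<eta> < 1"
  shows "AE \<omega> in M. \<forall>\<^sub>F t in at_right 0. Y t \<omega> \<le>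
    ((1 + \<eta>) * L + B * Q ^ m * (\<Sum>k. 2 * real (k + 1) * Q ^ k)) / ((1 - A * Q ^ m) * (1 - \<eta>)) * (\<phi> t * ln (ln (1 / t)))"
proof -
  define S where "S = (\<Sum>k. 2 * real (k + 1) * Q ^ k)"
  have Ssum: "summable (\<lambda>k. 2 * real (k + 1) * Q ^ k)" by (rule summable_linear_geometric) (use Q in auto)
  have S0: "0 \<le> S" unfolding S_def by (rule suminf_nonneg[OF Ssum]) (use Q in auto)
  \<comment> \<open>With this ratio the block from \<open>\<theta> ^ Suc n\<close> to
    \<open>\<theta> ^ n\<close> has length \<open>\<theta> ^ n / 2 ^ m\<close>. Its level
    \<open>k\<close> is thus level \<open>m + k\<close> of [0, \<open>\<theta> ^ n\<close>], and
    every increment scale gains \<open>Q ^ m\<close>.\<close>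
  define \<theta> :: real where "\<theta> = 1 - 1 / 2 ^ m"
  have "(2::real) ^ 1 \<le> 2 ^ m" using m by (intro power_increasing) auto
  then have \<theta>: "0 < \<theta>" "\<theta> < 1" by (auto simp: \<theta>_def field_simps)
  define h where "h n = \<theta> ^ n / 2 ^ m" for n
  have hT: "\<theta> ^ Suc n + h n = \<theta> ^ n" for n by (simp add: h_def \<theta>_def algebra_simps)
  have h0: "0 < h n" for n using \<theta> by (simp add: h_def)
  define c where "c = - ln \<theta>"
  have c: "0 < c" using \<theta> by (simp add: c_def)
  have "(\<lambda>n. \<theta> ^ n) \<longlonglongrightarrow> 0" using \<theta> by (intro LIMSEQ_realpow_zero) auto
  then have "\<forall>\<^sub>F n in sequentially. \<theta> ^ n < \<delta>" using \<delta> by (intro order_tendstoD) auto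
  moreover have lnn: "filterlim (\<lambda>n. ln (real n)) at_top sequentially"
    by (intro filterlim_compose[OF ln_at_top] filterlim_real_sequentially)
  \<comment> \<open>\<open>ln n >= 1\<close> separates \<open>n\<close> from \<open>k\<close> in the
    chaining tail; the other bound absorbs the constant \<open>ln c\<close> into
    \<open>\<eta> * ln n\<close>.\<close>
  then have "\<forall>\<^sub>F n in sequentially. max 1 (- ln c / \<eta>) \<le> ln (real n)"
    unfolding filterlim_at_top by blast
  ultimately have "\<forall>\<^sub>F n in sequentially. \<theta> ^ n < \<delta> \<and> max 1 (- ln c / \<eta>) \<le> ln (real n) \<and> 1 \<le> n"
    by (intro eventually_conj eventually_ge_at_top)
  then obtain n0 where n0: "\<And>n. n0 \<le> n \<Longrightarrow> \<theta> ^ n < \<delta>" "\<And>n. n0 \<le> n \<Longrightarrow> 1 \<le> ln (real n)"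
      "\<And>n. n0 \<le> n \<Longrightarrow> - ln c / \<eta> \<le> ln (real n)" "\<And>n. n0 \<le> n \<Longrightarrow> 1 \<le> n"
    unfolding eventually_sequentially by (metis max.bounded_iff)
  define F where "F n x = Y (\<theta> ^ Suc n + h n * x)" for n x
  have pt: "0 \<le> \<theta> ^ Suc n + h n * x" "\<theta> ^ Suc n + h n * x \<le> \<theta> ^ n" if "0 \<le> x" "x \<le> 1" for n x
  proof -
    show "0 \<le> \<theta> ^ Suc n + h n * x" using \<theta> h0[of n] that by (intro add_nonneg_nonneg) auto
    have "h n * x \<le> h n * 1" using that h0[of n] by (intro mult_left_mono) auto
    then show "\<theta> ^ Suc n + h n * x \<le> \<theta> ^ n" using hT[of n] by linarith
  qed
  have Fmeas: "F n x \<in> borel_measurable M" if "n0 \<le> n" "0 \<le> x" "x \<le> 1" for n x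
    unfolding F_def using pt[OF that(2,3), of n] n0(1)[OF that(1)] by (intro meas) auto
  \<comment> \<open>The factor \<open>ln n\<close> makes the tails summable over blocks, the linear
    factor over levels; \<open>k + 1\<close> instead of \<open>k\<close> preserves
    \<open>n powr (- 2)\<close> at level 0.\<close>
  define l where "l n k = B * \<phi> (\<theta> ^ n) * Q ^ m * ln (real n) * (2 * real (k + 1) * Q ^ k)" for n k
  define E where "E n k = {\<omega> \<in> space M. \<exists>j<2 ^ k. l n k \<le> \<bar>F n (real (Suc j) / 2 ^ k) \<omega> - F n (real j / 2 ^ k) \<omega>\<bar>}" for n k
  have tail: "prob {\<omega> \<in> space M. l n k \<le> \<bar>F n (real (Suc j) / 2 ^ k) \<omega> - F n (real j / 2 ^ k) \<omega>\<bar>}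
      \<le> C * (real n powr (- 2) * exp (- (2 * real k)))"
    if "n0 \<le> n" "j < 2 ^ k" for n k j
  proof -
    have "real (Suc j) \<le> real (2 ^ k)" using that by (subst of_nat_le_iff) auto
    then have 1: "real (Suc j) / 2 ^ k \<le> 1" by simp
    define p where "p = real (Suc j) / 2 ^ k"
    define q where "q = real j / 2 ^ k"
    have pq: "p - q = 1 / 2 ^ k" by (simp add: p_def q_def field_simps)
    have "0 < 1 / (2::real) ^ k" by simp
    moreover have "0 \<le> p" "0 \<le> q" "p \<le> 1" using 1 by (simp_all add: p_def q_def)
    ultimately have 2: "0 \<le> p" "p \<le> 1" "0 \<le> q" "q \<le> 1" using pq by linarith+
    have "(\<theta> ^ Suc n + h n * p) - (\<theta> ^ Suc n + h n * q) = h n * (p - q)" by (simp add: algebra_simps)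
    also have "\<dots> = \<theta> ^ n / 2 ^ (m + k)" by (simp add: h_def power_add pq)
    finally have d: "\<bar>(\<theta> ^ Suc n + h n * p) - (\<theta> ^ Suc n + h n * q)\<bar> \<le> \<theta> ^ n / 2 ^ (m + k)"
      using \<theta> by simp
    have "prob {\<omega> \<in> space M. l n k \<le> \<bar>F n (real (Suc j) / 2 ^ k) \<omega> - F n (real j / 2 ^ k) \<omega>\<bar>}
        \<le> C * exp (- (l n k / (B * \<phi> (\<theta> ^ n) * Q ^ (m + k))))"
      unfolding F_def p_def[symmetric] q_def[symmetric]
      using pt[OF 2(1,2), of n] pt[OF 2(3,4), of n] d \<theta> n0(1)[OF that(1)]
      by (intro inc) auto
    also have "l n k / (B * \<phi> (\<theta> ^ n) * Q ^ (m + k)) = ln (real n) * (2 * real (k + 1))"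
      using B Q \<phi>[of "\<theta> ^ n"] \<theta> n0(1)[OF that(1)] by (simp add: l_def power_add)
    also have "exp (- (ln (real n) * (2 * real (k + 1)))) \<le> exp (- 2 * ln (real n)) * exp (- (2 * real k))"
    proof -
      have "1 * real k \<le> ln (real n) * real k" using n0(2)[OF that(1)] by (intro mult_right_mono) auto
      then have "- (ln (real n) * (2 * real (k + 1))) \<le> - 2 * ln (real n) + - (2 * real k)"
        by (simp add: algebra_simps)
      then show ?thesis unfolding exp_add[symmetric] by simp
    qed
    also have "exp (- 2 * ln (real n)) = real n powr (- 2)" using n0(4)[OF that(1)] by (simp add: powr_def)
    finally show ?thesis using C by (simp add: mult_left_mono)
  qed
  have E: "E n k \<in> events" "prob (E n k) \<le> C * real n powr (- 2) * (1 / 2) ^ k" if "n0 \<le> n" for n k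
  proof -
    show "E n k \<in> events" unfolding E_def by (rule prob_dyadic_grid_le(1)[OF Fmeas[OF that] tail[OF that]])
    have "prob (E n k) \<le> 2 ^ k * (C * (real n powr (- 2) * exp (- (2 * real k))))"
      unfolding E_def by (rule prob_dyadic_grid_le(2)[OF Fmeas[OF that] tail[OF that]])
    also have "\<dots> = C * real n powr (- 2) * (2 ^ k * exp (- (2 * real k)))" by simp
    also have "\<dots> \<le> C * real n powr (- 2) * (1 / 2) ^ k" using C by (intro mult_left_mono two_pow_mult_exp_le) auto
    finally show "prob (E n k) \<le> C * real n powr (- 2) * (1 / 2) ^ k" .
  qed
  define U where "U n = (\<Union>k. E n k)" for n
  have U: "U n \<in> events" "prob (U n) \<le> 2 * C * real n powr (- 2)" if "n0 \<le> n" for n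
  proof -
    show "U n \<in> events" unfolding U_def using E[OF that] by auto
    have geo: "(\<lambda>k. C * real n powr (- 2) * (1 / 2) ^ k) sums (C * real n powr (- 2) * (1 / (1 - 1 / 2)))"
      by (intro sums_mult geometric_sums) simp
    have s: "summable (\<lambda>k. prob (E n k))"
      by (rule summable_comparison_test_ev[OF _ sums_summable[OF geo]]) (auto intro!: always_eventually E that)
    have "prob (U n) \<le> (\<Sum>k. prob (E n k))"
      unfolding U_def using E[OF that] s by (intro finite_measure_subadditive_countably) auto
    also have "\<dots> \<le> (\<Sum>k. C * real n powr (- 2) * (1 / 2) ^ k)"
      by (intro suminf_le s sums_summable[OF geo] E that)
    also have "\<dots> = 2 * C * real n powr (- 2)" using sums_unique[OF geo] by simp
    finally show "prob (U n) \<le> 2 * C * real n powr (- 2)" .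
  qed
  \<comment> \<open>The factor \<open>1 + \<eta>\<close> turns the marginal tail into the summable
    \<open>n powr (- (1 + \<eta>))\<close>.\<close>
  define V where "V n = {\<omega> \<in> space M. (1 + \<eta>) * L * \<phi> (\<theta> ^ n) * ln (real n) \<le> Y (\<theta> ^ n) \<omega>}" for n
  have V: "V n \<in> events" "prob (V n) \<le> C' * real n powr (- (1 + \<eta>))" if "n0 \<le> n" for n
  proof -
    have [measurable]: "Y (\<theta> ^ n) \<in> borel_measurable M" using n0(1)[OF that] \<theta> by (intro meas) auto
    show "V n \<in> events" unfolding V_def by measurable
    have "prob (V n) \<le> C' * exp (- ((1 + \<eta>) * L * \<phi> (\<theta> ^ n) * ln (real n) / (L * \<phi> (\<theta> ^ n))))"
      unfolding V_def using n0(1)[OF that] \<theta> by (intro marg) auto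
    also have "(1 + \<eta>) * L * \<phi> (\<theta> ^ n) * ln (real n) / (L * \<phi> (\<theta> ^ n)) = (1 + \<eta>) * ln (real n)"
      using L \<phi>[of "\<theta> ^ n"] n0(1)[OF that] \<theta> by simp
    also have "exp (- ((1 + \<eta>) * ln (real n))) = real n powr (- (1 + \<eta>))"
      using n0(4)[OF that] unfolding powr_def by (simp add: algebra_simps)
    finally show "prob (V n) \<le> C' * real n powr (- (1 + \<eta>))" .
  qed
  \<comment> \<open>The estimates hold from \<open>n0\<close> on, hence the shifted index.\<close>
  have "AE \<omega> in M. \<forall>\<^sub>F n in sequentially. \<omega> \<in> space M - (U (n + n0) \<union> V (n + n0))"
  proof (rule borel_cantelli_AE1)
    show "U (n + n0) \<union> V (n + n0) \<in> events" for n using U V by auto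
    show "emeasure M (U (n + n0) \<union> V (n + n0)) < \<infinity>" for n by (simp add: emeasure_eq_measure)
    have s: "summable (\<lambda>n. 2 * C * real (n + n0) powr (- 2) + C' * real (n + n0) powr (- (1 + \<eta>)))"
    proof -
      have "summable (\<lambda>n. 2 * C * real n powr (- 2) + C' * real n powr (- (1 + \<eta>)))"
        using \<eta> by (intro summable_add summable_mult) (auto simp: summable_real_powr_iff)
      then show ?thesis by (subst (asm) summable_iff_shift[symmetric, of _ n0])
    qed
    show "summable (\<lambda>n. prob (U (n + n0) \<union> V (n + n0)))"
    proof (rule summable_comparison_test_ev[OF _ s], rule always_eventually, rule allI)
      fix n
      have "prob (U (n + n0) \<union> V (n + n0)) \<le> prob (U (n + n0)) + prob (V (n + n0))"
        by (rule measure_Un_le) (auto intro: U V)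
      also have "\<dots> \<le> 2 * C * real (n + n0) powr (- 2) + C' * real (n + n0) powr (- (1 + \<eta>))"
        by (intro add_mono U V) auto
      finally show "norm (prob (U (n + n0) \<union> V (n + n0)))
        \<le> 2 * C * real (n + n0) powr (- 2) + C' * real (n + n0) powr (- (1 + \<eta>))" by simp
    qed
  qed
  with cont show ?thesis
  proof eventually_elim
    case (elim \<omega>)
    then obtain n1 where n1: "\<And>n. n1 \<le> n \<Longrightarrow> \<omega> \<in> space M - (U (n + n0) \<union> V (n + n0))"
      unfolding eventually_sequentially by blast
    have main: "Y s \<omega> \<le> ((1 + \<eta>) * L + B * Q ^ m * S) / ((1 - A * Q ^ m) * (1 - \<eta>)) * (\<phi> s * ln (ln (1 / s)))"
      if s: "0 < s" "s \<le> \<theta> ^ (n1 + n0)" for s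
    proof -
      obtain n where n: "n1 + n0 \<le> n" "\<theta> ^ Suc n \<le> s" "s \<le> \<theta> ^ n"
        using geometric_bracket[OF \<theta> s] by blast
      have nn0: "n0 \<le> n" using n(1) by simp
      have notin: "\<omega> \<in> space M" "\<omega> \<notin> U n" "\<omega> \<notin> V n" using n1[of "n - n0"] n(1) by auto
      have T: "0 < \<theta> ^ n" "\<theta> ^ n \<le> \<delta>" using \<theta> n0(1)[OF nn0] by auto
      define x where "x = (s - \<theta> ^ Suc n) / h n"
      have x: "0 \<le> x" "x \<le> 1" "\<theta> ^ Suc n + h n * x = s"
        using n h0[of n] hT[of n] by (auto simp: x_def)
      have ln0: "1 \<le> ln (real n)" by (rule n0(2)[OF nn0])
      have "\<bar>F n x \<omega> - F n 1 \<omega>\<bar> \<le> suminf (l n)"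
      proof (rule dyadic_chain_bound)
        have "continuous_on {0..1} ((\<lambda>t. Y t \<omega>) \<circ> (\<lambda>x. \<theta> ^ Suc n + h n * x))"
        proof (rule continuous_on_compose)
          show "continuous_on ((\<lambda>x. \<theta> ^ Suc n + h n * x) ` {0..1}) (\<lambda>t. Y t \<omega>)"
          proof (rule continuous_on_subset[OF elim(1)], rule image_subsetI)
            fix z :: real assume "z \<in> {0..1}"
            then show "\<theta> ^ Suc n + h n * z \<in> {0..\<delta>}" using pt[of z n] T(2) by (simp del: power_Suc)
          qed
        qed (intro continuous_intros)
        then show "continuous_on {0..1} (\<lambda>x. F n x \<omega>)" by (simp add: F_def comp_def)
        show "\<bar>F n (real (Suc j) / 2 ^ k) \<omega> - F n (real j / 2 ^ k) \<omega>\<bar> \<le> l n k" if "j < 2 ^ k" for k j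
          using notin that by (force simp: U_def E_def)
        show "summable (l n)" unfolding l_def by (intro summable_mult Ssum)
        show "0 \<le> l n k" for k using B \<phi>[OF T] Q ln0 by (simp add: l_def)
      qed (use x in auto)
      moreover have "suminf (l n) = B * \<phi> (\<theta> ^ n) * Q ^ m * ln (real n) * S"
        unfolding l_def S_def by (rule suminf_mult[OF Ssum])
      moreover have "F n x \<omega> = Y s \<omega>" "F n 1 \<omega> = Y (\<theta> ^ n) \<omega>" using x(3) hT[of n] by (auto simp: F_def)
      moreover have "Y (\<theta> ^ n) \<omega> \<le> (1 + \<eta>) * L * \<phi> (\<theta> ^ n) * ln (real n)" using notin by (simp add: V_def)
      ultimately have Ys: "Y s \<omega> \<le> ((1 + \<eta>) * L + B * Q ^ m * S) * (\<phi> (\<theta> ^ n) * ln (real n))"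
        by (simp add: algebra_simps abs_le_iff)
      have "\<theta> ^ n - \<theta> ^ n / 2 ^ m = \<theta> ^ Suc n" by (simp add: \<theta>_def algebra_simps)
      then have "\<phi> (\<theta> ^ n) * (1 - A * Q ^ m) \<le> \<phi> s" using n T by (intro osc) auto
      then have 1: "\<phi> (\<theta> ^ n) \<le> \<phi> s / (1 - A * Q ^ m)" using m by (simp add: pos_le_divide_eq)
      \<comment> \<open>From \<open>s <= \<theta> ^ n\<close>, \<open>ln (ln (1 / s))\<close> is at
        least \<open>ln n + ln c\<close>.\<close>
      have "real n * c \<le> ln (1 / s)"
      proof -
        have "ln s \<le> ln (\<theta> ^ n)" using n(3) s T by simp
        then show ?thesis using \<theta> s by (simp add: c_def ln_realpow ln_div)
      qed
      moreover have "0 < real n * c" using n0(4)[OF nn0] c by simp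
      ultimately have "ln (real n * c) \<le> ln (ln (1 / s))" by (subst ln_le_cancel_iff) linarith+
      moreover have "ln (real n * c) = ln (real n) + ln c" using n0(4)[OF nn0] c by (simp add: ln_mult)
      moreover have "- ln c \<le> ln (real n) * \<eta>" using n0(3)[OF nn0] unfolding pos_divide_le_eq[OF \<eta>(1)] .
      ultimately have "ln (real n) * (1 - \<eta>) \<le> ln (ln (1 / s))" by (simp add: algebra_simps)
      then have 2: "ln (real n) \<le> ln (ln (1 / s)) / (1 - \<eta>)" using \<eta> by (simp add: pos_le_divide_eq)
      have "0 \<le> \<phi> s" using \<phi>[of s] s(1) n(3) T by simp
      then have "\<phi> (\<theta> ^ n) * ln (real n) \<le> (\<phi> s / (1 - A * Q ^ m)) * (ln (ln (1 / s)) / (1 - \<eta>))"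
        using 1 2 \<phi>[OF T] ln0 m by (intro mult_mono) auto
      then have le: "((1 + \<eta>) * L + B * Q ^ m * S) * (\<phi> (\<theta> ^ n) * ln (real n))
          \<le> ((1 + \<eta>) * L + B * Q ^ m * S) * ((\<phi> s / (1 - A * Q ^ m)) * (ln (ln (1 / s)) / (1 - \<eta>)))"
        using \<eta> L B Q S0 by (intro mult_left_mono) auto
      have "a * ((b / p) * (d / q)) = a / (p * q) * (b * d)" for a b d p q :: real by simp
      from order.trans[OF order.trans[OF Ys le] eq_refl[OF this]] show ?thesis .
    qed
    have "0 < \<theta> ^ (n1 + n0)" using \<theta> by simp
    then have "\<forall>\<^sub>F s in at_right 0. s \<in> {0<..<\<theta> ^ (n1 + n0)}" by (rule eventually_at_right_real)
    then show ?case
      unfolding S_def[symmetric] by eventually_elim (rule main; simp)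
  qed
qed

section \<open>Asymptotics of the kernel\<close>

text \<open>A bound of the form \<open>f (T / 2) \<le> q * f T\<close> and subadditivity replace Potter's bounds.\<close>

lemma subadditive_halving_bound:
  fixes f :: "real \<Rightarrow> real"
  assumes cont: "isCont f 0" "f 0 = 0" and sub: "\<And>x y. f (x + y) \<le> f x + f y"
    and q: "0 < q" "q < 1" and nonneg: "\<And>x. 0 \<le> f x"
    and half: "\<And>t. 0 < t \<Longrightarrow> t \<le> t0 \<Longrightarrow> f (t / 2) \<le> q * f t"
    and T: "0 < T" "T \<le> t0" and r: "0 \<le> r" "r \<le> T / 2 ^ k"
  shows "f r \<le> 1 / (1 - q) * q ^ k * f T"
proof -
  \<comment> \<open>\<open>A\<close> solves \<open>A = 1 + A * q\<close>: it sums the geometric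
    costs of successive halvings.\<close>
  define A where "A = 1 / (1 - q)"
  have A: "0 \<le> A" "(1 - q) * A = 1" using q by (auto simp: A_def)
  have qA: "q + A * q \<le> A"
  proof -
    have "0 \<le> (1 - q)\<^sup>2 * A" using A by simp
    also have "(1 - q)\<^sup>2 * A = (1 - q) * ((1 - q) * A)" by (simp add: power2_eq_square)
    finally have "0 \<le> 1 - q" by (simp only: A(2)) simp
    moreover have "A = 1 + A * q" using A(2) by (simp add: algebra_simps)
    ultimately show ?thesis by linarith
  qed
  \<comment> \<open>In place of monotonicity, \<open>r\<close> is reached through its binary digits
    relative to \<open>S\<close>: a nonzero digit costs the value of \<open>f\<close> at a halved
    \<open>S\<close>, and the remainder \<open>r'\<close> is left to continuity at 0.\<close>
  have chain: "\<exists>r'. 0 \<le> r' \<and> r' \<le> S / 2 ^ n \<and> f r \<le> A * f S + f r'"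
    if "0 < S" "S \<le> t0" "0 \<le> r" "r \<le> S" for n S r
    using that
  proof (induction n arbitrary: S r)
    case 0
    then show ?case using A nonneg[of S] by (intro exI[of _ r]) auto
  next
    case (Suc n)
    have hS: "f (S / 2) \<le> q * f S" using Suc.prems by (intro half) auto
    obtain r1 where r1: "0 \<le> r1" "r1 \<le> S / 2" "f r \<le> q * f S + f r1"
    proof (cases "r \<le> S / 2")
      case True
      then show ?thesis using that[of r] Suc.prems q nonneg[of S] by simp
    next
      case False
      have "f r \<le> f (S / 2) + f (r - S / 2)" using sub[of "S / 2" "r - S / 2"] by simp
      then show ?thesis using that[of "r - S / 2"] False Suc.prems hS by simp
    qed
    obtain r' where r': "0 \<le> r'" "r' \<le> S / 2 / 2 ^ n" "f r1 \<le> A * f (S / 2) + f r'"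
      using Suc.IH[of "S / 2" r1] Suc.prems r1 by auto
    have "A * f (S / 2) \<le> A * (q * f S)" using hS A by (intro mult_left_mono)
    then have "f r \<le> (q + A * q) * f S + f r'" using r1 r' by (simp add: algebra_simps)
    also have "(q + A * q) * f S \<le> A * f S" using qA nonneg by (intro mult_right_mono)
    finally show ?case using r' by (intro exI[of _ r']) simp
  qed
  have bound: "f r \<le> A * f S" if S: "0 < S" "S \<le> t0" "0 \<le> r" "r \<le> S" for S r
  proof (rule field_le_epsilon)
    fix e :: real assume e: "0 < e"
    then obtain d where d: "0 < d" "\<And>x. \<bar>x\<bar> < d \<Longrightarrow> \<bar>f x\<bar> < e"
      using cont unfolding continuous_at_eps_delta dist_real_def by force
    have "(\<lambda>n. S * (1 / 2) ^ n) \<longlonglongrightarrow> S * 0" by (intro tendsto_intros LIMSEQ_realpow_zero) auto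
    then have "\<forall>\<^sub>F n in sequentially. S * (1 / 2) ^ n < d" using d by (intro order_tendstoD) auto
    then obtain n where "S * (1 / 2) ^ n < d"
      using eventually_happens'[OF sequentially_bot] by blast
    then have n: "S / 2 ^ n < d" by (simp add: power_one_over)
    obtain r' where "0 \<le> r'" "r' \<le> S / 2 ^ n" "f r \<le> A * f S + f r'" using chain[OF S] by blast
    moreover from this have "\<bar>f r'\<bar> < e" using n by (intro d) auto
    ultimately show "f r \<le> A * f S + e" by linarith
  qed
  have pow: "f (T / 2 ^ k) \<le> q ^ k * f T"
  proof (induction k)
    case (Suc k)
    have "T / 2 ^ k \<le> T / 1" using T by (intro divide_left_mono) auto
    then have "f (T / 2 ^ k / 2) \<le> q * f (T / 2 ^ k)" using T by (intro half) auto
    also have "\<dots> \<le> q * (q ^ k * f T)" using Suc q by (intro mult_left_mono) auto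
    finally show ?case by (simp add: mult.commute[of 2])
  qed simp
  have "T / 2 ^ k \<le> T / 1" using T by (intro divide_left_mono) auto
  then have "f r \<le> A * f (T / 2 ^ k)" using T r by (intro bound) auto
  also have "\<dots> \<le> A * (q ^ k * f T)" using pow A by (intro mult_left_mono) auto
  finally show ?thesis by (simp add: A_def)
qed

lemma Limsup_le_ereal:
  assumes "\<And>e. L < e \<Longrightarrow> \<forall>\<^sub>F x in F. f x \<le> e"
  shows "Limsup F (\<lambda>x. ereal (f x)) \<le> ereal L"
proof (rule ereal_le_epsilon2)
  fix e :: real assume "0 < e"
  then have "\<forall>\<^sub>F x in F. f x \<le> L + e" by (intro assms) simp
  then show "Limsup F (\<lambda>x. ereal (f x)) \<le> ereal L + ereal e"
    by (intro Limsup_bounded) (auto elim: eventually_mono)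
qed

section \<open>Increment bounds for the kernel\<close>

context symmetric_exponent
begin

abbreviation "u \<equiv> u_pot \<psi> \<beta>"
abbreviation "s2 \<equiv> sigma_sq \<psi> \<beta>"

lemma s2_0: "s2 0 = 0" by (simp add: sigma_sq_def)

lemma s2_minus: "s2 (- x) = s2 x" by (simp add: sigma_sq_def u_pot_minus)

lemma s2_nonneg: "0 \<le> s2 x" using u_pot_increment_le[of 0 x] by linarith

lemma u_diff_le: "\<bar>u x - u y\<bar> \<le> s2 (x - y) / 2"
  using u_pot_increment_le[of y "x - y"] by simp

lemma s2_subadditive: "s2 (x + y) \<le> s2 x + s2 y"
  using abs_le_D2[OF u_pot_increment_le[of x y]] by (simp add: sigma_sq_def)

lemma isCont_s2: "isCont s2 x"
  unfolding sigma_sq_def[abs_def] by (intro continuous_intros isCont_u_pot)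

lemma borel_measurable_u [measurable]: "u \<in> borel_measurable borel"
  using isCont_u_pot by (intro borel_measurable_continuous_onI continuous_at_imp_continuous_on) auto

lemma u0_pos:
  assumes "0 < s2 t"
  shows "0 < u 0"
  using assms abs_u_pot_le[of t] by (simp add: sigma_sq_def abs_le_iff)

text \<open>Each of the two terms contributes half of the bound, the second because
  \<open>u x / u 0\<close> has modulus at most 1. Uniformity in \<open>x\<close> allows integration
  against \<mu>.\<close>

lemma v_pot_diff_le:
  assumes "0 < u 0"
  shows "\<bar>v_pot \<psi> \<beta> x y - v_pot \<psi> \<beta> x y'\<bar> \<le> s2 (y - y')"
proof -
  have "v_pot \<psi> \<beta> x y - v_pot \<psi> \<beta> x y' = (u (x - y) - u (x - y')) - u x / u 0 * (u y - u y')"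
    by (simp add: v_pot_def algebra_simps diff_divide_distrib)
  also have "\<bar>\<dots>\<bar> \<le> \<bar>u (x - y) - u (x - y')\<bar> + \<bar>u x / u 0 * (u y - u y')\<bar>" by (rule abs_triangle_ineq4)
  also have "\<bar>u x / u 0 * (u y - u y')\<bar> \<le> 1 * (s2 (y - y') / 2)"
    unfolding abs_mult using u_diff_le[of y y'] abs_u_pot_le[of x] assms
    by (intro mult_mono) (auto simp: field_simps)
  also have "\<bar>u (x - y) - u (x - y')\<bar> \<le> s2 (y - y') / 2"
    using u_diff_le[of "x - y" "x - y'"] s2_minus[of "y - y'"] by simp
  finally show ?thesis by simp
qed

lemma v_pot_commute: "v_pot \<psi> \<beta> x y = v_pot \<psi> \<beta> y x"
  using u_pot_minus[of "x - y"] by (simp add: v_pot_def mult.commute)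

lemma v_pot_0: "0 < u 0 \<Longrightarrow> v_pot \<psi> \<beta> x 0 = 0"
  by (simp add: v_pot_def)

end

locale symmetric_exponent_measure = symmetric_exponent + \<mu>: finite_measure \<mu> for \<mu> :: "real measure" +
  assumes \<mu>_sets [measurable_cong]: "sets \<mu> = sets borel" and u0: "0 < u_pot \<psi> \<beta> 0"
begin

abbreviation "mass \<equiv> measure \<mu> (space \<mu>)"

abbreviation "K \<equiv> v_kernel \<psi> \<beta> \<mu>"

lemma integrable_u_shift: "integrable \<mu> (\<lambda>x. u (x - y))"
  using abs_u_pot_le by (intro \<mu>.integrable_const_bound[where B = "u 0"]) auto

lemma f_v_eq: "f_v \<psi> \<beta> \<mu> y = f_u \<psi> \<beta> \<mu> y - u y / u 0 * f_u \<psi> \<beta> \<mu> 0"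
proof -
  have "f_v \<psi> \<beta> \<mu> y = (LINT x|\<mu>. u (x - y) - u y / u 0 * u (x - 0))"
    by (simp add: f_v_def v_pot_def mult.commute)
  also have "\<dots> = f_u \<psi> \<beta> \<mu> y - u y / u 0 * f_u \<psi> \<beta> \<mu> 0"
    unfolding f_u_def using integrable_u_shift[of y] integrable_u_shift[of 0] by simp
  finally show ?thesis .
qed

lemma f_v_diff_le: "\<bar>f_v \<psi> \<beta> \<mu> y - f_v \<psi> \<beta> \<mu> y'\<bar> \<le> mass * s2 (y - y')"
proof -
  have i: "integrable \<mu> (\<lambda>x. v_pot \<psi> \<beta> x y)" for y
    unfolding v_pot_def using integrable_u_shift[of y] integrable_u_shift[of 0] by simp
  have "\<bar>f_v \<psi> \<beta> \<mu> y - f_v \<psi> \<beta> \<mu> y'\<bar> = \<bar>LINT x|\<mu>. v_pot \<psi> \<beta> x y - v_pot \<psi> \<beta> x y'\<bar>"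
    unfolding f_v_def by (simp add: i)
  also have "\<dots> \<le> (LINT x|\<mu>. \<bar>v_pot \<psi> \<beta> x y - v_pot \<psi> \<beta> x y'\<bar>)" by (rule integral_abs_bound)
  also have "\<dots> \<le> (LINT x|\<mu>. s2 (y - y'))"
    by (intro integral_mono integrable_abs Bochner_Integration.integrable_diff i v_pot_diff_le u0) auto
  finally show ?thesis by (simp add: mult.commute)
qed

lemma f_v_0: "f_v \<psi> \<beta> \<mu> 0 = 0"
  using u0 by (simp add: f_v_eq)

text \<open>\<open>K x 0 = 0\<close>, reflecting the killing at 0, so the size of
  \<open>K x y\<close> is an increment in the second argument.\<close>

lemma abs_kernel_le: "\<bar>K x y\<bar> \<le> (1 + mass) * s2 y"
proof -
  have "\<bar>v_pot \<psi> \<beta> x y\<bar> \<le> s2 y" using v_pot_diff_le[OF u0, of x y 0] v_pot_0[OF u0] by simp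
  moreover have "\<bar>f_v \<psi> \<beta> \<mu> y\<bar> \<le> mass * s2 y" using f_v_diff_le[of y 0] by (simp add: f_v_0)
  ultimately show ?thesis by (simp add: v_kernel_def algebra_simps abs_le_iff)
qed

lemma kernel_diff_le: "\<bar>K x y - K x' y\<bar> \<le> s2 (x - x')"
  using v_pot_diff_le[OF u0, of y x x'] by (simp add: v_kernel_def v_pot_commute[of _ y])

lemma kernel_diag_diff_le: "\<bar>K s s - K t t\<bar> \<le> (2 + mass) * s2 (s - t)"
proof -
  have "\<bar>v_pot \<psi> \<beta> s s - v_pot \<psi> \<beta> s t\<bar> \<le> s2 (s - t)" by (rule v_pot_diff_le[OF u0])
  moreover have "\<bar>v_pot \<psi> \<beta> s t - v_pot \<psi> \<beta> t t\<bar> \<le> s2 (s - t)"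
    using v_pot_diff_le[OF u0, of t s t] by (simp add: v_pot_commute[of s t])
  ultimately show ?thesis
    using f_v_diff_le[of s t] unfolding v_kernel_def abs_le_iff by (simp add: algebra_simps)
qed

text \<open>Subtracting row \<open>t\<close> from row \<open>s\<close> leaves differences in the
  first argument, where \<open>f_v\<close> cancels. Every product then has one factor
  \<open>s2 (s - t)\<close> and one of order \<open>s2 s\<close> or \<open>s2 t\<close>.\<close>

lemma kernel_det_le: "K s s * K t t - K s t * K t s \<le> (1 + mass) * s2 (s - t) * (s2 s + s2 t)"
proof -
  have "K s s * K t t - K s t * K t s = (K s s - K t s) * K t t + K t s * (K t t - K s t)"
    by (simp add: algebra_simps)
  also have "\<dots> \<le> \<bar>K s s - K t s\<bar> * \<bar>K t t\<bar> + \<bar>K t s\<bar> * \<bar>K t t - K s t\<bar>"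
    by (intro add_mono) (metis abs_ge_self abs_mult)+
  also have "\<dots> \<le> s2 (s - t) * ((1 + mass) * s2 t) + ((1 + mass) * s2 s) * s2 (s - t)"
    using kernel_diff_le[of s s t] kernel_diff_le[of t t s] abs_kernel_le[of t t] abs_kernel_le[of t s]
      s2_nonneg s2_minus[of "s - t"]
    by (intro add_mono mult_mono) auto
  finally show ?thesis by (simp add: algebra_simps)
qed

text \<open>Substitution of \<open>u t = u 0 - s2 t / 2\<close> isolates the integral as the one
  term that is not an explicit multiple of \<open>s2 t\<close>.\<close>

lemma kernel_diag_eq:
  "K t t = s2 t * (1 - s2 t / (4 * u 0) + f_u \<psi> \<beta> \<mu> 0 / (2 * u 0)) + (LINT x|\<mu>. u (x - t) - u x)"
proof -
  have "(LINT x|\<mu>. u (x - t) - u x) = f_u \<psi> \<beta> \<mu> t - f_u \<psi> \<beta> \<mu> 0"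
    unfolding f_u_def using integrable_u_shift[of t] integrable_u_shift[of 0] by simp
  moreover have "v_pot \<psi> \<beta> t t = s2 t * (1 - s2 t / (4 * u 0))"
    using u0 by (simp add: v_pot_def sigma_sq_def field_simps power2_eq_square)
  moreover have "f_v \<psi> \<beta> \<mu> t = f_u \<psi> \<beta> \<mu> t - f_u \<psi> \<beta> \<mu> 0 + s2 t * (f_u \<psi> \<beta> \<mu> 0 / (2 * u 0))"
    unfolding f_v_eq using u0 by (simp add: sigma_sq_def field_simps)
  ultimately show ?thesis by (simp add: v_kernel_def algebra_simps)
qed

text \<open>The quotient \<open>(u (x - t) - u x) / s2 t\<close> is \<open>- 1 / 2\<close> times a
  difference quotient of \<open>s2\<close>, with step \<open>- t\<close> at \<open>x\<close>, times
  \<open>t / s2 t\<close>, which explains the coefficient \<open>c / 2\<close>. This needs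
  \<open>x\<close> nonzero, and 0 is a null point of \<mu>.\<close>

lemma kernel_diag_asymptotics:
  assumes C1: "s2 C1_differentiable_on (UNIV - {0})" and \<mu>0: "emeasure \<mu> {0} = 0"
    and pos: "\<forall>\<^sub>F t in at_right 0. 0 < s2 t"
    and c: "((\<lambda>t. t / s2 t) \<longlongrightarrow> c) (at_right 0)"
  shows "((\<lambda>t. K t t / s2 t) \<longlongrightarrow> 1 + f_u \<psi> \<beta> \<mu> 0 / (2 * u 0) + c / 2 * (LINT x|\<mu>. deriv s2 x)) (at_right 0)"
proof -
  obtain D where D: "\<And>x. x \<noteq> 0 \<Longrightarrow> (s2 has_vector_derivative D x) (at x)" "continuous_on (UNIV - {0}) D"
    using C1 unfolding C1_differentiable_on_def by blast
  have deriv: "(s2 has_real_derivative D x) (at x)" if "x \<noteq> 0" for x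
    using D(1)[OF that] by (simp add: has_real_derivative_iff_has_vector_derivative)
  have dD: "deriv s2 x = D x" if "x \<noteq> 0" for x using deriv[OF that] by (rule DERIV_imp_deriv)
  have meas: "deriv s2 \<in> borel_measurable borel"
  proof -
    have "continuous_on (UNIV - {0}) (deriv s2)" using D(2) by (subst continuous_on_cong[OF refl dD]) auto
    then have "(\<lambda>x. if x \<in> UNIV - {0} then deriv s2 x else deriv s2 0) \<in> borel_measurable borel"
      by (intro borel_measurable_continuous_on_if) auto
    moreover have "(\<lambda>x. if x \<in> UNIV - {0} then deriv s2 x else deriv s2 0) = deriv s2" by auto
    ultimately show ?thesis by simp
  qed
  have AE0: "AE x in \<mu>. x \<noteq> 0"
    using \<mu>0 by (intro AE_I[of _ _ "{0}"]) (auto simp: \<mu>_sets)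
  have lim: "((\<lambda>t. (u (x - t) - u x) / s2 t) \<longlongrightarrow> c / 2 * deriv s2 x) (at_right 0)" if x: "x \<noteq> 0" for x
  proof -
    have "((\<lambda>t. s2 (x - t)) has_real_derivative D (x - 0) * (0 - 1)) (at 0)"
      by (rule DERIV_chain2[where f = s2 and g = "\<lambda>t. x - t"]) (use deriv[OF x] in \<open>auto intro!: derivative_eq_intros\<close>)
    then have "((\<lambda>t. (s2 (x - t) - s2 x) / t) \<longlongrightarrow> - D x) (at 0)"
      by (simp add: has_field_derivative_iff)
    then have "((\<lambda>t. (s2 (x - t) - s2 x) / t) \<longlongrightarrow> - D x) (at_right 0)"
      by (rule filterlim_mono) (auto simp: at_le)
    then have "((\<lambda>t. - (1 / 2) * ((s2 (x - t) - s2 x) / t) * (t / s2 t)) \<longlongrightarrow> - (1 / 2) * (- D x) * c) (at_right 0)"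
      by (intro tendsto_intros c)
    then show ?thesis
    proof (rule filterlim_cong[THEN iffD1, rotated -1])
      have "\<forall>\<^sub>F t in at_right (0::real). 0 < t" by (simp add: eventually_at_right_less)
      then show "\<forall>\<^sub>F t in at_right 0. - (1 / 2) * ((s2 (x - t) - s2 x) / t) * (t / s2 t) = (u (x - t) - u x) / s2 t"
      proof eventually_elim
        case (elim t)
        have eq: "s2 (x - t) - s2 x = - 2 * (u (x - t) - u x)" by (simp add: sigma_sq_def)
        have "- (1 / 2) * (- 2 * a / t) * (t / b) = a / b" for a b :: real using elim by simp
        then show ?case unfolding eq .
      qed
      show "nhds (- (1 / 2) * (- D x) * c) = nhds (c / 2 * deriv s2 x)" using dD[OF x] by (simp add: mult.commute)
    qed simp
  qed
  \<comment> \<open>The substitution of \<open>inverse t\<close> turns the limit at 0 from the right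
    into one at infinity, the setting of the dominated convergence theorem applied here.\<close>
  have "((\<lambda>t. LINT x|\<mu>. (u (x - inverse t) - u x) / s2 (inverse t)) \<longlongrightarrow> (LINT x|\<mu>. c / 2 * deriv s2 x)) at_top"
  proof (rule integral_dominated_convergence_at_top[where w = "\<lambda>_. 1 / 2"])
    show "(\<lambda>x. c / 2 * deriv s2 x) \<in> borel_measurable \<mu>" using meas by measurable
    show "(\<lambda>x. (u (x - inverse t) - u x) / s2 (inverse t)) \<in> borel_measurable \<mu>" for t by measurable
    show "AE x in \<mu>. ((\<lambda>t. (u (x - inverse t) - u x) / s2 (inverse t)) \<longlongrightarrow> c / 2 * deriv s2 x) at_top"
      using AE0 by eventually_elim (use lim in \<open>simp add: filterlim_at_right_to_top\<close>)
    show "\<forall>\<^sub>F t in at_top. AE x in \<mu>. norm ((u (x - inverse t) - u x) / s2 (inverse t)) \<le> 1 / 2"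
      using pos unfolding eventually_at_right_to_top
    proof eventually_elim
      case (elim t)
      have "\<bar>u (x - inverse t) - u x\<bar> \<le> s2 (inverse t) / 2" for x
        using u_diff_le[of "x - inverse t" x] s2_minus[of "inverse t"] by simp
      then show ?case using elim by (intro AE_I2) (simp add: field_simps)
    qed
  qed simp
  \<comment> \<open>The factor \<open>c / 2\<close> leaves the integral whether or not
    \<open>deriv s2\<close> is integrable; for \<open>c = 0\<close> the term is 0 whatever value
    \<open>LINT\<close> has.\<close>
  then have I: "((\<lambda>t. (LINT x|\<mu>. u (x - t) - u x) / s2 t) \<longlongrightarrow> c / 2 * (LINT x|\<mu>. deriv s2 x)) (at_right 0)"
    by (simp add: filterlim_at_right_to_top)
  have "((\<lambda>t. 1 - s2 t / (4 * u 0) + f_u \<psi> \<beta> \<mu> 0 / (2 * u 0)) \<longlongrightarrow> 1 - s2 0 / (4 * u 0) + f_u \<psi> \<beta> \<mu> 0 / (2 * u 0)) (at_right 0)"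
    using isCont_s2[of 0] u0 by (intro tendsto_intros) (auto simp: continuous_within intro: tendsto_mono[OF at_le])
  from tendsto_add[OF this I] have "((\<lambda>t. (1 - s2 t / (4 * u 0) + f_u \<psi> \<beta> \<mu> 0 / (2 * u 0)) + (LINT x|\<mu>. u (x - t) - u x) / s2 t)
      \<longlongrightarrow> (1 - s2 0 / (4 * u 0) + f_u \<psi> \<beta> \<mu> 0 / (2 * u 0)) + c / 2 * (LINT x|\<mu>. deriv s2 x)) (at_right 0)" .
  then show ?thesis
  proof (rule filterlim_cong[THEN iffD1, rotated -1])
    show "\<forall>\<^sub>F t in at_right 0. (1 - s2 t / (4 * u 0) + f_u \<psi> \<beta> \<mu> 0 / (2 * u 0)) + (LINT x|\<mu>. u (x - t) - u x) / s2 t = K t t / s2 t"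
      using pos by eventually_elim (simp add: kernel_diag_eq add_divide_distrib)
  qed (simp_all add: s2_0)
qed

end

section \<open>Permanental processes near the origin\<close>

text \<open>Regular variation is condensed into \<open>q\<close> and \<open>t0\<close>: on the
  interval up to \<open>t0\<close>, halving the argument contracts \<open>sigma_sq\<close> by the
  factor \<open>q\<close>.\<close>

locale permanental_levy = symmetric_exponent_measure +
  fixes \<alpha> :: real and M :: "'b measure" and X :: "real \<Rightarrow> 'b \<Rightarrow> real" and q t0 :: real
  assumes \<alpha>: "0 < \<alpha>" and X: "permanental_process M \<alpha> (v_kernel \<psi> \<beta> \<mu>) {0..1} X"
    and q: "0 < q" "q < 1" and t0: "0 < t0" "t0 \<le> 1"
    and s2_pos: "\<And>t. 0 < t \<Longrightarrow> t \<le> t0 \<Longrightarrow> 0 < sigma_sq \<psi> \<beta> t"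
    and s2_half: "\<And>t. 0 < t \<Longrightarrow> t \<le> t0 \<Longrightarrow> sigma_sq \<psi> \<beta> (t / 2) \<le> q * sigma_sq \<psi> \<beta> t"
begin

text \<open>\<open>A\<close> is the constant of the halving bound. In \<open>B\<close>, the 4
  matches the \<open>d / 4\<close> of the increment tail and \<open>2 + mass\<close> is the constant
  of \<open>kernel_diag_diff_le\<close>.\<close>

definition "A = 1 / (1 - q)"
definition "B = 4 * (2 + mass) * A"

sublocale M: prob_space M
  using X by (simp add: permanental_process_def)

lemma X_measurable: "0 \<le> t \<Longrightarrow> t \<le> 1 \<Longrightarrow> X t \<in> borel_measurable M"
  using X by (simp add: permanental_process_def)

lemma A_pos: "0 < A" using q by (simp add: A_def)

lemma B_pos: "0 < B" using A_pos by (simp add: B_def add_pos_nonneg)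

lemma s2_bound:
  assumes "0 < T" "T \<le> t0" "\<bar>r\<bar> \<le> T / 2 ^ k"
  shows "s2 r \<le> A * q ^ k * s2 T"
proof -
  have "s2 \<bar>r\<bar> \<le> A * q ^ k * s2 T"
    unfolding A_def
    by (rule subadditive_halving_bound[OF isCont_s2 s2_0 s2_subadditive q s2_nonneg s2_half])
      (use assms in auto)
  then show ?thesis by (simp add: abs_if s2_minus split: if_splits)
qed

lemma power_q: "q ^ k = sqrt q ^ k * sqrt q ^ k" "0 < sqrt q ^ k" "sqrt q ^ k \<le> 1"
  using q by (auto simp: power_mult_distrib[symmetric] power_le_one)

text \<open>With \<open>S = A * s2 T\<close> and \<open>w = sqrt q ^ k\<close> the determinant is of
  order \<open>(S * w)^2\<close>, and its square root sets the scale. The diagonal difference is of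
  the smaller order \<open>S * w^2\<close>, as \<open>w <= 1\<close>.\<close>

lemma increment_tail:
  assumes T: "0 < T" "T \<le> t0" and s: "0 \<le> s" "s \<le> T" and t: "0 \<le> t" "t \<le> T"
    and st: "\<bar>s - t\<bar> \<le> T / 2 ^ k"
  shows "measure M {\<omega> \<in> space M. l \<le> \<bar>X s \<omega> - X t \<omega>\<bar>} \<le> 2 * 2 powr \<alpha> * exp (- (l / (B * s2 T * sqrt q ^ k)))"
proof -
  define w where "w = sqrt q ^ k"
  have w: "q ^ k = w * w" "0 < w" "w \<le> 1" using power_q[of k] by (auto simp: w_def)
  define S where "S = A * s2 T"
  have S: "0 < S" using A_pos s2_pos[OF T] by (simp add: S_def)
  define c where "c = (2 + mass) * (S * w)"
  define d where "d = 4 * c"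
  have st': "s2 (s - t) \<le> S * w * w" using s2_bound[OF T st] w by (simp add: S_def ac_simps)
  have ss: "s2 s \<le> S" "s2 t \<le> S" using s2_bound[OF T, of s 0] s2_bound[OF T, of t 0] s t by (auto simp: S_def)
  have Sw: "S * w * w \<le> S * w" using S w by (intro mult_left_le) auto
  have "\<bar>K s s - K t t\<bar> \<le> (2 + mass) * s2 (s - t)" by (rule kernel_diag_diff_le)
  also have "\<dots> \<le> c" unfolding c_def using st' Sw by (intro mult_left_mono) auto
  finally have 1: "\<bar>K s s - K t t\<bar> \<le> d / 4" by (simp add: d_def)
  have "K s s * K t t - K s t * K t s \<le> (1 + mass) * s2 (s - t) * (s2 s + s2 t)" by (rule kernel_det_le)
  also have "\<dots> \<le> (1 + mass) * (S * w * w) * (2 * S)"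
    using st' ss s2_nonneg S w by (intro mult_mono) auto
  also have "\<dots> = 2 * (1 + mass) * (S * w)\<^sup>2" by (simp add: power2_eq_square)
  also have "\<dots> \<le> 4 * (2 + mass)\<^sup>2 * (S * w)\<^sup>2"
  proof (rule mult_right_mono)
    have "2 * (1 + x) \<le> 4 * (2 + x)\<^sup>2" if "0 \<le> x" for x :: real
      using that mult_nonneg_nonneg[OF that that] by (simp add: power2_eq_square algebra_simps)
    then show "2 * (1 + mass) \<le> 4 * (2 + mass)\<^sup>2" by simp
  qed simp
  also have "\<dots> = d\<^sup>2 / 4" by (simp add: d_def c_def power_mult_distrib)
  finally have 2: "K s s * K t t - K s t * K t s \<le> d\<^sup>2 / 4" .
  have "0 < d" using S w by (simp add: d_def c_def add_pos_nonneg)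
  then have tail: "M.prob {\<omega> \<in> space M. l \<le> \<bar>X s \<omega> - X t \<omega>\<bar>} \<le> 2 * 2 powr \<alpha> * exp (- (l / d))"
    using s t T t0 by (intro permanental_increment_tail[OF X _ _ _ \<alpha> 1 2]) auto
  have "B * s2 T * sqrt q ^ k = d"
    unfolding d_def c_def S_def B_def w_def by (simp only: mult.assoc mult.commute mult.left_commute)
  with tail show ?thesis by simp
qed

text \<open>By subadditivity \<open>s2 T\<close> exceeds \<open>s2 s\<close> by at most
  \<open>s2 (T - s)\<close>, which is a small fraction of \<open>s2 T\<close> on a short final
  block.\<close>

lemma s2_oscillation:
  assumes "0 < T" "T \<le> t0" "T - T / 2 ^ k \<le> s" "s \<le> T"
  shows "s2 T * (1 - A * sqrt q ^ k) \<le> s2 s"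
proof -
  have "s2 T \<le> s2 s + s2 (T - s)" using s2_subadditive[of s "T - s"] by simp
  also have "s2 (T - s) \<le> A * q ^ k * s2 T" using assms by (intro s2_bound) auto
  also have "A * q ^ k * s2 T \<le> A * sqrt q ^ k * s2 T"
    using A_pos power_q[of k] s2_nonneg by (intro mult_right_mono mult_left_mono) (auto intro: mult_left_le)
  finally show ?thesis by (simp add: algebra_simps)
qed

lemma continuous_version_exists: "\<exists>Y. continuous_version M X t0 Y"
proof -
  obtain Y where Y: "\<And>t. 0 \<le> t \<Longrightarrow> t \<le> t0 \<Longrightarrow> Y t \<in> borel_measurable M"
    "\<And>t. 0 \<le> t \<Longrightarrow> t \<le> t0 \<Longrightarrow> AE \<omega> in M. Y t \<omega> = X t \<omega>"
    "AE \<omega> in M. continuous_on {0..t0} (\<lambda>t. Y t \<omega>)"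
  proof (rule M.continuous_modification[where X = X and T = t0 and b = "B * s2 t0" and Q = "sqrt q" and C = "2 * 2 powr \<alpha>"])
    show "0 < B * s2 t0" using B_pos s2_pos t0 by simp
    show "0 < sqrt q" "sqrt q < 1" using q by auto
    show "(0::real) \<le> 2 * 2 powr \<alpha>" by simp
    show "M.prob {\<omega> \<in> space M. l \<le> \<bar>X s \<omega> - X t \<omega>\<bar>} \<le> 2 * 2 powr \<alpha> * exp (- (l / (B * s2 t0 * sqrt q ^ k)))"
      if "0 \<le> s" "s \<le> t0" "0 \<le> t" "t \<le> t0" "\<bar>s - t\<bar> \<le> t0 / 2 ^ k" for k s t l
      using that t0 by (intro increment_tail) auto
  qed (use t0 X_measurable in auto)
  \<comment> \<open>A version is required on all of [0, 1], continuity only up to \<open>t0\<close>;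
    beyond \<open>t0\<close> the original \<open>X\<close> is kept.\<close>
  have "continuous_version M X t0 (\<lambda>t. if t \<le> t0 then Y t else X t)"
    unfolding continuous_version_def version_on_def
  proof (intro conjI ballI)
    show "AE \<omega> in M. continuous_on {0..t0} (\<lambda>t. (if t \<le> t0 then Y t else X t) \<omega>)"
      using Y(3)
    proof eventually_elim
      case (elim \<omega>)
      then show ?case by (subst continuous_on_cong[OF refl, of _ _ "\<lambda>t. Y t \<omega>"]) auto
    qed
  qed (use Y X_measurable in auto)
  then show ?thesis by blast
qed

text \<open>Tail bounds concern laws at one or two times, so they pass from \<open>X\<close> to
  every version \<open>Y\<close>.\<close>

lemma iterated_log_bound_aux:
  assumes Y: "continuous_version M X \<delta> Y" and \<delta>: "0 < \<delta>" "\<delta> \<le> 1"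
    and L: "0 \<le> L" "((\<lambda>t. K t t / s2 t) \<longlongrightarrow> L) (at_right 0)"
    and m: "1 \<le> m" "A * sqrt q ^ m < 1" and \<eta>: "0 < \<eta>" "\<eta> < 1"
  shows "AE \<omega> in M. \<forall>\<^sub>F t in at_right 0. Y t \<omega> \<le>
    ((1 + \<eta>) * (L + 2 * \<eta>) + B * sqrt q ^ m * (\<Sum>k. 2 * real (k + 1) * sqrt q ^ k))
      / ((1 - A * sqrt q ^ m) * (1 - \<eta>)) * (s2 t * ln (ln (1 / t)))"
proof -
  have "\<forall>\<^sub>F t in at_right 0. K t t / s2 t < L + \<eta>"
    using L(2) \<eta> by (intro order_tendstoD) auto
  then obtain t1 where t1: "0 < t1" "\<And>t. 0 < t \<Longrightarrow> t < t1 \<Longrightarrow> K t t / s2 t < L + \<eta>"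
    unfolding eventually_at_right_field by blast
  define \<delta>' where "\<delta>' = min (min \<delta> t0) (t1 / 2)"
  have \<delta>': "0 < \<delta>'" "\<delta>' \<le> \<delta>" "\<delta>' \<le> t0" "\<delta>' < t1" using \<delta> t0 t1 by (auto simp: \<delta>'_def)
  have Ym: "Y t \<in> borel_measurable M" and YX: "AE \<omega> in M. Y t \<omega> = X t \<omega>" if "0 \<le> t" "t \<le> 1" for t
    using Y that by (auto simp: continuous_version_def version_on_def)
  \<comment> \<open>Near 0 the kernel ratio is below \<open>L + \<eta>\<close>, so the scale
    \<open>(L + 2 * \<eta>) * s2 t\<close> leaves the gap \<open>\<kappa>\<close> before the blow-up
    of the moment; it is positive even if \<open>L = 0\<close>.\<close>
  define \<kappa> where "\<kappa> = \<eta> / (L + 2 * \<eta>)"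
  have \<kappa>: "0 < \<kappa>" using L \<eta> by (simp add: \<kappa>_def)
  show ?thesis
  proof (rule M.iterated_log_upper_bound)
    show "AE \<omega> in M. continuous_on {0..\<delta>'} (\<lambda>t. Y t \<omega>)"
      using Y \<delta>' unfolding continuous_version_def by (auto elim!: eventually_mono intro: continuous_on_subset)
    show "(0::real) \<le> 2 * 2 powr \<alpha>" "0 \<le> \<kappa> powr (- \<alpha>)" by auto
    show "M.prob {\<omega> \<in> space M. l \<le> \<bar>Y s \<omega> - Y t \<omega>\<bar>} \<le> 2 * 2 powr \<alpha> * exp (- (l / (B * s2 T * sqrt q ^ k)))"
      if "0 < T" "T \<le> \<delta>'" "0 \<le> s" "s \<le> T" "0 \<le> t" "t \<le> T" "\<bar>s - t\<bar> \<le> T / 2 ^ k" for T k s t l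
    proof -
      have st: "0 \<le> s" "s \<le> 1" "0 \<le> t" "t \<le> 1" using that \<delta>' \<delta> by auto
      note [measurable] = Ym[OF st(1,2)] Ym[OF st(3,4)] X_measurable[OF st(1,2)] X_measurable[OF st(3,4)]
      have "M.prob {\<omega> \<in> space M. l \<le> \<bar>Y s \<omega> - Y t \<omega>\<bar>} = M.prob {\<omega> \<in> space M. l \<le> \<bar>X s \<omega> - X t \<omega>\<bar>}"
        using YX[OF st(1,2)] YX[OF st(3,4)] by (intro M.finite_measure_eq_AE) (auto elim: AE_mp)
      also have "\<dots> \<le> 2 * 2 powr \<alpha> * exp (- (l / (B * s2 T * sqrt q ^ k)))"
        using that \<delta>' by (intro increment_tail) auto
      finally show ?thesis .
    qed
    show "M.prob {\<omega> \<in> space M. l \<le> Y t \<omega>} \<le> \<kappa> powr (- \<alpha>) * exp (- (l / ((L + 2 * \<eta>) * s2 t)))"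
      if t: "0 < t" "t \<le> \<delta>'" for t l
    proof -
      have t': "0 \<le> t" "t \<le> 1" using that \<delta>' \<delta> by auto
      note [measurable] = Ym[OF t'] X_measurable[OF t']
      have "M.prob {\<omega> \<in> space M. l \<le> Y t \<omega>} = M.prob {\<omega> \<in> space M. l \<le> X t \<omega>}"
        using YX[OF t'] by (intro M.finite_measure_eq_AE) (auto elim: AE_mp)
      also have "\<dots> \<le> \<kappa> powr (- \<alpha>) * exp (- (1 / ((L + 2 * \<eta>) * s2 t) * l))"
      proof (rule permanental_tail[OF X])
        have s: "0 < s2 t" using t \<delta>' by (intro s2_pos) auto
        show "0 < 1 / ((L + 2 * \<eta>) * s2 t)" using s L \<eta> by simp
        have "K t t / s2 t / (L + 2 * \<eta>) \<le> (L + \<eta>) / (L + 2 * \<eta>)"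
          using t1(2)[of t] t \<delta>' L \<eta> by (intro divide_right_mono) auto
        also have "\<dots> = 1 - \<kappa>" using L \<eta> by (simp add: \<kappa>_def field_simps)
        finally show "1 / ((L + 2 * \<eta>) * s2 t) * K t t \<le> 1 - \<kappa>" by (simp add: mult.commute)
      qed (use t' \<kappa> \<alpha> in auto)
      finally show ?thesis by simp
    qed
    show "s2 T * (1 - A * sqrt q ^ k) \<le> s2 s" if "0 < T" "T \<le> \<delta>'" "T - T / 2 ^ k \<le> s" "s \<le> T" for T k s
      using that \<delta>' by (intro s2_oscillation) auto
  qed (use \<delta> \<delta>' q L \<eta> m B_pos in \<open>auto intro!: Ym s2_pos\<close>)
qed

lemma iterated_log_bound:
  assumes Y: "continuous_version M X \<delta> Y" and \<delta>: "0 < \<delta>" "\<delta> \<le> 1"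
    and L: "((\<lambda>t. K t t / s2 t) \<longlongrightarrow> L) (at_right 0)"
  shows "AE \<omega> in M. \<forall>e>L. \<forall>\<^sub>F t in at_right 0. Y t \<omega> \<le> e * (s2 t * ln (ln (1 / t)))"
proof -
  have ev01: "\<forall>\<^sub>F t in at_right (0::real). 0 < t \<and> t < t0"
    using eventually_at_right_real[OF t0(1)] by (simp add: greaterThanLessThan_iff)
  have L0: "0 \<le> L"
  proof (rule tendsto_lowerbound[OF L])
    show "\<forall>\<^sub>F t in at_right 0. 0 \<le> K t t / s2 t"
      using ev01
    proof eventually_elim
      case (elim t)
      have "0 \<le> K t t" by (rule permanental_diag_nonneg[OF X]) (use elim t0 in auto)
      then show ?case using s2_nonneg by simp
    qed
  qed simp
  define \<eta> where "\<eta> n = 1 / real (Suc n)" for n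
  define S where "S = (\<Sum>k. 2 * real (k + 1) * sqrt q ^ k)"
  \<comment> \<open>Both free parameters are tied to one integer, \<open>m = n\<close> and
    \<open>\<eta> n = 1 / (n + 1)\<close>, so that countably many null sets suffice for all
    \<open>e > L\<close> at once.\<close>
  define b where "b n = ((1 + \<eta> n) * (L + 2 * \<eta> n) + B * sqrt q ^ n * S) / ((1 - A * sqrt q ^ n) * (1 - \<eta> n))" for n
  have Q0: "(\<lambda>n. sqrt q ^ n) \<longlonglongrightarrow> 0" using q by (intro LIMSEQ_realpow_zero) auto
  have \<eta>0: "\<eta> \<longlonglongrightarrow> 0" unfolding \<eta>_def by (rule LIMSEQ_Suc[OF lim_1_over_n])
  have "b \<longlonglongrightarrow> ((1 + 0) * (L + 2 * 0) + B * 0 * S) / ((1 - A * 0) * (1 - 0))"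
    unfolding b_def by (intro tendsto_intros Q0 \<eta>0) auto
  then have bL: "b \<longlonglongrightarrow> L" by simp
  have "(\<lambda>n. A * sqrt q ^ n) \<longlonglongrightarrow> A * 0" by (intro tendsto_intros Q0)
  then have AQ: "\<forall>\<^sub>F n in sequentially. A * sqrt q ^ n < 1" by (intro order_tendstoD) auto
  have "AE \<omega> in M. \<forall>n. 1 \<le> n \<and> A * sqrt q ^ n < 1 \<longrightarrow>
      (\<forall>\<^sub>F t in at_right 0. Y t \<omega> \<le> b n * (s2 t * ln (ln (1 / t))))"
    unfolding AE_all_countable
  proof (intro allI)
    fix n
    show "AE \<omega> in M. 1 \<le> n \<and> A * sqrt q ^ n < 1 \<longrightarrow>
        (\<forall>\<^sub>F t in at_right 0. Y t \<omega> \<le> b n * (s2 t * ln (ln (1 / t))))"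
    proof (cases "1 \<le> n \<and> A * sqrt q ^ n < 1")
      case True
      \<comment> \<open>\<open>\<eta> 0 = 1\<close>, hence the restriction to
        \<open>n >= 1\<close>.\<close>
      then have "0 < \<eta> n" "\<eta> n < 1" by (auto simp: \<eta>_def)
      from iterated_log_bound_aux[OF Y \<delta> L0 L _ _ this] True show ?thesis by (simp add: b_def S_def)
    qed auto
  qed
  then show ?thesis
  proof eventually_elim
    case (elim \<omega>)
    show ?case
    proof (intro allI impI)
      fix e assume "L < e"
      then have "\<forall>\<^sub>F n in sequentially. b n < e" using bL by (intro order_tendstoD)
      then have "\<forall>\<^sub>F n in sequentially. b n < e \<and> A * sqrt q ^ n < 1 \<and> 1 \<le> n"
        using AQ by (intro eventually_conj eventually_ge_at_top)
      then obtain n where n: "b n < e" "A * sqrt q ^ n < 1" "1 \<le> n"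
        using eventually_happens'[OF sequentially_bot] by blast
      then have "\<forall>\<^sub>F t in at_right 0. Y t \<omega> \<le> b n * (s2 t * ln (ln (1 / t)))" using elim by blast
      moreover have "\<forall>\<^sub>F t in at_right (0::real). 0 < ln (ln (1 / t))" by real_asymp
      ultimately show "\<forall>\<^sub>F t in at_right 0. Y t \<omega> \<le> e * (s2 t * ln (ln (1 / t)))"
      proof eventually_elim
        case (elim t)
        have "b n * (s2 t * ln (ln (1 / t))) \<le> e * (s2 t * ln (ln (1 / t)))"
          using n elim s2_nonneg[of t] by (intro mult_right_mono) auto
        with elim show ?case by simp
      qed
    qed
  qed
qed

lemma Limsup_sigma_bound:
  assumes Y: "continuous_version M X \<delta> Y" and \<delta>: "0 < \<delta>" "\<delta> \<le> 1"
    and L: "((\<lambda>t. K t t / s2 t) \<longlongrightarrow> L) (at_right 0)"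
  shows "AE \<omega> in M. Limsup (at_right 0) (\<lambda>t. ereal (Y t \<omega> / (s2 t * ln (ln (1 / t))))) \<le> ereal L"
  using iterated_log_bound[OF assms]
proof eventually_elim
  case (elim \<omega>)
  show ?case
  proof (rule Limsup_le_ereal)
    fix e assume "L < e"
    with elim have "\<forall>\<^sub>F t in at_right 0. Y t \<omega> \<le> e * (s2 t * ln (ln (1 / t)))" by blast
    moreover have "\<forall>\<^sub>F t in at_right (0::real). 0 < ln (ln (1 / t))" by real_asymp
    moreover have "\<forall>\<^sub>F t in at_right (0::real). t \<in> {0<..<t0}" by (rule eventually_at_right_real[OF t0(1)])
    ultimately show "\<forall>\<^sub>F t in at_right 0. Y t \<omega> / (s2 t * ln (ln (1 / t))) \<le> e"
    proof eventually_elim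
      case (elim t)
      then have "0 < s2 t * ln (ln (1 / t))" using s2_pos[of t] by simp
      then show ?case using elim by (simp add: pos_divide_le_eq)
    qed
  qed
qed

lemma Limsup_linear_bound:
  assumes Y: "continuous_version M X \<delta> Y" and \<delta>: "0 < \<delta>" "\<delta> \<le> 1" and C: "0 < C"
    and L: "((\<lambda>t. K t t / s2 t) \<longlongrightarrow> L) (at_right 0)"
    and lin: "((\<lambda>t. t / s2 t) \<longlongrightarrow> 1 / C) (at_right 0)"
  shows "AE \<omega> in M. Limsup (at_right 0) (\<lambda>t. ereal (Y t \<omega> / (C * t * ln (ln (1 / t))))) \<le> ereal L"
  using iterated_log_bound[OF Y \<delta> L]
proof eventually_elim
  case (elim \<omega>)
  show ?case
  proof (rule Limsup_le_ereal)
    fix e assume e: "L < e"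
    \<comment> \<open>The midpoint leaves room for the factor \<open>s2 t / (C * t)\<close>, which
      tends to 1 and converts one normalisation into the other.\<close>
    define e' where "e' = (L + e) / 2"
    have e': "L < e'" "e' < e" using e by (auto simp: e'_def)
    have "((\<lambda>t. e' * (inverse (t / s2 t) / C)) \<longlongrightarrow> e' * (inverse (1 / C) / C)) (at_right 0)"
      using C by (intro tendsto_intros lin) auto
    then have "\<forall>\<^sub>F t in at_right 0. e' * (inverse (t / s2 t) / C) < e"
      using C e' by (intro order_tendstoD) auto
    moreover from elim e' have "\<forall>\<^sub>F t in at_right 0. Y t \<omega> \<le> e' * (s2 t * ln (ln (1 / t)))" by blast
    moreover have "\<forall>\<^sub>F t in at_right (0::real). 0 < ln (ln (1 / t))" by real_asymp
    moreover have "\<forall>\<^sub>F t in at_right (0::real). t \<in> {0<..<t0}" by (rule eventually_at_right_real[OF t0(1)])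
    ultimately show "\<forall>\<^sub>F t in at_right 0. Y t \<omega> / (C * t * ln (ln (1 / t))) \<le> e"
    proof eventually_elim
      case (elim t)
      have pos: "0 < C * t * ln (ln (1 / t))" using elim C by simp
      have "e' * (s2 t * ln (ln (1 / t))) = e' * (inverse (t / s2 t) / C) * (C * t * ln (ln (1 / t)))"
        using C elim by simp
      also have "\<dots> \<le> e * (C * t * ln (ln (1 / t)))"
        using elim pos by (intro mult_right_mono) auto
      finally show ?case unfolding pos_divide_le_eq[OF pos] by (rule order.trans[OF elim(2)])
    qed
  qed
qed

end

text \<open>The ratio of \<open>f (t / 2)\<close> to \<open>f t\<close> tends to
  \<open>(1 / 2) powr \<rho>\<close>, which is below 1 because the index is positive;
  \<open>q\<close> is the midpoint between this limit and 1.\<close>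

lemma regularly_varying_at_zero_halving:
  assumes "regularly_varying_at_zero f \<rho>" "0 < \<rho>"
  obtains q t0 where "0 < q" "q < 1" "0 < t0" "t0 \<le> 1"
    "\<And>t. 0 < t \<Longrightarrow> t \<le> t0 \<Longrightarrow> 0 < f t" "\<And>t. 0 < t \<Longrightarrow> t \<le> t0 \<Longrightarrow> f (t / 2) \<le> q * f t"
proof -
  have half: "(1 / 2) powr \<rho> < (1::real)" using powr_less_mono'[of "1 / 2" 0 \<rho>] assms(2) by simp
  define q where "q = (1 + (1 / 2) powr \<rho>) / 2"
  have q: "0 < q" "q < 1" "(1 / 2) powr \<rho> < q" using half by (auto simp: q_def add_pos_nonneg)
  have pos: "\<forall>\<^sub>F t in at_right 0. 0 < f t" using assms by (simp add: regularly_varying_at_zero_def)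
  have "((\<lambda>t. f (1 / 2 * t) / f t) \<longlongrightarrow> (1 / 2) powr \<rho>) (at_right 0)"
    using assms(1) unfolding regularly_varying_at_zero_def by (elim conjE allE[of _ "1 / 2"]) simp
  then have "\<forall>\<^sub>F t in at_right 0. f (1 / 2 * t) / f t < q" using q by (intro order_tendstoD)
  with pos have "\<forall>\<^sub>F t in at_right 0. 0 < f t \<and> f (1 / 2 * t) / f t < q" by (rule eventually_conj)
  then obtain b where b: "0 < b" "\<And>t. 0 < t \<Longrightarrow> t < b \<Longrightarrow> 0 < f t \<and> f (1 / 2 * t) / f t < q"
    unfolding eventually_at_right_field by blast
  show ?thesis
  proof (rule that[of q "min (b / 2) 1"])
    fix t assume t: "0 < t" "t \<le> min (b / 2) 1"
    then have "0 < f t \<and> f (1 / 2 * t) / f t < q" using b by (intro b(2)) auto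
    then show "0 < f t" "f (t / 2) \<le> q * f t" by (auto simp: pos_divide_less_eq)
  qed (use q b in auto)
qed

theorem theorem1p5:
  fixes N :: "'a measure" and Z :: "real \<Rightarrow> 'a \<Rightarrow> real" and \<psi> :: "real \<Rightarrow> real"
    and \<beta> :: real and \<mu> :: "real measure"
    and \<alpha> :: real and M :: "'b measure" and X :: "real \<Rightarrow> 'b \<Rightarrow> real"
  assumes "levy_process N Z" and "symmetric_process N Z"
    and "characteristic_exponent N Z \<psi>"
    and "\<And>l. \<psi> (- l) = \<psi> l"
    and "integrable lborel (\<lambda>l. 1 / (1 + \<psi> l))"
    and "\<beta> > 0"
    and "finite_measure \<mu>" and "sets \<mu> = sets borel" and "emeasure \<mu> {0} = 0"
    and "\<alpha> > 0"
    and "permanental_process M \<alpha> (v_kernel \<psi> \<beta> \<mu>) {0..1} X"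
    and "sigma_sq \<psi> \<beta> C1_differentiable_on (UNIV - {0})"
    and "\<And>\<Delta>. \<Delta> > 0 \<Longrightarrow> bounded ((\<lambda>x. \<bar>deriv (sigma_sq \<psi> \<beta>) x\<bar>) ` ({..< - \<Delta>} \<union> {\<Delta><..}))"
    and "\<exists>\<rho>>0. regularly_varying_at_zero (sigma_sq \<psi> \<beta>) \<rho>"
  shows "(\<exists>\<delta> Y. 0 < \<delta> \<and> \<delta> \<le> 1 \<and> continuous_version M X \<delta> Y) \<and>
    (\<forall>\<delta> Y. 0 < \<delta> \<and> \<delta> \<le> 1 \<and> continuous_version M X \<delta> Y \<longrightarrow>
      (((\<lambda>t. t / sigma_sq \<psi> \<beta> t) \<longlongrightarrow> 0) (at_right 0) \<longrightarrow>
        (AE \<omega> in M.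
          Limsup (at_right 0) (\<lambda>t. ereal (Y t \<omega> / (sigma_sq \<psi> \<beta> t * ln (ln (1 / t)))))
            \<le> ereal (1 + f_u \<psi> \<beta> \<mu> 0 / (2 * u_pot \<psi> \<beta> 0)))) \<and>
      (\<forall>C>0. ((\<lambda>t. t / sigma_sq \<psi> \<beta> t) \<longlongrightarrow> 1 / C) (at_right 0) \<longrightarrow>
        (AE \<omega> in M.
          Limsup (at_right 0) (\<lambda>t. ereal (Y t \<omega> / (C * t * ln (ln (1 / t)))))
            \<le> ereal (1 + f_u \<psi> \<beta> \<mu> 0 / (2 * u_pot \<psi> \<beta> 0)
                      + 1 / (2 * C) * (LINT x|\<mu>. deriv (sigma_sq \<psi> \<beta>) x)))))"
proof -
  obtain \<rho> where \<rho>: "0 < \<rho>" "regularly_varying_at_zero (sigma_sq \<psi> \<beta>) \<rho>" using assms(14) by blast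
  obtain q t0 where qt: "0 < q" "q < 1" "0 < t0" "t0 \<le> 1"
      "\<And>t. 0 < t \<Longrightarrow> t \<le> t0 \<Longrightarrow> 0 < sigma_sq \<psi> \<beta> t"
      "\<And>t. 0 < t \<Longrightarrow> t \<le> t0 \<Longrightarrow> sigma_sq \<psi> \<beta> (t / 2) \<le> q * sigma_sq \<psi> \<beta> t"
    using regularly_varying_at_zero_halving[OF \<rho>(2,1)] by blast
  interpret symmetric_exponent N Z \<psi> \<beta>
    using assms by (intro symmetric_exponent.intro symmetric_exponent_axioms.intro)
      (auto simp: levy_process_def)
  interpret symmetric_exponent_measure N Z \<psi> \<beta> \<mu>
    using assms u0_pos[OF qt(5)[OF qt(3) order_refl]]
    by (intro symmetric_exponent_measure.intro symmetric_exponent_measure_axioms.intro symmetric_exponent_axioms)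
  interpret permanental_levy N Z \<psi> \<beta> \<mu> \<alpha> M X q t0
    using assms qt
    by (intro permanental_levy.intro permanental_levy_axioms.intro symmetric_exponent_measure_axioms)
  \<comment> \<open>In (i) \<open>c = 0\<close> removes the integral term; in (ii)
    \<open>c = 1 / C\<close> gives it the coefficient \<open>1 / (2 * C)\<close>.\<close>
  have diag: "((\<lambda>t. v_kernel \<psi> \<beta> \<mu> t t / sigma_sq \<psi> \<beta> t)
      \<longlongrightarrow> 1 + f_u \<psi> \<beta> \<mu> 0 / (2 * u_pot \<psi> \<beta> 0) + c / 2 * (LINT x|\<mu>. deriv (sigma_sq \<psi> \<beta>) x)) (at_right 0)"
    if "((\<lambda>t. t / sigma_sq \<psi> \<beta> t) \<longlongrightarrow> c) (at_right 0)" for c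
    using \<rho>(2) by (intro kernel_diag_asymptotics assms that) (simp add: regularly_varying_at_zero_def)
  show ?thesis
  proof (intro conjI allI impI)
    show "\<exists>\<delta> Y. 0 < \<delta> \<and> \<delta> \<le> 1 \<and> continuous_version M X \<delta> Y"
      using continuous_version_exists qt(3,4) by blast
  next
    fix \<delta> Y assume Y: "0 < \<delta> \<and> \<delta> \<le> 1 \<and> continuous_version M X \<delta> Y"
      and lim: "((\<lambda>t. t / sigma_sq \<psi> \<beta> t) \<longlongrightarrow> 0) (at_right 0)"
    show "AE \<omega> in M. Limsup (at_right 0) (\<lambda>t. ereal (Y t \<omega> / (sigma_sq \<psi> \<beta> t * ln (ln (1 / t)))))
            \<le> ereal (1 + f_u \<psi> \<beta> \<mu> 0 / (2 * u_pot \<psi> \<beta> 0))"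
      using Limsup_sigma_bound[OF _ _ _ diag[OF lim], of \<delta> Y] Y by simp
  next
    fix \<delta> Y and C :: real
    assume Y: "0 < \<delta> \<and> \<delta> \<le> 1 \<and> continuous_version M X \<delta> Y" and C: "0 < C"
      and lim: "((\<lambda>t. t / sigma_sq \<psi> \<beta> t) \<longlongrightarrow> 1 / C) (at_right 0)"
    show "AE \<omega> in M. Limsup (at_right 0) (\<lambda>t. ereal (Y t \<omega> / (C * t * ln (ln (1 / t)))))
            \<le> ereal (1 + f_u \<psi> \<beta> \<mu> 0 / (2 * u_pot \<psi> \<beta> 0)
                      + 1 / (2 * C) * (LINT x|\<mu>. deriv (sigma_sq \<psi> \<beta>) x))"
      using Limsup_linear_bound[OF _ _ _ C diag[OF lim] lim, of \<delta> Y] Y by (simp add: mult.commute)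
  qed
qed

end
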